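(* Let $n\ge 2$ and equip the complex projective space $\mathbb{CP}^n$ with its standard Fubini–Study metric. Then any smooth area non-increasing self map $f:\mathbb{CP}^n\to\mathbb{CP}^n$ is either homotopically trivial or an isometry.
   Context: For a smooth map $f:(M,g)\to(N,h)$ and $x\in M$, let $\lambda_1,\dots,\lambda_{\dim M}\ge 0$ be the singular values of $df_x$, i.e. $\lambda_i^2$ are the eigenvalues of $f^*h$ with respect to $g$ at $x$. The map $f$ is area non-increasing if $\lambda_i\lambda_j\le 1$ for all $i\ne j$ at every point. A map is homotopically trivial if it is homotopic to a constant map. *)

theory Defs
  imports "HOL-Analysis.Analysis"
begin

section \<open>Complex projective space\<close>

text \<open>
  Homogeneous coordinates on \<open>CP\<^sup>n\<close> with \<open>n = CARD('n)\<close> are indexed by the \<open>n + 1\<close> elements of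
  \<^typ>\<open>'n option\<close>.
\<close>

definition proj_rel :: "complex^('n::finite option) \<Rightarrow> complex^('n option) \<Rightarrow> bool" where
  "proj_rel x y \<longleftrightarrow> x \<noteq> 0 \<and> (\<exists>c. c \<noteq> 0 \<and> y = c *s x)"

lemma proj_rel_part_equivp: "part_equivp (proj_rel :: complex^('n::finite option) \<Rightarrow> _)"
proof (rule part_equivpI)
  have "proj_rel (\<chi> i. 1) ((\<chi> i. 1) :: complex^('n::finite option))"
    unfolding proj_rel_def by (auto simp: vec_eq_iff intro!: exI[of _ 1])
  then show "\<exists>x::complex^('n::finite option). proj_rel x x" by blast
  show "symp (proj_rel :: complex^('n::finite option) \<Rightarrow> _)"
  proof (rule sympI)
    fix x y :: "complex^('n::finite option)"
    assume "proj_rel x y"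
    then obtain c where c: "x \<noteq> 0" "c \<noteq> 0" "y = c *s x" by (auto simp: proj_rel_def)
    then have "y \<noteq> 0" "x = inverse c *s y" by (auto simp: vector_smult_assoc)
    then show "proj_rel y x" using c unfolding proj_rel_def by (metis inverse_nonzero_iff_nonzero)
  qed
  show "transp (proj_rel :: complex^('n::finite option) \<Rightarrow> _)"
    by (rule transpI) (auto simp: proj_rel_def vector_smult_assoc intro: no_zero_divisors)
qed

quotient_type 'n cproj = "complex^('n::finite option)" / partial: proj_rel
  morphisms rep_cproj to_cproj
  by (rule proj_rel_part_equivp)

text \<open>
  The quotient topology of \<open>C\<^sup>n\<^sup>+\<^sup>1 - {0}\<close>; a subset of this open set is relatively open iff it is open.
\<close>

instantiation cproj :: (finite) topological_space
begin

definition open_cproj :: "'a cproj set \<Rightarrow> bool" where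
  "open_cproj U \<longleftrightarrow> open {z. z \<noteq> 0 \<and> to_cproj z \<in> U}"

instance
proof
  have "{z::complex^('a option). z \<noteq> 0 \<and> to_cproj z \<in> UNIV} = - {0}" by auto
  then show "open (UNIV :: 'a cproj set)"
    unfolding open_cproj_def by (simp add: open_Compl)
next
  fix S T :: "'a cproj set"
  assume "open S" "open T"
  moreover have "{z. z \<noteq> 0 \<and> to_cproj z \<in> S \<inter> T} =
      {z. z \<noteq> 0 \<and> to_cproj z \<in> S} \<inter> {z. z \<noteq> 0 \<and> to_cproj z \<in> T}" by auto
  ultimately show "open (S \<inter> T)"
    unfolding open_cproj_def by (simp add: open_Int)
next
  fix K :: "'a cproj set set"
  assume "\<forall>S\<in>K. open S"
  moreover have "{z. z \<noteq> 0 \<and> to_cproj z \<in> \<Union>K} =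
      (\<Union>S\<in>K. {z. z \<noteq> 0 \<and> to_cproj z \<in> S})" by auto
  ultimately show "open (\<Union>K)"
    unfolding open_cproj_def by (auto intro!: open_UN)
qed

end

text \<open>
  The affine chart around the points whose homogeneous coordinate \<open>i\<close> is nonzero. The remaining \<open>n\<close>
  coordinates are indexed by \<^typ>\<open>'n\<close> through the transposition of \<^term>\<open>None\<close> and \<open>i\<close>.
\<close>

definition affine_lift :: "'n::finite option \<Rightarrow> complex^'n \<Rightarrow> complex^('n option)" where
  "affine_lift i w =
     (\<chi> j. case Transposition.transpose None i j of None \<Rightarrow> 1 | Some k \<Rightarrow> w $ k)"

definition affine_param :: "'n::finite option \<Rightarrow> complex^'n \<Rightarrow> 'n cproj" where
  "affine_param i w = to_cproj (affine_lift i w)"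

definition affine_domain :: "'n::finite option \<Rightarrow> 'n cproj set" where
  "affine_domain i = to_cproj ` {z. z $ i \<noteq> 0}"

lift_definition affine_chart :: "'n::finite option \<Rightarrow> 'n cproj \<Rightarrow> complex^'n" is
  "\<lambda>i z. \<chi> k. z $ Transposition.transpose None i (Some k) / z $ i"
  by (auto simp: proj_rel_def vec_eq_iff)

lemma affine_lift_nth_self [simp]: "affine_lift i w $ i = 1"
  by (simp add: affine_lift_def)

lemma affine_lift_nonzero [simp]: "affine_lift i w \<noteq> 0"
  by (metis affine_lift_nth_self zero_index zero_neq_one)

lemma proj_rel_refl: "z \<noteq> 0 \<Longrightarrow> proj_rel z z"
  unfolding proj_rel_def by (auto intro!: exI[of _ 1])

lemma affine_chart_to_cproj:
  assumes "z \<noteq> 0"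
  shows "affine_chart i (to_cproj z) =
           (\<chi> k. z $ Transposition.transpose None i (Some k) / z $ i)"
  using assms by (simp add: affine_chart.abs_eq proj_rel_refl)

lemma affine_chart_param: "affine_chart i (affine_param i w) = w"
proof -
  have "affine_lift i w $ Transposition.transpose None i (Some k) = w $ k" for k
    by (simp add: affine_lift_def)
  then show ?thesis by (simp add: affine_param_def affine_chart_to_cproj)
qed

lemma affine_param_chart:
  assumes "p \<in> affine_domain i"
  shows "affine_param i (affine_chart i p) = p"
proof -
  obtain z where z: "z $ i \<noteq> 0" "p = to_cproj z"
    using assms by (auto simp: affine_domain_def)
  then have nz: "z \<noteq> 0" by auto
  have "z $ i * affine_lift i (affine_chart i p) $ j = z $ j" for j
  proof (cases "Transposition.transpose None i j")
    case None
    then have "j = i" by (metis transpose_apply_first transpose_involutory)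
    then show ?thesis by simp
  next
    case (Some k)
    then have "Transposition.transpose None i (Some k) = j" by (metis transpose_involutory)
    then show ?thesis using Some z nz by (simp add: affine_lift_def affine_chart_to_cproj)
  qed
  then have "z = z $ i *s affine_lift i (affine_chart i p)" by (simp add: vec_eq_iff)
  then have "proj_rel (affine_lift i (affine_chart i p)) z"
    unfolding proj_rel_def using z by (metis affine_lift_nonzero)
  then show ?thesis
    unfolding affine_param_def z(2) using Quotient_rel_abs[OF Quotient_cproj] by metis
qed

lemma affine_domain_eq_range: "affine_domain i = range (affine_param i)"
proof
  show "affine_domain i \<subseteq> range (affine_param i)"
    using affine_param_chart by (metis rangeI subsetI)
  show "range (affine_param i) \<subseteq> affine_domain i"
    by (auto simp: affine_domain_def affine_param_def)
qed

section \<open>The Fubini--Study metric\<close>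

definition herm :: "complex^'n::finite \<Rightarrow> complex^'n \<Rightarrow> complex" where
  "herm u v = (\<Sum>k\<in>UNIV. u $ k * cnj (v $ k))"

text \<open>
  The Riemannian metric with value \<open>Re (\<Sum>\<^sub>j\<^sub>k g\<^sub>j\<^sub>k u\<^sub>j cnj v\<^sub>k)\<close> in an affine chart, where \<open>g\<^sub>j\<^sub>k\<close> is the complex Hessian
  of the potential \<open>log (1 + |w|\<^sup>2)\<close>. It makes the Hopf fibration of the unit sphere a Riemannian
  submersion and has the same expression in every affine chart.
\<close>

definition fubini_study :: "complex^'n::finite \<Rightarrow> complex^'n \<Rightarrow> complex^'n \<Rightarrow> real" where
  "fubini_study w u v =
     ((1 + (norm w)\<^sup>2) * Re (herm u v) - Re (herm u w * herm w v)) / (1 + (norm w)\<^sup>2)\<^sup>2"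

section \<open>Smooth maps\<close>

text \<open>
  In finite dimension, \<open>f\<close> is \<open>C\<^sup>k\<^sup>+\<^sup>1\<close> on an open set iff it is differentiable there and all its
  directional derivatives are \<open>C\<^sup>k\<close>.
\<close>

fun Ck_on :: "nat \<Rightarrow> 'a::euclidean_space set \<Rightarrow> ('a \<Rightarrow> 'b::euclidean_space) \<Rightarrow> bool" where
  "Ck_on 0 S f \<longleftrightarrow> continuous_on S f"
| "Ck_on (Suc k) S f \<longleftrightarrow>
     (\<forall>x\<in>S. f differentiable (at x)) \<and> (\<forall>v. Ck_on k S (\<lambda>x. frechet_derivative f (at x) v))"

definition smooth_on :: "'a::euclidean_space set \<Rightarrow> ('a \<Rightarrow> 'b::euclidean_space) \<Rightarrow> bool" where
  "smooth_on S f \<longleftrightarrow> (\<forall>k. Ck_on k S f)"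

definition local_domain ::
    "('n::finite cproj \<Rightarrow> 'n cproj) \<Rightarrow> 'n option \<Rightarrow> 'n option \<Rightarrow> (complex^'n) set" where
  "local_domain f i j = {w. f (affine_param i w) \<in> affine_domain j}"

definition local_rep ::
    "('n::finite cproj \<Rightarrow> 'n cproj) \<Rightarrow> 'n option \<Rightarrow> 'n option \<Rightarrow> complex^'n \<Rightarrow> complex^'n" where
  "local_rep f i j = affine_chart j \<circ> f \<circ> affine_param i"

definition smooth_cproj :: "('n::finite cproj \<Rightarrow> 'n cproj) \<Rightarrow> bool" where
  "smooth_cproj f \<longleftrightarrow>
     continuous_on UNIV f \<and> (\<forall>i j. smooth_on (local_domain f i j) (local_rep f i j))"

section \<open>Singular values, area non-increasing maps and isometries\<close>

text \<open>The pulled back metric \<open>f\<^sup>*g\<close> at \<^term>\<open>affine_param i w\<close>, for \<open>w \<in> local_domain f i j\<close>.\<close>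

definition pullback_fs ::
    "('n::finite cproj \<Rightarrow> 'n cproj) \<Rightarrow> 'n option \<Rightarrow> 'n option \<Rightarrow> complex^'n
      \<Rightarrow> complex^'n \<Rightarrow> complex^'n \<Rightarrow> real" where
  "pullback_fs f i j w u v =
     (let D = frechet_derivative (local_rep f i j) (at w)
      in fubini_study (local_rep f i j w) (D u) (D v))"

text \<open>
  \<open>s 0, s 1, \<dots>\<close> are nonnegative and their squares list the eigenvalues of the symmetric bilinear form
  \<open>H\<close> with respect to the inner product \<open>G\<close>, each as often as the dimension of its eigenspace.
\<close>

definition singular_values ::
    "('a::euclidean_space \<Rightarrow> 'a \<Rightarrow> real) \<Rightarrow> ('a \<Rightarrow> 'a \<Rightarrow> real) \<Rightarrow> (nat \<Rightarrow> real) \<Rightarrow> bool" where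
  "singular_values G H s \<longleftrightarrow>
     (\<forall>a < DIM('a). s a \<ge> 0) \<and>
     (\<forall>t. card {a. a < DIM('a) \<and> (s a)\<^sup>2 = t} = dim {u. \<forall>v. H u v = t * G u v})"

definition area_nonincreasing :: "('n::finite cproj \<Rightarrow> 'n cproj) \<Rightarrow> bool" where
  "area_nonincreasing f \<longleftrightarrow>
     (\<forall>i j. \<forall>w \<in> local_domain f i j.
        \<exists>s. singular_values (fubini_study w) (pullback_fs f i j w) s \<and>
          (\<forall>a < DIM(complex^'n). \<forall>b < DIM(complex^'n). a \<noteq> b \<longrightarrow> s a * s b \<le> 1))"

definition isometry_cproj :: "('n::finite cproj \<Rightarrow> 'n cproj) \<Rightarrow> bool" where
  "isometry_cproj f \<longleftrightarrow>
     bij f \<and> smooth_cproj f \<and> smooth_cproj (inv f) \<and>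
     (\<forall>i j. \<forall>w \<in> local_domain f i j. \<forall>u v. pullback_fs f i j w u v = fubini_study w u v)"

definition homotopically_trivial :: "('a::topological_space \<Rightarrow> 'b::topological_space) \<Rightarrow> bool" where
  "homotopically_trivial f \<longleftrightarrow> (\<exists>c. homotopic_with_canon (\<lambda>_. True) UNIV UNIV f (\<lambda>_. c))"

end

theory Submission
  imports Defs
begin

text \<open>
  The classes of maps \<open>CP\<^sup>n \<rightarrow> CP\<^sup>n\<close> are detected by the degree \<open>k\<close> on the second cohomology. Complex lines
  are calibrated, so for an area non-increasing map \<open>\<bar>k\<bar> \<le> 1\<close>; the degree is computed as the holonomy of a lift
  to \<open>C\<^sup>n\<^sup>+\<^sup>1 - {0}\<close> around the circles of a line, via Stokes' theorem. If \<open>k = 0\<close>, the map itself lifts to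
  \<open>C\<^sup>n\<^sup>+\<^sup>1 - {0}\<close> and is null-homotopic for dimension reasons. Otherwise equality holds on every complex line
  through every point, and as \<open>n \<ge> 2\<close> this forces all singular values to be \<open>1\<close>. An infinitesimal
  isometry of \<open>CP\<^sup>n\<close> is open, hence onto, and a compactness argument with its iterates shows that it is
  injective.
\<close>

section \<open>Calculus of \<open>C\<^sup>k\<close> maps\<close>

text \<open>The hypothesis bounds only products of two singular values, so no distance estimate is
  available until equality is known; everything passes through 2-forms. The Kaehler form of two
  vectors is at most their area (Wirtinger), so in polar coordinates around a base point the
  pulled-back form on a complex line is at most the area density sin r cos r. The connection form of
  a lift has curvature twice this form, and the resulting bound 2 pi sin 2r integrates to 2 pi over
  [0, pi/2]. This is exactly the quantum of holonomy: one strict inequality near the centre makes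
  the degree vanish on that line, hence, by connectedness, on all lines through the base point.
  Equality is used only in the limit r -> 0, and the base point is arbitrary.

  The obstacle is that f has no preferred lift over a disc. A vector over the centre is projected
  successively onto the lines that f assigns to the points of a ray. The result is smooth on each of
  finitely many annuli and agrees on their common circles, so the holonomy integrals telescope. The
  same lift, after a phase correction on the boundary, descends to \<open>CP^n\<close> when the
  degree is zero.\<close>

lemma has_derivative_frechet:
  "f differentiable (at x) \<Longrightarrow> (f has_derivative frechet_derivative f (at x)) (at x)"
  using frechet_derivative_works by blast

lemma Ck_on_cong:
  assumes "open S" "\<And>x. x \<in> S \<Longrightarrow> f x = g x" "Ck_on k S f"
  shows "Ck_on k S g"
  using assms(2,3)
proof (induction k arbitrary: f g)
  case 0
  then show ?case by (simp cong: continuous_on_cong)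
next
  case (Suc k)
  have d: "f differentiable at x" if "x \<in> S" for x using Suc.prems that by simp
  have eq: "frechet_derivative f (at x) = frechet_derivative g (at x)" if "x \<in> S" for x
    by (rule frechet_derivative_transform_within_open[OF d[OF that] assms(1) that]) (use Suc.prems in auto)
  have dg: "g differentiable at x" if "x \<in> S" for x
    using d[OF that] has_derivative_transform_within_open[OF _ assms(1) that] Suc.prems(1)
    unfolding differentiable_def by blast
  have "Ck_on k S (\<lambda>x. frechet_derivative g (at x) v)" for v
    by (rule Suc.IH[of "\<lambda>x. frechet_derivative f (at x) v"]) (use Suc.prems eq in auto)
  then show ?case using dg by simp
qed

lemma Ck_on_SucI:
  assumes "open S" "\<And>x. x \<in> S \<Longrightarrow> (f has_derivative f' x) (at x)"
    and "\<And>v. Ck_on k S (\<lambda>x. f' x v)"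
  shows "Ck_on (Suc k) S f"
proof -
  have "frechet_derivative f (at x) = f' x" if "x \<in> S" for x
    using assms(2)[OF that] frechet_derivative_at by metis
  then have "Ck_on k S (\<lambda>x. frechet_derivative f (at x) v)" for v
    by (intro Ck_on_cong[OF assms(1) _ assms(3)[of v]]) auto
  then show ?thesis using assms(2) by (auto simp: differentiable_def)
qed

lemma Ck_on_SucD: "Ck_on (Suc k) S f \<Longrightarrow> Ck_on k S f"
proof (induction k arbitrary: f)
  case 0
  then have "\<forall>x\<in>S. continuous (at x) f"
    by (auto intro: differentiable_imp_continuous_within)
  then show ?case by (simp add: continuous_at_imp_continuous_on)
next
  case (Suc k)
  show ?case
    unfolding Ck_on.simps(2)[of k S f]
    using Suc.IH Suc.prems unfolding Ck_on.simps(2)[of "Suc k"] by blast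
qed

lemma Ck_on_continuous: "Ck_on k S f \<Longrightarrow> continuous_on S f"
  by (induction k) (simp, metis Ck_on_SucD)

lemma Ck_on_SucE:
  "Ck_on (Suc k) S f \<Longrightarrow> x \<in> S \<Longrightarrow> (f has_derivative frechet_derivative f (at x)) (at x)"
  by (rule has_derivative_frechet) simp

lemma Ck_on_subset: "Ck_on k S f \<Longrightarrow> T \<subseteq> S \<Longrightarrow> Ck_on k T f"
  by (induction k arbitrary: f) (auto intro: continuous_on_subset)

lemma Ck_on_local:
  assumes "open S" "\<And>x. x \<in> S \<Longrightarrow> \<exists>U. open U \<and> x \<in> U \<and> Ck_on k U f"
  shows "Ck_on k S f"
  using assms(2)
proof (induction k arbitrary: f)
  case 0
  have "continuous (at x) f" if "x \<in> S" for x
    using 0[OF that] by (auto simp: continuous_on_eq_continuous_at)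
  then show ?case by (simp add: continuous_at_imp_continuous_on)
next
  case (Suc k)
  have "f differentiable at x" if "x \<in> S" for x using Suc.prems[OF that] by auto
  moreover have "Ck_on k S (\<lambda>x. frechet_derivative f (at x) v)" for v
    by (rule Suc.IH) (use Suc.prems in fastforce)
  ultimately show ?case by simp
qed

lemma Ck_on_const: "Ck_on k S (\<lambda>x. c)"
  by (induction k arbitrary: c) auto

lemma Ck_on_bounded_linear_self:
  assumes "bounded_linear h" "open S"
  shows "Ck_on k S h"
proof (cases k)
  case 0
  then show ?thesis by (simp add: linear_continuous_on assms)
next
  case (Suc k')
  show ?thesis unfolding Suc
    by (rule Ck_on_SucI[OF assms(2), where f'="\<lambda>_. h"])
      (use assms(1) bounded_linear_imp_has_derivative Ck_on_const in auto)
qed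

lemma Ck_on_linear_compose:
  assumes "bounded_linear h" "open S" "Ck_on k S f"
  shows "Ck_on k S (\<lambda>x. h (f x))"
  using assms(3)
proof (induction k arbitrary: f)
  case 0
  then show ?case
    using linear_continuous_on[OF assms(1), of UNIV] by (auto intro: continuous_on_compose2)
next
  case (Suc k)
  show ?case
  proof (rule Ck_on_SucI[OF assms(2), where f'="\<lambda>x v. h (frechet_derivative f (at x) v)"])
    show "((\<lambda>x. h (f x)) has_derivative (\<lambda>v. h (frechet_derivative f (at x) v))) (at x)" if "x \<in> S" for x
      by (rule bounded_linear.has_derivative[OF assms(1) Ck_on_SucE[OF Suc.prems that]])
  qed (use Suc in auto)
qed

lemma Ck_on_add:
  assumes "open S" "Ck_on k S f" "Ck_on k S g"
  shows "Ck_on k S (\<lambda>x. f x + g x)"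
  using assms(2,3)
proof (induction k arbitrary: f g)
  case 0
  then show ?case by (auto intro: continuous_on_add)
next
  case (Suc k)
  show ?case
    by (rule Ck_on_SucI[OF assms(1), where f'="\<lambda>x v. frechet_derivative f (at x) v + frechet_derivative g (at x) v"])
      (use Suc in \<open>auto intro!: has_derivative_add has_derivative_frechet\<close>)
qed

lemma Ck_on_sum:
  assumes "open S" "\<And>i. i \<in> I \<Longrightarrow> Ck_on k S (f i)"
  shows "Ck_on k S (\<lambda>x. \<Sum>i\<in>I. f i x)"
  using assms(2)
  by (induction I rule: infinite_finite_induct) (auto intro: Ck_on_const Ck_on_add[OF assms(1)])

text \<open>One induction serves products, inner products, Hermitian forms, scalar multiplication
  and the action of matrices on vectors.\<close>

lemma Ck_on_bilinear:
  assumes "bounded_bilinear h" "open S" "Ck_on k S f" "Ck_on k S g"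
  shows "Ck_on k S (\<lambda>x. h (f x) (g x))"
  using assms(3,4)
proof (induction k arbitrary: f g)
  case 0
  then show ?case by (auto intro: bounded_bilinear.continuous_on[OF assms(1)])
next
  case (Suc k)
  show ?case
  proof (rule Ck_on_SucI[OF assms(2), where f'="\<lambda>x v. h (f x) (frechet_derivative g (at x) v) + h (frechet_derivative f (at x) v) (g x)"])
    show "((\<lambda>x. h (f x) (g x)) has_derivative (\<lambda>v. h (f x) (frechet_derivative g (at x) v) + h (frechet_derivative f (at x) v) (g x))) (at x)" if "x \<in> S" for x
      by (rule bounded_bilinear.FDERIV[OF assms(1) Ck_on_SucE[OF Suc.prems(1) that] Ck_on_SucE[OF Suc.prems(2) that]])
    show "Ck_on k S (\<lambda>x. h (f x) (frechet_derivative g (at x) v) + h (frechet_derivative f (at x) v) (g x))" for v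
      using Suc.prems Suc.prems[THEN Ck_on_SucD] by (intro Ck_on_add[OF assms(2)] Suc.IH) auto
  qed
qed

lemma Ck_on_compose:
  fixes f :: "'b::euclidean_space \<Rightarrow> 'c::euclidean_space"
  assumes "open S" "open T" "Ck_on k T f" "Ck_on k S g" "\<And>x. x \<in> S \<Longrightarrow> g x \<in> T"
  shows "Ck_on k S (\<lambda>x. f (g x))"
  using assms(3,4)
proof (induction k arbitrary: f)
  case 0
  then show ?case using assms(5) by (auto intro: continuous_on_compose2)
next
  case (Suc k)
  let ?f = "\<lambda>x. frechet_derivative f (at x)" and ?g = "\<lambda>x. frechet_derivative g (at x)"
  have df: "f differentiable at (g x)" if "x \<in> S" for x using Suc.prems assms(5) that by simp
  have dg: "g differentiable at x" if "x \<in> S" for x using Suc.prems that by simp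
  \<comment> \<open>The direction \<open>?g x v\<close> moves with \<open>x\<close>, whereas the
    induction hypothesis covers derivatives in fixed directions only; expansion in the basis
    separates the two.\<close>
  have lin: "?f (g x) u = (\<Sum>b\<in>Basis. (u \<bullet> b) *\<^sub>R ?f (g x) b)" if "x \<in> S" for x u
  proof -
    interpret linear "?f (g x)"
      using has_derivative_frechet[OF df[OF that]] has_derivative_linear by blast
    have "?f (g x) u = ?f (g x) (\<Sum>b\<in>Basis. (u \<bullet> b) *\<^sub>R b)" by (simp add: euclidean_representation)
    then show ?thesis by (simp add: sum scale)
  qed
  have C: "Ck_on k S (\<lambda>x. \<Sum>b\<in>Basis. (?g x v \<bullet> b) *\<^sub>R ?f (g x) b)" for v
  proof (rule Ck_on_sum[OF assms(1)])
    fix b :: 'b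
    have "Ck_on k S (\<lambda>x. ?g x v \<bullet> b)"
      by (rule Ck_on_linear_compose[OF bounded_linear_inner_left assms(1)]) (use Suc.prems in auto)
    moreover have "Ck_on k S (\<lambda>x. ?f (g x) b)"
      by (rule Suc.IH) (use Suc.prems Ck_on_SucD in auto)
    ultimately show "Ck_on k S (\<lambda>x. (?g x v \<bullet> b) *\<^sub>R ?f (g x) b)"
      by (rule Ck_on_bilinear[OF bounded_bilinear_scaleR assms(1)])
  qed
  show ?case
  proof (rule Ck_on_SucI[OF assms(1), where f'="\<lambda>x v. ?f (g x) (?g x v)"])
    show "((\<lambda>x. f (g x)) has_derivative (\<lambda>v. ?f (g x) (?g x v))) (at x)" if "x \<in> S" for x
      using diff_chain_at[OF has_derivative_frechet[OF dg[OF that]] has_derivative_frechet[OF df[OF that]]]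
      by (simp add: o_def)
    show "Ck_on k S (\<lambda>x. ?f (g x) (?g x v))" for v
      by (rule Ck_on_cong[OF assms(1) _ C[of v]]) (simp add: lin)
  qed
qed

lemma Ck_on_inverse:
  fixes f :: "'a::euclidean_space \<Rightarrow> 'b::{real_normed_field, euclidean_space}"
  assumes "open S" "Ck_on k S f" "\<And>x. x \<in> S \<Longrightarrow> f x \<noteq> 0"
  shows "Ck_on k S (\<lambda>x. inverse (f x))"
  using assms(2)
proof (induction k)
  case 0
  then show ?case using assms(3) by (auto intro: continuous_on_inverse)
next
  case (Suc k)
  let ?f = "\<lambda>x. frechet_derivative f (at x)"
  have C: "Ck_on k S (\<lambda>x. inverse (f x))" using Suc Ck_on_SucD by blast
  show ?case
  proof (rule Ck_on_SucI[OF assms(1), where f'="\<lambda>x v. - (inverse (f x) * ?f x v * inverse (f x))"])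
    show "((\<lambda>x. inverse (f x)) has_derivative (\<lambda>v. - (inverse (f x) * ?f x v * inverse (f x)))) (at x)" if "x \<in> S" for x
      by (rule Deriv.has_derivative_inverse[OF assms(3)[OF that] Ck_on_SucE[OF Suc.prems that]])
    show "Ck_on k S (\<lambda>x. - (inverse (f x) * ?f x v * inverse (f x)))" for v
      by (intro Ck_on_linear_compose[OF bounded_linear_minus[OF bounded_linear_ident] assms(1)]
          Ck_on_bilinear[OF bounded_bilinear_mult assms(1)] C) (use Suc.prems in auto)
  qed
qed

lemma bounded_linear_axis: "bounded_linear (axis k :: 'b::euclidean_space \<Rightarrow> 'b^'k::finite)"
  by (auto simp: linear_conv_bounded_linear[symmetric] linear_iff vec_eq_iff axis_def)

lemma Ck_on_vec:
  fixes f :: "'a::euclidean_space \<Rightarrow> 'b::euclidean_space^'k::finite"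
  assumes "open S" "\<And>k. Ck_on m S (\<lambda>x. f x $ k)"
  shows "Ck_on m S f"
proof -
  have "Ck_on m S (\<lambda>x. \<Sum>k\<in>UNIV. axis k (f x $ k))"
    by (intro Ck_on_sum Ck_on_linear_compose[OF bounded_linear_axis] assms)
  then show ?thesis
    by (rule Ck_on_cong[OF assms(1), rotated]) (simp add: vec_eq_iff axis_def if_distrib cong: if_cong)
qed

lemma Ck_on_Pair:
  assumes "open S" "Ck_on k S f" "Ck_on k S g"
  shows "Ck_on k S (\<lambda>x. (f x, g x))"
proof -
  have "Ck_on k S (\<lambda>x. (f x, 0) + (0, g x))"
    by (intro Ck_on_add Ck_on_linear_compose[of "\<lambda>x. (x, 0)"] Ck_on_linear_compose[of "\<lambda>x. (0, x)"]
        bounded_linear_Pair bounded_linear_ident bounded_linear_zero assms)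
  then show ?thesis by simp
qed

lemma Ck_on_cos: "Ck_on k UNIV (cos :: real \<Rightarrow> real)"
  and Ck_on_sin: "Ck_on k UNIV (sin :: real \<Rightarrow> real)"
proof (induction k)
  case 0
  show "Ck_on 0 UNIV (cos :: real \<Rightarrow> real)" "Ck_on 0 UNIV (sin :: real \<Rightarrow> real)"
    by (auto intro!: continuous_intros)
next
  case (Suc k)
  have b: "bounded_linear (\<lambda>x::real. x * v)" "bounded_linear (\<lambda>x::real. - x * v)" for v
    using bounded_linear_mult_left[of v] bounded_linear_minus[OF bounded_linear_mult_left[of v]] by auto
  have c: "Ck_on k UNIV (\<lambda>x. - (sin x * v))" "Ck_on k UNIV (\<lambda>x. cos x * v)" for v :: real
    using Ck_on_linear_compose[OF b(2) open_UNIV Suc(2)] Ck_on_linear_compose[OF b(1) open_UNIV Suc(1)]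
    by simp_all
  show "Ck_on (Suc k) UNIV (cos :: real \<Rightarrow> real)"
    by (rule Ck_on_SucI[where f'="\<lambda>x v. - (sin x * v)"]) (auto intro!: c derivative_eq_intros)
  show "Ck_on (Suc k) UNIV (sin :: real \<Rightarrow> real)"
    by (rule Ck_on_SucI[where f'="\<lambda>x v. cos x * v"]) (auto intro!: c derivative_eq_intros)
qed

section \<open>Hermitian geometry\<close>

lemma Re_herm: "Re (herm u v) = u \<bullet> v"
  by (simp add: herm_def inner_vec_def inner_complex_def Re_sum)

lemma cnj_herm: "cnj (herm u v) = herm v u"
  by (simp add: herm_def mult.commute)

lemma herm_add_left: "herm (u + u') v = herm u v + herm u' v"
  and herm_add_right: "herm u (v + v') = herm u v + herm u v'"
  and herm_diff_left: "herm (u - u') v = herm u v - herm u' v"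
  and herm_diff_right: "herm u (v - v') = herm u v - herm u v'"
  and herm_scale_left: "herm (c *s u) v = c * herm u v"
  and herm_scale_right: "herm u (c *s v) = cnj c * herm u v"
  by (simp_all add: herm_def sum.distrib sum_subtractf sum_distrib_left algebra_simps)

lemma herm_zero [simp]: "herm 0 v = 0" "herm u 0 = 0"
  by (simp_all add: herm_def)

lemmas herm_simps = herm_add_left herm_add_right herm_diff_left herm_diff_right
  herm_scale_left herm_scale_right

lemma herm_self: "herm u u = of_real ((norm u)\<^sup>2)"
proof (rule complex_eqI)
  show "Re (herm u u) = Re (of_real ((norm u)\<^sup>2))" by (simp add: Re_herm power2_norm_eq_inner)
  show "Im (herm u u) = Im (of_real ((norm u)\<^sup>2))"
    using cnj_herm[of u u] by (simp add: complex_eq_iff)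
qed

lemma of_real_cmod_square: "(complex_of_real (cmod c))\<^sup>2 = c * cnj c"
  by (metis complex_norm_square of_real_power)

lemma norm_vector_smult: "norm (c *s u) = norm c * norm u" for c :: complex
proof -
  have "complex_of_real ((norm (c *s u))\<^sup>2) = of_real ((norm c * norm u)\<^sup>2)"
    unfolding herm_self[symmetric] herm_scale_left herm_scale_right
    by (simp add: herm_self power_mult_distrib of_real_cmod_square)
  then have "(norm (c *s u))\<^sup>2 = (norm c * norm u)\<^sup>2" by (simp only: of_real_eq_iff)
  then show ?thesis by (simp add: power2_eq_iff_nonneg)
qed

lemma vector_smult_eq_0_iff [simp]: "c *s u = 0 \<longleftrightarrow> c = 0 \<or> u = 0" for c :: complex
  by (metis norm_vector_smult mult_eq_0_iff norm_eq_zero)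

lemma scaleR_vector_smult: "r *\<^sub>R u = of_real r *s u" for u :: "complex^'k"
  by (simp add: vec_eq_iff complex_eq_iff)

lemma scaleR_vector_smult_left: "(r *\<^sub>R c) *s u = r *\<^sub>R (c *s u)" for c :: complex
  by (simp add: vec_eq_iff)

lemma herm_scaleR_left: "herm (r *\<^sub>R u) v = of_real r * herm u v"
  and herm_scaleR_right: "herm u (r *\<^sub>R v) = of_real r * herm u v"
  by (simp_all add: scaleR_vector_smult herm_simps)

text \<open>A unit scalar \<open>c\<close> makes the Hermitian product real and nonnegative, which
  reduces the claim to the real Cauchy-Schwarz inequality.\<close>

lemma norm_herm_le: "norm (herm u v) \<le> norm u * norm v"
proof (cases "herm u v = 0")
  case False
  define c where "c = cnj (herm u v) / norm (herm u v)"
  have c: "norm c = 1" using False by (simp add: c_def norm_divide)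
  have "c * herm u v = norm (herm u v)"
    using False of_real_cmod_square[of "herm u v"] unfolding c_def
    by (simp add: power2_eq_square mult.commute[of "cnj _"] nonzero_divide_eq_eq)
  then have "norm (herm u v) = Re (herm (c *s u) v)" by (simp add: herm_simps)
  also have "\<dots> \<le> norm (c *s u) * norm v" unfolding Re_herm by (rule norm_cauchy_schwarz)
  finally show ?thesis by (simp add: norm_vector_smult c)
qed simp

lemma bounded_bilinear_herm: "bounded_bilinear herm"
  unfolding bilinear_conv_bounded_bilinear[symmetric] bilinear_def linear_iff
  by (auto simp: herm_simps herm_scaleR_left herm_scaleR_right complex_eq_iff)

lemma bounded_bilinear_vector_smult:
  "bounded_bilinear ((*s) :: complex \<Rightarrow> complex^'k::finite \<Rightarrow> _)"
  unfolding bilinear_conv_bounded_bilinear[symmetric] bilinear_def linear_iff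
  by (auto simp: vec_eq_iff algebra_simps)

lemma bounded_bilinear_matrix_vector_mult:
  "bounded_bilinear ((*v) :: complex^'k::finite^'l::finite \<Rightarrow> _)"
  unfolding bilinear_conv_bounded_bilinear[symmetric] bilinear_def linear_iff
  by (auto simp: vec_eq_iff matrix_vector_mult_def sum.distrib sum_distrib_left
      scaleR_sum_right algebra_simps)

lemmas herm_continuous_on = bounded_bilinear.continuous_on[OF bounded_bilinear_herm]

definition perp :: "complex^'k::finite \<Rightarrow> complex^'k \<Rightarrow> complex^'k" where
  "perp y u = u - (herm u y / (norm y)\<^sup>2) *s y"

text \<open>The Hermitian form on \<open>C\<^sup>k - {0}\<close> whose real part is the pulled back Fubini--Study metric.\<close>

definition fs_form :: "complex^'k::finite \<Rightarrow> complex^'k \<Rightarrow> complex^'k \<Rightarrow> complex" where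
  "fs_form y u v = (herm u v * (norm y)\<^sup>2 - herm u y * herm y v) / (norm y)^4"

lemma fs_form_perp:
  assumes "y \<noteq> 0"
  shows "fs_form y u v = herm (perp y u) (perp y v) / (norm y)\<^sup>2"
proof -
  define n where "n = complex_of_real ((norm y)\<^sup>2)"
  have n: "n \<noteq> 0" "herm y y = n" "cnj n = n" using assms by (simp_all add: n_def herm_self)
  have n4: "complex_of_real ((norm y)^4) = n * n" by (simp add: n_def power4_eq_xxxx power2_eq_square)
  show ?thesis
    unfolding fs_form_def perp_def n4 n_def[symmetric]
    using n by (simp add: herm_simps cnj_herm field_simps)
qed

text \<open>Wirtinger's inequality: the imaginary part is the Kaehler form, the right-hand side the
  squared area of the parallelogram. It is Hermitian Cauchy-Schwarz for the components orthogonal to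
  \<open>y\<close>.\<close>

lemma fs_form_Cauchy_Schwarz:
  assumes "y \<noteq> 0"
  shows "(Im (fs_form y u v))\<^sup>2 \<le> Re (fs_form y u u) * Re (fs_form y v v) - (Re (fs_form y u v))\<^sup>2"
proof -
  let ?a = "perp y u" and ?b = "perp y v"
  have "(norm (herm ?a ?b))\<^sup>2 \<le> (norm ?a * norm ?b)\<^sup>2"
    by (intro power_mono norm_herm_le) auto
  then have "(Re (herm ?a ?b))\<^sup>2 + (Im (herm ?a ?b))\<^sup>2 \<le> (norm ?a)\<^sup>2 * (norm ?b)\<^sup>2"
    by (simp add: cmod_power2 power_mult_distrib)
  then have "((Re (herm ?a ?b))\<^sup>2 + (Im (herm ?a ?b))\<^sup>2) / ((norm y)\<^sup>2)\<^sup>2 \<le> (norm ?a)\<^sup>2 * (norm ?b)\<^sup>2 / ((norm y)\<^sup>2)\<^sup>2"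
    by (rule divide_right_mono) simp
  then show ?thesis
    by (simp add: fs_form_perp[OF assms] herm_self Re_divide_of_real Im_divide_of_real
        power_divide add_divide_distrib power2_eq_square flip: of_real_power of_real_mult)
qed

lemma Re_fs_form_nonneg: "Re (fs_form y u u) \<ge> 0"
proof (cases "y = 0")
  case False
  then show ?thesis by (simp add: fs_form_perp herm_self Re_divide_of_real flip: of_real_power)
qed (simp add: fs_form_def)

lemma fs_form_linear:
  "fs_form y (u + u') v = fs_form y u v + fs_form y u' v"
  "fs_form y u (v + v') = fs_form y u v + fs_form y u v'"
  "fs_form y (r *\<^sub>R u) v = of_real r * fs_form y u v"
  "fs_form y u (r *\<^sub>R v) = of_real r * fs_form y u v"
  by (simp_all add: fs_form_def herm_simps herm_scaleR_left herm_scaleR_right field_simps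
      add_divide_distrib diff_divide_distrib)

lemma cnj_fs_form: "cnj (fs_form y u v) = fs_form y v u"
  by (simp add: fs_form_def cnj_herm mult.commute)

lemma Re_fs_form_sym: "Re (fs_form y u v) = Re (fs_form y v u)"
  by (simp flip: cnj_fs_form[of y u v])

text \<open>When a representative y(t) of a curve is replaced by c(t) y(t), its derivative changes
  in precisely this way; so the form depends only on the curve in \<open>CP^n\<close>.\<close>

lemma fs_form_scale:
  assumes "c \<noteq> 0" "y \<noteq> 0"
  shows "fs_form (c *s y) (c *s u + a *s y) (c *s v + b *s y) = fs_form y u v"
proof -
  define n where "n = complex_of_real ((norm y)\<^sup>2)"
  have n: "n \<noteq> 0" "herm y y = n" using assms by (simp_all add: n_def herm_self)
  have n4: "complex_of_real ((norm y)^4) = n * n" by (simp add: n_def power4_eq_xxxx power2_eq_square)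
  have cc: "complex_of_real ((norm (c *s y))\<^sup>2) = c * cnj c * n"
    by (simp add: norm_vector_smult power_mult_distrib n_def of_real_cmod_square)
  have cc4: "complex_of_real ((norm (c *s y))^4) = (c * cnj c * n) * (c * cnj c * n)"
    unfolding cc[symmetric] by (simp add: power4_eq_xxxx power2_eq_square)
  show ?thesis
    unfolding fs_form_def cc cc4 n4 n_def[symmetric]
    using n assms(1) by (simp add: herm_simps field_simps)
qed

section \<open>Homogeneous coordinates\<close>

lemma to_cproj_eq_iff:
  assumes "x \<noteq> 0" "y \<noteq> 0"
  shows "to_cproj x = to_cproj y \<longleftrightarrow> (\<exists>c. c \<noteq> 0 \<and> y = c *s x)"
  using Quotient_rel[OF Quotient_cproj, of x y] proj_rel_refl[OF assms(1)] proj_rel_refl[OF assms(2)] assms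
  unfolding proj_rel_def by auto

lemma to_cproj_scale: "c \<noteq> 0 \<Longrightarrow> z \<noteq> 0 \<Longrightarrow> to_cproj (c *s z) = to_cproj z"
  using to_cproj_eq_iff[of z "c *s z"] by auto

lemma cproj_cases:
  obtains z where "z \<noteq> 0" "p = to_cproj z"
  using Quotient_cproj proj_rel_def by (metis Quotient_rep_reflp Quotient_abs_rep)

text \<open>The chart on representatives, a map between vector spaces that can be
  differentiated.\<close>

definition cchart :: "'n::finite option \<Rightarrow> complex^('n option) \<Rightarrow> complex^'n" where
  "cchart i z = (\<chi> k. z $ Transposition.transpose None i (Some k) / z $ i)"

definition dchart :: "'n::finite option \<Rightarrow> complex^('n option) \<Rightarrow> complex^('n option) \<Rightarrow> complex^'n" where
  "dchart i z u = (\<chi> k. (u $ Transposition.transpose None i (Some k) * z $ i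
      - z $ Transposition.transpose None i (Some k) * u $ i) / (z $ i)\<^sup>2)"

lemma affine_chart_eq: "z \<noteq> 0 \<Longrightarrow> affine_chart i (to_cproj z) = cchart i z"
  by (simp add: affine_chart_to_cproj cchart_def)

lemma in_affine_domain_iff:
  assumes "z \<noteq> 0"
  shows "to_cproj z \<in> affine_domain i \<longleftrightarrow> z $ i \<noteq> 0"
proof
  assume "to_cproj z \<in> affine_domain i"
  then obtain y where y: "y $ i \<noteq> 0" "to_cproj z = to_cproj y" by (auto simp: affine_domain_def)
  then have "y \<noteq> 0" by auto
  then obtain c where "c \<noteq> 0" "y = c *s z" using to_cproj_eq_iff[OF assms] y by auto
  then show "z $ i \<noteq> 0" using y by auto
qed (auto simp: affine_domain_def)

lemma affine_param_cchart: "z $ i \<noteq> 0 \<Longrightarrow> affine_param i (cchart i z) = to_cproj z"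
  using affine_param_chart[of "to_cproj z" i] in_affine_domain_iff[of z i] affine_chart_eq[of z i]
  by (metis zero_index)

lemma vec_has_derivative:
  fixes f :: "'a::real_normed_vector \<Rightarrow> 'b::euclidean_space^'k::finite"
  assumes "\<And>k. ((\<lambda>x. f x $ k) has_derivative (\<lambda>v. f' v $ k)) F"
  shows "(f has_derivative f') F"
proof -
  have "((\<lambda>x. \<Sum>k\<in>UNIV. axis k (f x $ k)) has_derivative (\<lambda>v. \<Sum>k\<in>UNIV. axis k (f' v $ k))) F"
    by (intro has_derivative_sum bounded_linear.has_derivative[OF bounded_linear_axis] assms)
  moreover have "(\<Sum>k\<in>UNIV. axis k (w $ k)) = w" for w :: "'b^'k"
    by (simp add: vec_eq_iff axis_def if_distrib cong: if_cong)
  ultimately show ?thesis by simp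
qed

lemma cchart_has_derivative:
  assumes "z $ i \<noteq> 0"
  shows "(cchart i has_derivative dchart i z) (at z)"
proof (rule vec_has_derivative)
  fix k
  have n: "((\<lambda>x. x $ j) has_derivative (\<lambda>u. u $ j)) (at z)" for j
    by (rule bounded_linear_imp_has_derivative[OF bounded_linear_vec_nth])
  show "((\<lambda>x. cchart i x $ k) has_derivative (\<lambda>v. dchart i z v $ k)) (at z)"
    unfolding cchart_def dchart_def
    using has_derivative_divide'[OF n n assms, of "Transposition.transpose None i (Some k)"]
    by (simp add: power2_eq_square)
qed

lemma sum_option_transpose:
  fixes g :: "'n::finite option \<Rightarrow> 'b::comm_monoid_add"
  shows "(\<Sum>j\<in>UNIV. g j) = g i + (\<Sum>k\<in>UNIV. g (Transposition.transpose None i (Some k)))"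
proof -
  have "(\<Sum>j\<in>UNIV. g j) = (\<Sum>j\<in>UNIV. g (Transposition.transpose None i j))"
    by (rule sum.reindex_bij_betw[symmetric, OF bij_transpose])
  also have "\<dots> = g (Transposition.transpose None i None) + (\<Sum>j\<in>range Some. g (Transposition.transpose None i j))"
    unfolding UNIV_option_conv by (rule sum.insert) auto
  also have "(\<Sum>j\<in>range Some. g (Transposition.transpose None i j)) = (\<Sum>k\<in>UNIV. g (Transposition.transpose None i (Some k)))"
    by (subst sum.reindex) auto
  finally show ?thesis by simp
qed

lemma fubini_study_chart:
  assumes "y $ j \<noteq> 0"
  shows "fubini_study (cchart j y) (dchart j y u) (dchart j y v) = Re (fs_form y u v)"
proof -
  let ?t = "\<lambda>k. Transposition.transpose None j (Some k)"
  define c where "c = inverse (y $ j)"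
  have c: "c \<noteq> 0" "y \<noteq> 0" using assms by (auto simp: c_def)
  \<comment> \<open>Scaling by \<open>c\<close> makes the \<open>j\<close>-th coordinate of the
    representative equal to 1. \<open>T u\<close> is the derivative of a curve normalised in this
    way, so its \<open>j\<close>-th coordinate vanishes and the others are those of
    \<open>dchart\<close>.\<close>
  define T where "T u = c *s u + (- c * u $ j * c) *s y" for u
  have Tj: "T u $ j = 0" for u using assms by (simp add: T_def c_def)
  have Tk: "T u $ ?t k = dchart j y u $ k" for u k
    using assms by (simp add: T_def c_def dchart_def field_simps power2_eq_square)
  have yj: "(c *s y) $ j = 1" and yk: "(c *s y) $ ?t k = cchart j y $ k" for k
    using assms by (simp_all add: c_def cchart_def field_simps)
  have h: "herm (T u) (T v) = herm (dchart j y u) (dchart j y v)" for u v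
    unfolding herm_def by (subst sum_option_transpose[of _ j]) (simp add: Tj Tk)
  have hy: "herm (T u) (c *s y) = herm (dchart j y u) (cchart j y)" for u
    unfolding herm_def by (subst sum_option_transpose[of _ j]) (simp only: Tj Tk yj yk, simp)
  have hy': "herm (c *s y) (T u) = herm (cchart j y) (dchart j y u)" for u
    using hy[of u] by (metis cnj_herm)
  have "herm (c *s y) (c *s y) = 1 + herm (cchart j y) (cchart j y)"
    unfolding herm_def by (subst sum_option_transpose[of _ j]) (simp only: yj yk, simp)
  then have n: "(norm (c *s y))\<^sup>2 = 1 + (norm (cchart j y))\<^sup>2"
    unfolding herm_self by (metis of_real_1 of_real_add of_real_eq_iff)
  have n4: "(norm (c *s y))^4 = (1 + (norm (cchart j y))\<^sup>2)\<^sup>2"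
    unfolding n[symmetric] by (simp flip: power_mult)
  have "fs_form y u v = fs_form (c *s y) (T u) (T v)"
    unfolding T_def by (rule fs_form_scale[symmetric, OF c])
  also have "\<dots> = (herm (dchart j y u) (dchart j y v) * of_real (1 + (norm (cchart j y))\<^sup>2)
      - herm (dchart j y u) (cchart j y) * herm (cchart j y) (dchart j y v)) / of_real ((1 + (norm (cchart j y))\<^sup>2)\<^sup>2)"
    unfolding fs_form_def h hy hy' n4 n ..
  finally show ?thesis
    unfolding fubini_study_def by (simp only: Re_divide_of_real minus_complex.simps) (simp add: mult.commute)
qed

section \<open>The quotient map, and derivatives of f computed on lifts of curves\<close>

lemma continuous_on_to_cproj: "continuous_on (- {0}) to_cproj"
proof -
  have "\<exists>A. open A \<and> A \<inter> - {0} = to_cproj -` B \<inter> - {0}" if "open B" for B :: "'n::finite cproj set"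
  proof -
    have "open {z. z \<noteq> 0 \<and> to_cproj z \<in> B}" using that unfolding open_cproj_def .
    then show ?thesis by (intro exI[of _ "{z. z \<noteq> 0 \<and> to_cproj z \<in> B}"]) auto
  qed
  then show ?thesis unfolding continuous_on_open_invariant by blast
qed

lemma open_affine_domain: "open (affine_domain i)"
proof -
  have "{z. z \<noteq> 0 \<and> to_cproj z \<in> affine_domain i} = {z. z $ i \<noteq> 0}"
    using in_affine_domain_iff by (metis (mono_tags, lifting) zero_index)
  moreover have "open {z::complex^'a option. z $ i \<noteq> 0}"
    by (intro open_Collect_neq continuous_intros)
  ultimately show ?thesis unfolding open_cproj_def by simp
qed

lemma affine_lift_has_derivative:
  "(affine_lift i has_derivative (\<lambda>u. affine_lift i u - affine_lift i 0)) (at w)"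
proof (rule vec_has_derivative)
  fix j
  show "((\<lambda>x. affine_lift i x $ j) has_derivative (\<lambda>v. (affine_lift i v - affine_lift i 0) $ j)) (at w)"
  proof (cases "Transposition.transpose None i j")
    case (Some k)
    then show ?thesis
      by (simp add: affine_lift_def bounded_linear_imp_has_derivative[OF bounded_linear_vec_nth])
  qed (simp add: affine_lift_def)
qed

lemma continuous_on_affine_lift: "continuous_on S (affine_lift i)"
  by (rule has_derivative_continuous_on[OF has_derivative_at_withinI[OF affine_lift_has_derivative]])

lemma continuous_on_affine_param: "continuous_on S (affine_param i)"
  unfolding affine_param_def
  by (rule continuous_on_compose2[OF continuous_on_to_cproj continuous_on_affine_lift]) auto

lemma open_local_domain:
  assumes "smooth_cproj f"
  shows "open (local_domain f i j)"
proof -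
  have "continuous_on UNIV (\<lambda>w. f (affine_param i w))"
    using assms continuous_on_affine_param[of UNIV i] unfolding smooth_cproj_def
    by (auto intro: continuous_on_compose2)
  then show ?thesis
    unfolding local_domain_def using open_affine_domain[of j]
    by (simp add: continuous_on_open_vimage vimage_def)
qed

lemma local_rep_has_derivative:
  assumes "smooth_cproj f" "w \<in> local_domain f i j"
  shows "(local_rep f i j has_derivative frechet_derivative (local_rep f i j) (at w)) (at w)"
  using assms unfolding smooth_cproj_def smooth_on_def by (meson Ck_on_SucE)

lemma local_domain_cchart:
  assumes "z $ i \<noteq> 0" "y $ j \<noteq> 0" "to_cproj y = f (to_cproj z)"
  shows "cchart i z \<in> local_domain f i j" "local_rep f i j (cchart i z) = cchart j y"
proof -
  have "y \<noteq> 0" using assms(2) by auto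
  then show "cchart i z \<in> local_domain f i j" "local_rep f i j (cchart i z) = cchart j y"
    using assms by (auto simp: local_domain_def local_rep_def affine_param_cchart
        in_affine_domain_iff affine_chart_eq simp flip: assms(3))
qed

text \<open>Near \<open>t\<close> the chart expression of f along \<open>z\<close> is the chart
  image of the lift \<open>y\<close>, and both are differentiated. From here on derivatives of f can
  be read off any lift, without charts.\<close>

lemma lift_derivative:
  fixes z y :: "real \<Rightarrow> complex^('n::finite option)"
  assumes f: "smooth_cproj f"
    and z: "(z has_vector_derivative z') (at t)" "z t $ i \<noteq> 0"
    and y: "(y has_vector_derivative y') (at t)" "y t $ j \<noteq> 0"
    and ev: "\<forall>\<^sub>F s in nhds t. to_cproj (y s) = f (to_cproj (z s))"
  shows "frechet_derivative (local_rep f i j) (at (cchart i (z t))) (dchart i (z t) z') = dchart j (y t) y'"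
proof -
  have eq: "to_cproj (y t) = f (to_cproj (z t))" using ev by (rule eventually_nhds_x_imp_x)
  have nz: "\<forall>\<^sub>F s in nhds t. x s $ k \<noteq> 0" if "(x has_vector_derivative x') (at t)" "x t $ k \<noteq> 0"
    for x x' and k :: "'n option"
  proof -
    have "((\<lambda>s. x s $ k) \<longlongrightarrow> x t $ k) (nhds t)"
      by (intro tendsto_vec_nth iffD1[OF tendsto_at_iff_tendsto_nhds]
          isContD has_vector_derivative_continuous[OF that(1)])
    then show ?thesis using that(2) by (rule tendsto_imp_eventually_ne)
  qed
  have cz: "((\<lambda>s. cchart i (z s)) has_vector_derivative dchart i (z t) z') (at t)"
    using vector_derivative_diff_chain_within[OF z(1), of "cchart i" "dchart i (z t)"]
      cchart_has_derivative[OF z(2)] by (simp add: o_def has_derivative_at_withinI)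
  have cy: "((\<lambda>s. cchart j (y s)) has_vector_derivative dchart j (y t) y') (at t)"
    using vector_derivative_diff_chain_within[OF y(1), of "cchart j" "dchart j (y t)"]
      cchart_has_derivative[OF y(2)] by (simp add: o_def has_derivative_at_withinI)
  have "((\<lambda>s. local_rep f i j (cchart i (z s))) has_vector_derivative
      frechet_derivative (local_rep f i j) (at (cchart i (z t))) (dchart i (z t) z')) (at t)"
    using vector_derivative_diff_chain_within[OF cz, of "local_rep f i j"]
      local_rep_has_derivative[OF f local_domain_cchart(1)[where f=f, OF z(2) y(2) eq]]
    by (simp add: o_def has_derivative_at_withinI)
  moreover have "\<forall>\<^sub>F s in nhds t. local_rep f i j (cchart i (z s)) = cchart j (y s)"
    using nz[OF z] nz[OF y] ev by eventually_elim (rule local_domain_cchart(2))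
  then have "((\<lambda>s. local_rep f i j (cchart i (z s))) has_vector_derivative dchart j (y t) y') (at t)"
    using cy unfolding has_vector_derivative_def eventually_nhds_conv_at
    by (auto elim!: has_derivative_transform_eventually elim: eventually_mono simp: eq_commute)
  ultimately show ?thesis by (rule vector_derivative_unique_at)
qed

text \<open>One curve for each argument of the metric. The two parameters may differ, as for a
  radial and an angular curve through the same point.\<close>

lemma pullback_lift:
  fixes z y :: "real \<Rightarrow> complex^('n::finite option)" and z2 y2 :: "real \<Rightarrow> complex^('n option)"
  assumes f: "smooth_cproj f"
    and z: "(z has_vector_derivative z') (at t)" "z t $ i \<noteq> 0"
    and y: "(y has_vector_derivative y') (at t)" "y t $ j \<noteq> 0"
    and z2: "(z2 has_vector_derivative z2') (at t2)" "z2 t2 = z t"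
    and y2: "(y2 has_vector_derivative y2') (at t2)" "y2 t2 = y t"
    and ev: "\<forall>\<^sub>F s in nhds t. to_cproj (y s) = f (to_cproj (z s))"
      "\<forall>\<^sub>F s in nhds t2. to_cproj (y2 s) = f (to_cproj (z2 s))"
  shows "pullback_fs f i j (cchart i (z t)) (dchart i (z t) z') (dchart i (z t) z2')
    = Re (fs_form (y t) y' y2')"
proof -
  have eq: "to_cproj (y t) = f (to_cproj (z t))" using ev(1) by (rule eventually_nhds_x_imp_x)
  show ?thesis
    unfolding pullback_fs_def Let_def local_domain_cchart(2)[where f=f, OF z(2) y(2) eq]
    using lift_derivative[OF f z y ev(1)] lift_derivative[OF f z2(1) _ y2(1) _ ev(2), of i j]
      z2 y2 z y by (simp add: fubini_study_chart)
qed

section \<open>Area bounds for pairs of quadratic forms\<close>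

lemma quadratic_nonneg_imp_linear_zero:
  fixes b c :: real
  assumes "\<And>t. 2 * t * b + t\<^sup>2 * c \<ge> 0"
  shows "b = 0"
proof (rule ccontr)
  assume b: "b \<noteq> 0"
  \<comment> \<open>The test value \<open>- b / k\<close> gives b^2 (c - 2k) / k^2, which is
    negative as soon as k > 0 and k > c.\<close>
  define k where "k = \<bar>c\<bar> + 1"
  have k: "k > 0" "c < k" by (auto simp: k_def)
  have "0 \<le> k\<^sup>2 * (2 * (- b / k) * b + (- b / k)\<^sup>2 * c)"
    using assms[of "- b / k"] by simp
  also have "\<dots> = b\<^sup>2 * (c - 2 * k)" using k by (simp add: field_simps power2_eq_square)
  finally have "0 \<le> b\<^sup>2 * (c - 2 * k)" .
  moreover have "b\<^sup>2 * (c - 2 * k) < 0" using b k by (simp add: mult_pos_neg)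
  ultimately show False by simp
qed

lemma bilinear_simps:
  fixes H :: "'a::euclidean_space \<Rightarrow> 'a \<Rightarrow> real"
  assumes "bilinear H"
  shows "H (x + x') y = H x y + H x' y" "H x (y + y') = H x y + H x y'"
    "H (r *\<^sub>R x) y = r * H x y" "H x (r *\<^sub>R y) = r * H x y"
    "H (x - x') y = H x y - H x' y" "H x (y - y') = H x y - H x y'" "H 0 y = 0" "H x 0 = 0"
  using assms by (auto simp: bilinear_ladd bilinear_radd bilinear_lmul bilinear_rmul
      bilinear_lsub bilinear_rsub bilinear_lzero bilinear_rzero)

text \<open>The Rayleigh quotient attains its maximum on the unit sphere of \<open>W\<close>;
  vanishing of its first variation is the eigenvector equation tested against
  \<open>W\<close>.\<close>

lemma quadratic_form_maximum:
  fixes G H :: "'a::euclidean_space \<Rightarrow> 'a \<Rightarrow> real"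
  assumes G: "bilinear G" "\<And>x y. G x y = G y x" "\<And>x. x \<noteq> 0 \<Longrightarrow> G x x > 0"
    and H: "bilinear H" "\<And>x y. H x y = H y x"
    and W: "subspace W" "w \<in> W" "w \<noteq> 0"
  shows "\<exists>e\<in>W. G e e = 1 \<and> (\<forall>x\<in>W. H x x \<le> H e e * G x x \<and> H e x = H e e * G e x)"
proof -
  note simps = bilinear_simps[OF G(1)] bilinear_simps[OF H(1)]
  have cont: "continuous_on S (\<lambda>x. B x x)" if "bilinear B" for S and B :: "'a \<Rightarrow> 'a \<Rightarrow> real"
    by (rule bounded_bilinear.continuous_on[OF that[unfolded bilinear_conv_bounded_bilinear]
          continuous_on_id continuous_on_id])
  let ?S = "W \<inter> sphere 0 1"
  have "compact ?S" using closed_subspace[OF W(1)] by (simp add: closed_Int_compact)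
  moreover have "w /\<^sub>R norm w \<in> ?S" using W by (simp add: subspace_mul)
  then have "?S \<noteq> {}" by blast
  moreover have "continuous_on ?S (\<lambda>x. H x x / G x x)"
  proof (intro continuous_on_divide cont[OF G(1)] cont[OF H(1)] ballI)
    fix x assume "x \<in> ?S"
    then show "G x x \<noteq> 0" using G(3)[of x] by (cases "x = 0") auto
  qed
  ultimately obtain m where m: "m \<in> ?S" "\<And>x. x \<in> ?S \<Longrightarrow> H x x / G x x \<le> H m m / G m m"
    using continuous_attains_sup[of ?S "\<lambda>x. H x x / G x x"] by blast
  have m0: "m \<noteq> 0" using m by auto
  then have Gm: "G m m > 0" by (rule G(3))
  define e where "e = (1 / sqrt (G m m)) *\<^sub>R m"
  have e: "e \<in> W" using m W by (simp add: e_def subspace_mul)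
  have Ge: "G e e = 1" using Gm by (simp add: e_def simps field_simps flip: power2_eq_square)
  have He: "H e e = H m m / G m m" using Gm by (simp add: e_def simps field_simps flip: power2_eq_square)
  have max: "H x x \<le> H e e * G x x" if "x \<in> W" for x
  proof (cases "x = 0")
    case False
    let ?x = "x /\<^sub>R norm x"
    have "?x \<in> ?S" using that False W by (simp add: subspace_mul)
    then have "H ?x ?x / G ?x ?x \<le> H e e" unfolding He by (rule m(2))
    then show ?thesis using G(3)[OF False] False by (simp add: simps field_simps)
  qed (simp add: simps)
  have "H e x = H e e * G e x" if x: "x \<in> W" for x
  proof -
    have "2 * t * (H e e * G e x - H e x) + t\<^sup>2 * (H e e * G x x - H x x) \<ge> 0" for t
    proof -
      have "e + t *\<^sub>R x \<in> W" using e x W by (simp add: subspace_add subspace_mul)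
      from max[OF this] show ?thesis
        by (simp add: simps Ge G(2)[of x e] H(2)[of x e] algebra_simps power2_eq_square)
    qed
    from quadratic_nonneg_imp_linear_zero[OF this] show ?thesis by simp
  qed
  with e Ge max show ?thesis by blast
qed

text \<open>
  The two largest singular values have product at most \<open>1\<close>, and every plane meets the orthogonal
  complement of the first singular vector.
\<close>

lemma singular_values_area_le:
  fixes G H :: "'a::euclidean_space \<Rightarrow> 'a \<Rightarrow> real"
  assumes G: "bilinear G" "\<And>x y. G x y = G y x" "\<And>x. x \<noteq> 0 \<Longrightarrow> G x x > 0"
    and H: "bilinear H" "\<And>x y. H x y = H y x" "\<And>x. H x x \<ge> 0"
    and s: "singular_values G H s" "\<forall>a<DIM('a). \<forall>b<DIM('a). a \<noteq> b \<longrightarrow> s a * s b \<le> 1"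
  shows "H u u * H v v - (H u v)\<^sup>2 \<le> G u u * G v v - (G u v)\<^sup>2"
proof -
  note simps = bilinear_simps[OF G(1)] bilinear_simps[OF H(1)]
  have scaled: ?thesis if "v = c *\<^sub>R u" for c
    using that by (simp add: simps power2_eq_square)
  show ?thesis
  proof (cases "u = 0")
    case True
    then show ?thesis by (simp add: simps)
  next
    case u0: False
    obtain e1 where e1: "G e1 e1 = 1" "\<And>x. H x x \<le> H e1 e1 * G x x"
      "\<And>x. H e1 x = H e1 e1 * G e1 x"
      using quadratic_form_maximum[OF G H(1,2) subspace_UNIV UNIV_I u0] by blast
    \<comment> \<open>Coefficients of a vector of the plane that is orthogonal to \<open>e1\<close>.
      If \<open>u\<close> and \<open>v\<close> are both orthogonal to \<open>e1\<close>, the general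
      formula would give 0, and \<open>u\<close> itself is taken.\<close>
    define \<alpha> \<beta> where "\<alpha> = (if G e1 u = 0 \<and> G e1 v = 0 then 1 else G e1 v)" and
      "\<beta> = (if G e1 u = 0 \<and> G e1 v = 0 then 0 else - G e1 u)"
    define x where "x = \<alpha> *\<^sub>R u + \<beta> *\<^sub>R v"
    have D: "\<alpha>\<^sup>2 + \<beta>\<^sup>2 > 0"
      unfolding \<alpha>_def \<beta>_def by (auto simp: sum_power2_gt_zero_iff)
    have x1: "G e1 x = 0" by (simp add: x_def \<alpha>_def \<beta>_def simps)
    show ?thesis
    proof (cases "x = 0")
      case True
      have "\<beta> \<noteq> 0" using True D u0 by (auto simp: x_def)
      then have "v = (1 / \<beta>) *\<^sub>R (\<beta> *\<^sub>R v)" by simp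
      also have "\<beta> *\<^sub>R v = - (\<alpha> *\<^sub>R u)" using True by (simp add: x_def add_eq_0_iff)
      finally have "v = (- \<alpha> / \<beta>) *\<^sub>R u" by simp
      then show ?thesis by (rule scaled)
    next
      case x0: False
      let ?W = "{x. G e1 x = 0}"
      have sub: "subspace ?W" by (auto simp: subspace_def simps)
      have xW: "x \<in> ?W" using x1 by simp
      obtain e2 where e2: "G e1 e2 = 0" "G e2 e2 = 1"
        "\<And>x. G e1 x = 0 \<Longrightarrow> H x x \<le> H e2 e2 * G x x"
        "\<And>x. G e1 x = 0 \<Longrightarrow> H e2 x = H e2 e2 * G e2 x"
        using quadratic_form_maximum[OF G H(1,2) sub xW x0] by blast
      \<comment> \<open>Maximality gives the equation only on the complement of \<open>e1\<close>.
        The \<open>e1\<close> component contributes 0 to both sides, since \<open>e1\<close> is an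
        eigenvector orthogonal to \<open>e2\<close>.\<close>
      have ev2: "H e2 y = H e2 e2 * G e2 y" for y
      proof -
        have "H e2 (y - G e1 y *\<^sub>R e1) = H e2 e2 * G e2 (y - G e1 y *\<^sub>R e1)"
          by (rule e2) (simp add: simps e1)
        then show ?thesis using e1(3)[of e2] e2(1) by (simp add: simps H(2)[of e2 e1] G(2)[of e2 e1])
      qed
      let ?E = "\<lambda>t. {u. \<forall>v. H u v = t * G u v}" and ?A = "\<lambda>t. {a. a < DIM('a) \<and> (s a)\<^sup>2 = t}"
      have cardA: "card (?A t) = dim (?E t)" for t using s(1) by (simp add: singular_values_def)
      have ne: "?A t \<noteq> {}" if "e \<in> ?E t" "e \<noteq> 0" for t e
      proof -
        have "dim (?E t) \<noteq> 0" using that by (auto simp: dim_eq_0)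
        then show ?thesis using cardA[of t] by (metis card.empty)
      qed
      have enz: "e1 \<noteq> 0" "e2 \<noteq> 0" using e1(1) e2(2) by (auto simp: simps)
      have mem1: "e1 \<in> ?E (H e1 e1)" using e1(3) by blast
      have mem2: "e2 \<in> ?E (H e2 e2)" using ev2 by blast
      \<comment> \<open>The area condition speaks of distinct indices. For equal eigenvalues these
        come from multiplicity: the common eigenspace contains the independent vectors
        \<open>e1\<close> and \<open>e2\<close>.\<close>
      have "\<exists>a\<in>?A (H e1 e1). \<exists>b\<in>?A (H e2 e2). a \<noteq> b"
      proof (cases "H e1 e1 = H e2 e2")
        case False
        obtain a where a: "a \<in> ?A (H e1 e1)"
          using ne[OF mem1 enz(1)] unfolding ex_in_conv[symmetric] ..
        obtain b where b: "b \<in> ?A (H e2 e2)"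
          using ne[OF mem2 enz(2)] unfolding ex_in_conv[symmetric] ..
        have "a \<noteq> b" using a b False by auto
        then show ?thesis using a b by (intro bexI)
      next
        case True
        have "e1 \<notin> span {e2}"
        proof
          assume "e1 \<in> span {e2}"
          then obtain k where "e1 = k *\<^sub>R e2" by (auto simp: span_singleton)
          then have "G e1 e1 = k * G e1 e2" by (metis simps(4))
          then show False using e1(1) e2(1) by simp
        qed
        then have ind: "independent {e1, e2}" "e1 \<noteq> e2"
          using enz by (auto simp: independent_insert span_base)
        have sub: "{e1, e2} \<subseteq> ?E (H e1 e1)" using mem1 mem2 unfolding True by blast
        have "2 \<le> card (?A (H e1 e1))"
          using independent_card_le_dim[OF sub ind(1)] ind(2) cardA by simp
        then have "\<not> card (?A (H e1 e1)) \<le> Suc 0" by linarith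
        then obtain a b where "a \<in> ?A (H e1 e1)" "b \<in> ?A (H e1 e1)" "a \<noteq> b"
          using card_le_Suc0_iff_eq[of "?A (H e1 e1)"] by auto
        then show ?thesis using True by auto
      qed
      then obtain a b where ab: "a < DIM('a)" "b < DIM('a)" "a \<noteq> b" "(s a)\<^sup>2 = H e1 e1" "(s b)\<^sup>2 = H e2 e2"
        by auto
      have "(s a * s b)\<^sup>2 \<le> 1\<^sup>2"
        using s ab by (intro power_mono) (auto simp: singular_values_def)
      then have le1: "H e1 e1 * H e2 e2 \<le> 1" by (simp add: power_mult_distrib ab)
      \<comment> \<open>The pair (x, y) is a rotated and scaled copy of (u, v), and \<open>z\<close>
        differs from \<open>y\<close> by a multiple of \<open>x\<close>; the Gram determinants of
        both forms therefore change by the same positive factor.\<close>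
      define y where "y = (- \<beta>) *\<^sub>R u + \<alpha> *\<^sub>R v"
      define z where "z = y - (G x y / G x x) *\<^sub>R x"
      have Gx: "G x x > 0" using x0 by (rule G(3))
      have gram: "B x x * B z z - (B x z)\<^sup>2 = (\<alpha>\<^sup>2 + \<beta>\<^sup>2)\<^sup>2 * (B u u * B v v - (B u v)\<^sup>2)"
        if B: "bilinear B" "\<And>x y. B x y = B y x" for B :: "'a \<Rightarrow> 'a \<Rightarrow> real"
      proof -
        note bs = bilinear_simps[OF B(1)]
        have "B x x * B z z - (B x z)\<^sup>2 = B x x * B y y - (B x y)\<^sup>2"
          unfolding z_def by (simp add: bs B(2)[of y x] algebra_simps power2_eq_square)
        also have "\<dots> = (\<alpha>\<^sup>2 + \<beta>\<^sup>2)\<^sup>2 * (B u u * B v v - (B u v)\<^sup>2)"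
          unfolding x_def y_def by (simp add: bs B(2)[of v u] algebra_simps power2_eq_square)
        finally show ?thesis .
      qed
      have Gxz: "G x z = 0" using Gx by (simp add: z_def simps)
      have Gz: "G z z \<ge> 0" using G(3)[of z] by (cases "z = 0") (auto simp: simps)
      have "H x x * H z z - (H x z)\<^sup>2 \<le> H x x * H z z" by simp
      also have "\<dots> \<le> (H e2 e2 * G x x) * (H e1 e1 * G z z)"
        by (intro mult_mono e1 e2 x1 H(3) mult_nonneg_nonneg) (use Gx in auto)
      also have "\<dots> = (H e1 e1 * H e2 e2) * (G x x * G z z)" by simp
      also have "\<dots> \<le> 1 * (G x x * G z z)"
        by (intro mult_right_mono le1 mult_nonneg_nonneg) (use Gx Gz in auto)
      finally have "H x x * H z z - (H x z)\<^sup>2 \<le> G x x * G z z - (G x z)\<^sup>2" by (simp add: Gxz)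
      moreover have "(\<alpha>\<^sup>2 + \<beta>\<^sup>2)\<^sup>2 > 0" using D by (rule zero_less_power)
      ultimately show ?thesis
        unfolding gram[OF G(1,2)] gram[OF H(1,2)] by (simp only: mult_le_cancel_left_pos)
    qed
  qed
qed

text \<open>Real orthogonality to both \<open>c\<close> and \<open>\<i> *s c\<close> is Hermitian
  orthogonality to \<open>c\<close>, and the real span of four vectors is proper in real dimension
  at least 6.\<close>

lemma ex_orthogonal_two:
  fixes a b :: "complex^'m::finite"
  assumes "CARD('m) \<ge> 3"
  obtains x where "x \<noteq> 0" "herm x a = 0" "herm x b = 0"
proof -
  have "dim {a, \<i> *s a, b, \<i> *s b} \<le> card {a, \<i> *s a, b, \<i> *s b}" by (intro dim_le_card') simp
  also have "\<dots> \<le> 4" by (intro card_insert_le_m1) auto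
  also have "4 < DIM(complex^'m)" using assms by simp
  finally obtain x where x: "x \<noteq> 0" "\<And>y. y \<in> span {a, \<i> *s a, b, \<i> *s b} \<Longrightarrow> orthogonal x y"
    using orthogonal_to_subspace_exists by blast
  have "herm x c = 0" if "c \<in> {a, b}" for c
  proof -
    have "x \<bullet> c = 0" "x \<bullet> (\<i> *s c) = 0"
      using x(2)[of c] x(2)[of "\<i> *s c"] that by (auto simp: orthogonal_def span_base)
    then show ?thesis
      unfolding Re_herm[symmetric] by (simp add: herm_simps complex_eq_iff)
  qed
  then show ?thesis using that x(1) by simp
qed

text \<open>
  For a largest eigenvalue \<open>\<mu>\<close> with eigenvector \<open>e\<close>, the first hypothesis gives \<open>H x x \<le> 1 / \<mu>\<close> for unit
  vectors orthogonal to \<open>e\<close>; applying the second one to a complex line orthogonal to \<open>e\<close> yields \<open>\<mu> \<le> 1\<close>.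
\<close>

lemma area_equality_on_complex_lines:
  fixes H :: "complex^'m::finite \<Rightarrow> complex^'m \<Rightarrow> real"
  assumes card: "CARD('m) \<ge> 3"
    and H: "bilinear H" "\<And>x y. H x y = H y x" "\<And>x. H x x \<ge> 0"
    and le: "\<And>u v. herm u p = 0 \<Longrightarrow> herm v p = 0 \<Longrightarrow>
      H u u * H v v - (H u v)\<^sup>2 \<le> (u \<bullet> u) * (v \<bullet> v) - (u \<bullet> v)\<^sup>2"
    and ge: "\<And>a. herm a p = 0 \<Longrightarrow> norm a = 1 \<Longrightarrow> 1 \<le> H a a * H (\<i> *s a) (\<i> *s a) - (H a (\<i> *s a))\<^sup>2"
    and uv: "herm u p = 0" "herm v p = 0"
  shows "H u v = u \<bullet> v"
proof -
  note simps = bilinear_simps[OF H(1)]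
  let ?W = "{x. herm x p = 0}"
  have W: "subspace ?W" by (auto simp: subspace_def herm_simps herm_scaleR_left)
  obtain w where w: "w \<noteq> 0" "herm w p = 0" using ex_orthogonal_two[OF card, of p p] by auto
  have inner: "bilinear ((\<bullet>) :: complex^'m \<Rightarrow> _)"
    unfolding bilinear_conv_bounded_bilinear by (rule bounded_bilinear_inner)
  have pos: "x \<bullet> x > 0" if "x \<noteq> 0" for x :: "complex^'m" using that by simp
  have wW: "w \<in> ?W" using w by simp
  obtain e where e: "herm e p = 0" "e \<bullet> e = 1" "\<And>x. herm x p = 0 \<Longrightarrow> H x x \<le> H e e * (x \<bullet> x)"
    "\<And>x. herm x p = 0 \<Longrightarrow> H e x = H e e * (e \<bullet> x)"
    using quadratic_form_maximum[OF inner inner_commute pos H(1,2) W wW w(1)] by blast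
  obtain x0 where x0: "x0 \<noteq> 0" "herm x0 p = 0" "herm x0 e = 0"
    using ex_orthogonal_two[OF card] by blast
  define x where "x = x0 /\<^sub>R norm x0"
  have x: "herm x p = 0" "herm x e = 0" "norm x = 1"
    using x0 by (simp_all add: x_def herm_scaleR_left)
  have le1: "H e e * H y y \<le> 1" if "herm y p = 0" "herm y e = 0" "norm y = 1" for y
  proof -
    have "e \<bullet> y = 0" using that(2) by (metis Re_herm inner_commute zero_complex.sel(1))
    moreover have "y \<bullet> y = 1" using that(3) by (simp add: dot_square_norm)
    ultimately show ?thesis using le[OF e(1) that(1)] e(2) e(4)[OF that(1)] by simp
  qed
  have ix: "herm (\<i> *s y) p = 0" "norm (\<i> *s y) = norm y" if "herm y p = 0" for y p :: "complex^'m"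
    using that by (simp_all add: herm_simps norm_vector_smult)
  have a: "H e e * H x x \<le> 1" by (rule le1[OF x])
  have b: "H e e * H (\<i> *s x) (\<i> *s x) \<le> 1" by (rule le1) (use x ix in auto)
  have c: "1 \<le> H x x * H (\<i> *s x) (\<i> *s x)"
    using ge[OF x(1,3)] zero_le_power2[of "H x (\<i> *s x)"] by linarith
  have "H e e \<le> 1"
  proof (rule ccontr)
    assume "\<not> H e e \<le> 1"
    then have g: "H e e > 1" by simp
    have "H y y < 1" if "H e e * H y y \<le> 1" for y
    proof (rule ccontr)
      assume "\<not> H y y < 1"
      then have "H e e * 1 \<le> H e e * H y y" using g by (intro mult_left_mono) auto
      then show False using that g by linarith
    qed
    then have "H x x < 1" "H (\<i> *s x) (\<i> *s x) < 1" using a b by auto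
    then have "H x x * H (\<i> *s x) (\<i> *s x) < 1 * 1" by (intro mult_strict_mono') (auto simp: H(3))
    then show False using c by simp
  qed
  then have le': "H y y \<le> y \<bullet> y" if "herm y p = 0" for y
    using e(3)[OF that] mult_right_mono[of "H e e" 1 "y \<bullet> y"] by simp
  have unit: "H y y = 1" if "herm y p = 0" "norm y = 1" for y
  proof -
    have y: "H y y \<le> 1" "H (\<i> *s y) (\<i> *s y) \<le> 1"
      using le'[OF that(1)] le'[OF ix(1)[OF that(1)]] ix(2)[OF that(1)] that(2)
      by (simp_all add: dot_square_norm)
    have "1 \<le> H y y * H (\<i> *s y) (\<i> *s y)"
      using ge[OF that] zero_le_power2[of "H y (\<i> *s y)"] by linarith
    also have "\<dots> \<le> H y y * 1" using y H(3) by (intro mult_left_mono) auto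
    finally show ?thesis using y by simp
  qed
  have q: "H y y = y \<bullet> y" if "herm y p = 0" for y
  proof (cases "y = 0")
    case False
    have "H (y /\<^sub>R norm y) (y /\<^sub>R norm y) = 1"
      by (rule unit) (use that False in \<open>simp_all add: herm_scaleR_left\<close>)
    then show ?thesis using False by (simp add: simps field_simps dot_square_norm power2_eq_square)
  qed (simp add: simps)
  have "H (u + v) (u + v) = (u + v) \<bullet> (u + v)" by (rule q) (simp add: herm_simps uv)
  then show ?thesis using q[OF uv(1)] q[OF uv(2)]
    by (simp add: simps inner_add_left inner_add_right H(2)[of v u] inner_commute[of v u])
qed

section \<open>Area non-increasing maps in homogeneous coordinates\<close>

lemma bilinear_fubini_study: "bilinear (fubini_study w)"
  unfolding bilinear_def linear_iff fubini_study_def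
  by (auto simp: herm_simps herm_scaleR_left herm_scaleR_right add_divide_distrib[symmetric]
      intro!: arg_cong[where f="\<lambda>x. x / _"]) (auto simp: algebra_simps)

lemma fubini_study_sym: "fubini_study w u v = fubini_study w v u"
proof -
  have "Re (herm u w * herm w v) = Re (cnj (herm u w * herm w v))" by simp
  also have "\<dots> = Re (herm v w * herm w u)" by (simp add: cnj_herm mult.commute)
  finally show ?thesis unfolding fubini_study_def by (simp add: Re_herm inner_commute)
qed

lemma fubini_study_pos:
  assumes "u \<noteq> 0"
  shows "fubini_study w u u > 0"
proof -
  have "Re (herm u w * herm w u) = (norm (herm u w))\<^sup>2"
    by (metis Re_complex_of_real cnj_herm complex_norm_square)
  also have "\<dots> \<le> (norm u * norm w)\<^sup>2" by (intro power_mono norm_herm_le) auto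
  finally have "Re (herm u w * herm w u) \<le> (norm w)\<^sup>2 * (norm u)\<^sup>2"
    by (simp add: power_mult_distrib mult.commute)
  moreover have "Re (herm u u) = (norm u)\<^sup>2" by (simp add: herm_self)
  moreover have "(norm u)\<^sup>2 > 0" using assms by simp
  moreover have "1 + (norm w)\<^sup>2 > 0" by (simp add: add_pos_nonneg)
  then have p: "(1 + (norm w)\<^sup>2)\<^sup>2 > 0" by (rule zero_less_power)
  have "Re (herm u w * herm w u) < (1 + (norm w)\<^sup>2) * Re (herm u u)"
    using calculation(1-3) by (simp only: ring_distribs)
  then have "0 < (1 + (norm w)\<^sup>2) * Re (herm u u) - Re (herm u w * herm w u)" by linarith
  from divide_pos_pos[OF this p] show ?thesis unfolding fubini_study_def .
qed

lemma fubini_study_nonneg: "fubini_study w u u \<ge> 0"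
  using fubini_study_pos[of u w] by (cases "u = 0") (auto simp: fubini_study_def)

lemma pullback_fs_bilinear:
  assumes "smooth_cproj f" "w \<in> local_domain f i j"
  shows "bilinear (pullback_fs f i j w)"
proof -
  have "linear (frechet_derivative (local_rep f i j) (at w))"
    using local_rep_has_derivative[OF assms] by (rule has_derivative_linear)
  then show ?thesis
    using bilinear_simps(1-4)[OF bilinear_fubini_study]
    unfolding pullback_fs_def Let_def bilinear_def linear_iff by auto
qed

text \<open>The condition on singular values in the form used later: squared areas of
  parallelograms, computed on arbitrary local lifts, do not grow under f.\<close>

lemma lift_area_le:
  fixes z y z2 y2 :: "real \<Rightarrow> complex^('n::finite option)"
  assumes f: "smooth_cproj f" "area_nonincreasing f"
    and z: "(z has_vector_derivative z') (at t)" "z t \<noteq> 0"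
    and y: "(y has_vector_derivative y') (at t)" "y t \<noteq> 0"
    and z2: "(z2 has_vector_derivative z2') (at t2)" "z2 t2 = z t"
    and y2: "(y2 has_vector_derivative y2') (at t2)" "y2 t2 = y t"
    and ev: "\<forall>\<^sub>F s in nhds t. to_cproj (y s) = f (to_cproj (z s))"
      "\<forall>\<^sub>F s in nhds t2. to_cproj (y2 s) = f (to_cproj (z2 s))"
  shows "Re (fs_form (y t) y' y') * Re (fs_form (y t) y2' y2') - (Re (fs_form (y t) y' y2'))\<^sup>2
    \<le> Re (fs_form (z t) z' z') * Re (fs_form (z t) z2' z2') - (Re (fs_form (z t) z' z2'))\<^sup>2"
proof -
  obtain i where i: "z t $ i \<noteq> 0" using z(2) by (auto simp: vec_eq_iff)
  obtain j where j: "y t $ j \<noteq> 0" using y(2) by (auto simp: vec_eq_iff)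
  let ?w = "cchart i (z t)" and ?u = "dchart i (z t) z'" and ?v = "dchart i (z t) z2'"
  have eq: "to_cproj (y t) = f (to_cproj (z t))" using ev(1) by (rule eventually_nhds_x_imp_x)
  have dom: "?w \<in> local_domain f i j" by (rule local_domain_cchart(1)[where f=f, OF i j eq])
  obtain s where s: "singular_values (fubini_study ?w) (pullback_fs f i j ?w) s"
      "\<forall>a < DIM(complex^'n). \<forall>b < DIM(complex^'n). a \<noteq> b \<longrightarrow> s a * s b \<le> 1"
    using f(2) dom unfolding area_nonincreasing_def by blast
  note le = singular_values_area_le[OF bilinear_fubini_study fubini_study_sym fubini_study_pos
      pullback_fs_bilinear[OF f(1) dom] _ _ s, of ?u ?v]
  have p: "pullback_fs f i j ?w ?u ?u = Re (fs_form (y t) y' y')"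
    "pullback_fs f i j ?w ?u ?v = Re (fs_form (y t) y' y2')"
    by (rule pullback_lift[OF f(1) z(1) i y(1) j z(1) refl y(1) refl ev(1) ev(1)]
        pullback_lift[OF f(1) z(1) i y(1) j z2 y2 ev])+
  have "pullback_fs f i j (cchart i (z2 t2)) (dchart i (z2 t2) z2') (dchart i (z2 t2) z2')
      = Re (fs_form (y2 t2) y2' y2')"
    by (rule pullback_lift[OF f(1) z2(1) _ y2(1) _ z2(1) refl y2(1) refl ev(2) ev(2)])
      (use i j z2 y2 in auto)
  then have p2: "pullback_fs f i j ?w ?v ?v = Re (fs_form (y t) y2' y2')" using z2 y2 by simp
  have "pullback_fs f i j ?w ?u ?u * pullback_fs f i j ?w ?v ?v - (pullback_fs f i j ?w ?u ?v)\<^sup>2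
    \<le> fubini_study ?w ?u ?u * fubini_study ?w ?v ?v - (fubini_study ?w ?u ?v)\<^sup>2"
    by (rule le) (auto simp: pullback_fs_def Let_def fubini_study_sym fubini_study_nonneg)
  then show ?thesis unfolding p p2 fubini_study_chart[OF i] .
qed

section \<open>Projection matrices\<close>

text \<open>The Hermitian projection onto the line of \<open>z\<close>. It embeds
  \<open>CP^n\<close> into a Euclidean space, which provides distances between points and a
  chart-free expression of f. The factor is written as an inverse so that the closure rules for
  \<open>Ck_on\<close> apply.\<close>

definition proj_mat :: "complex^'m::finite \<Rightarrow> complex^'m^'m" where
  "proj_mat z = (\<chi> i j. z $ i * cnj (z $ j) * inverse (of_real (z \<bullet> z)))"

lemma proj_mat_mult: "proj_mat z *v x = (herm x z / (norm z)\<^sup>2) *s z"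
  by (simp add: proj_mat_def matrix_vector_mult_def herm_def vec_eq_iff sum_distrib_right
      sum_distrib_left divide_inverse power2_norm_eq_inner mult_ac flip: of_real_power)

lemma proj_mat_scale: "c \<noteq> 0 \<Longrightarrow> proj_mat (c *s z) = proj_mat z"
proof -
  assume c: "c \<noteq> 0"
  have "complex_of_real ((c *s z) \<bullet> (c *s z)) = c * cnj c * of_real (z \<bullet> z)"
    unfolding power2_norm_eq_inner[symmetric] norm_vector_smult
    by (simp add: power_mult_distrib of_real_cmod_square)
  then show ?thesis using c by (simp add: proj_mat_def vec_eq_iff field_simps)
qed

lemma proj_mat_self: "z \<noteq> 0 \<Longrightarrow> proj_mat z *v (c *s z) = c *s z"
  by (simp add: proj_mat_mult herm_simps herm_self)

lemma Ck_on_inner_self: "open S \<Longrightarrow> Ck_on k S (\<lambda>z. z \<bullet> z)"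
  by (intro Ck_on_bilinear[OF bounded_bilinear_inner] Ck_on_bounded_linear_self bounded_linear_ident)

lemma open_nonzero: "open (- {0 :: complex^'m::finite})"
  by (rule open_Compl) simp

lemma Ck_on_proj_mat: "Ck_on k (- {0}) proj_mat"
proof -
  note o = open_nonzero
  have "Ck_on k (- {0}) (\<lambda>z::complex^'a. z $ i * cnj (z $ j) * inverse (of_real (z \<bullet> z)))" for i j
    by (intro Ck_on_bilinear[OF bounded_bilinear_mult o] Ck_on_inverse[OF o]
        Ck_on_linear_compose[OF bounded_linear_of_real o] Ck_on_inner_self o
        Ck_on_linear_compose[OF bounded_linear_cnj o]
        Ck_on_bounded_linear_self[OF bounded_linear_vec_nth o]) auto
  then show ?thesis by (intro Ck_on_vec o) (simp add: proj_mat_def)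
qed

lift_definition cproj_mat :: "'n::finite cproj \<Rightarrow> complex^('n option)^('n option)" is proj_mat
  by (auto simp: proj_rel_def proj_mat_scale)

lemma cproj_mat_to_cproj: "z \<noteq> 0 \<Longrightarrow> cproj_mat (to_cproj z) = proj_mat z"
  by (simp add: cproj_mat.abs_eq proj_rel_refl)

lemma inj_cproj_mat: "inj cproj_mat"
proof (rule injI)
  fix p q :: "'n::finite cproj"
  assume eq: "cproj_mat p = cproj_mat q"
  obtain z where z: "z \<noteq> 0" "p = to_cproj z" by (rule cproj_cases)
  obtain y where y: "y \<noteq> 0" "q = to_cproj y" by (rule cproj_cases)
  have "proj_mat z *v y = y"
    using eq proj_mat_self[OF y(1), of 1] by (simp add: z y cproj_mat_to_cproj)
  then have "y = (herm y z / (norm z)\<^sup>2) *s z" by (simp add: proj_mat_mult)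
  moreover from this have "herm y z / (norm z)\<^sup>2 \<noteq> 0" using y by auto
  ultimately show "p = q" using to_cproj_eq_iff[OF z(1) y(1)] z y by blast
qed

text \<open>Whereas f need not lift to nonzero vectors, the projection onto the image line is
  defined and smooth at every nonzero \<open>z\<close>. Applied to a fixed vector it gives a lift of
  f wherever the result is nonzero.\<close>

definition map_mat :: "('n::finite cproj \<Rightarrow> 'n cproj) \<Rightarrow> complex^('n option) \<Rightarrow> complex^('n option)^('n option)" where
  "map_mat f z = cproj_mat (f (to_cproj z))"

lemma map_mat_eq:
  assumes "y \<noteq> 0" "to_cproj y = f (to_cproj z)"
  shows "map_mat f z = proj_mat y"
  using assms by (simp add: map_mat_def cproj_mat_to_cproj flip: assms(2))

lemma map_mat_fixes:
  assumes "y \<noteq> 0" "to_cproj y = f (to_cproj z)"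
  shows "map_mat f z *v y = y"
  using proj_mat_self[OF assms(1), of 1] by (simp add: map_mat_eq[where f=f, OF assms])

lemma to_cproj_map_mat:
  assumes "map_mat f z *v v \<noteq> 0"
  shows "to_cproj (map_mat f z *v v) = f (to_cproj z)"
proof -
  obtain y where y: "y \<noteq> 0" "f (to_cproj z) = to_cproj y" by (rule cproj_cases)
  have "map_mat f z *v v = (herm v y / (norm y)\<^sup>2) *s y"
    using map_mat_eq[of y f z] y by (simp add: proj_mat_mult)
  moreover from this have "herm v y / (norm y)\<^sup>2 \<noteq> 0" using assms by auto
  ultimately show ?thesis using to_cproj_scale[OF _ y(1)] y(2) by metis
qed

lemma map_mat_idem: "map_mat f z *v (map_mat f z *v v) = map_mat f z *v v"
proof (cases "map_mat f z *v v = 0")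
  case False
  then show ?thesis by (intro map_mat_fixes to_cproj_map_mat)
qed simp

lemma map_mat_scale: "c \<noteq> 0 \<Longrightarrow> z \<noteq> 0 \<Longrightarrow> map_mat f (c *s z) = map_mat f z"
  by (simp add: map_mat_def to_cproj_scale)

lemma Ck_on_affine_lift: "open S \<Longrightarrow> Ck_on k S (affine_lift i)"
proof (rule Ck_on_vec)
  fix j assume S: "open S"
  show "Ck_on k S (\<lambda>w. affine_lift i w $ j)"
    using Ck_on_const[of k S] Ck_on_bounded_linear_self[OF bounded_linear_vec_nth S]
    by (cases "Transposition.transpose None i j") (simp_all add: affine_lift_def)
qed

lemma open_nth_nonzero: "open {z::complex^'m::finite. z $ i \<noteq> 0}"
  by (intro open_Collect_neq continuous_intros)

lemma Ck_on_cchart: "Ck_on k {z. z $ i \<noteq> 0} (cchart i)"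
proof (rule Ck_on_vec[OF open_nth_nonzero])
  fix l
  have "Ck_on k {z::complex^'a option. z $ i \<noteq> 0} (\<lambda>z. z $ Transposition.transpose None i (Some l) * inverse (z $ i))"
    by (intro Ck_on_bilinear[OF bounded_bilinear_mult] Ck_on_inverse open_nth_nonzero
        Ck_on_bounded_linear_self bounded_linear_vec_nth) auto
  then show "Ck_on k {z. z $ i \<noteq> 0} (\<lambda>z. cchart i z $ l)" by (simp add: cchart_def divide_inverse)
qed

lemma Ck_on_map_mat:
  assumes f: "smooth_cproj f"
  shows "Ck_on k (- {0}) (map_mat f)"
proof (rule Ck_on_local)
  fix z :: "complex^'a option" assume "z \<in> - {0}"
  then obtain i where i: "z $ i \<noteq> 0" by (auto simp: vec_eq_iff)
  obtain y where y: "y \<noteq> 0" "f (to_cproj z) = to_cproj y" by (rule cproj_cases)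
  then obtain j where j: "y $ j \<noteq> 0" by (auto simp: vec_eq_iff)
  define U where "U = {z. z $ i \<noteq> 0} \<inter> cchart i -` local_domain f i j"
  have U: "open U" unfolding U_def
    by (rule continuous_open_preimage[OF Ck_on_continuous[OF Ck_on_cchart] open_nth_nonzero open_local_domain[OF f]])
  have zU: "z \<in> U" using i local_domain_cchart(1)[where f=f, OF i j] y by (simp add: U_def)
  have "Ck_on k (local_domain f i j) (local_rep f i j)"
    using f unfolding smooth_cproj_def smooth_on_def by blast
  then have "Ck_on k U (\<lambda>x. local_rep f i j (cchart i x))"
    by (rule Ck_on_compose[OF U open_local_domain[OF f] _ Ck_on_subset[OF Ck_on_cchart]]) (auto simp: U_def)
  then have "Ck_on k U (\<lambda>x. affine_lift j (local_rep f i j (cchart i x)))"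
    by (rule Ck_on_compose[where f="affine_lift j", OF U open_UNIV Ck_on_affine_lift[OF open_UNIV]]) auto
  then have "Ck_on k U (\<lambda>x. proj_mat (affine_lift j (local_rep f i j (cchart i x))))"
    by (rule Ck_on_compose[where f=proj_mat, OF U open_nonzero Ck_on_proj_mat]) auto
  then have "Ck_on k U (map_mat f)"
  proof (rule Ck_on_cong[OF U, rotated])
    fix x assume x: "x \<in> U"
    then have "f (to_cproj x) \<in> affine_domain j"
      by (auto simp: U_def local_domain_def affine_param_cchart)
    then have "affine_param j (local_rep f i j (cchart i x)) = f (to_cproj x)"
      using x by (auto simp: U_def local_rep_def affine_param_cchart affine_param_chart)
    then have "to_cproj (affine_lift j (local_rep f i j (cchart i x))) = f (to_cproj x)"
      by (simp add: affine_param_def)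
    then show "proj_mat (affine_lift j (local_rep f i j (cchart i x))) = map_mat f x"
      by (intro map_mat_eq[symmetric]) auto
  qed
  then show "\<exists>U. open U \<and> z \<in> U \<and> Ck_on k U (map_mat f)" using U zU by blast
qed (rule open_nonzero)

section \<open>The connection form along annuli\<close>

abbreviation D1 :: "(real \<times> real \<Rightarrow> 'b::euclidean_space) \<Rightarrow> real \<times> real \<Rightarrow> 'b" where
  "D1 y p \<equiv> frechet_derivative y (at p) (1, 0)"

abbreviation D2 :: "(real \<times> real \<Rightarrow> 'b::euclidean_space) \<Rightarrow> real \<times> real \<Rightarrow> 'b" where
  "D2 y p \<equiv> frechet_derivative y (at p) (0, 1)"

lemma partial_derivatives:
  assumes "y differentiable (at (r, \<theta>))"
  shows "((\<lambda>r. y (r, \<theta>)) has_vector_derivative D1 y (r, \<theta>)) (at r)"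
    and "((\<lambda>\<theta>. y (r, \<theta>)) has_vector_derivative D2 y (r, \<theta>)) (at \<theta>)"
proof -
  note d = has_derivative_frechet[OF assms]
  have "((\<lambda>r. y (r, \<theta>)) has_derivative (\<lambda>v. frechet_derivative y (at (r, \<theta>)) (v, 0))) (at r)"
    by (rule diff_chain_at[of "\<lambda>r. (r, \<theta>)" "\<lambda>v. (v, 0)" r y, OF _ d, unfolded o_def])
      (auto intro!: derivative_eq_intros)
  moreover have "frechet_derivative y (at (r, \<theta>)) (v, 0) = v *\<^sub>R D1 y (r, \<theta>)" for v
    using linear_cmul[OF has_derivative_linear[OF d], of v "(1, 0)"] by simp
  ultimately show "((\<lambda>r. y (r, \<theta>)) has_vector_derivative D1 y (r, \<theta>)) (at r)"
    unfolding has_vector_derivative_def by (rule has_derivative_eq_rhs[OF _ ext])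
  have "((\<lambda>\<theta>. y (r, \<theta>)) has_derivative (\<lambda>v. frechet_derivative y (at (r, \<theta>)) (0, v))) (at \<theta>)"
    by (rule diff_chain_at[of "\<lambda>\<theta>. (r, \<theta>)" "\<lambda>v. (0, v)" \<theta> y, OF _ d, unfolded o_def])
      (auto intro!: derivative_eq_intros)
  moreover have "frechet_derivative y (at (r, \<theta>)) (0, v) = v *\<^sub>R D2 y (r, \<theta>)" for v
    using linear_cmul[OF has_derivative_linear[OF d], of v "(0, 1)"] by simp
  ultimately show "((\<lambda>\<theta>. y (r, \<theta>)) has_vector_derivative D2 y (r, \<theta>)) (at \<theta>)"
    unfolding has_vector_derivative_def by (rule has_derivative_eq_rhs[OF _ ext])
qed

text \<open>Symmetry of second derivatives. \<open>y\<close> is written as an integral of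
  \<open>D1 y\<close> in the first variable, differentiated under the integral sign in the second,
  and the fundamental theorem is applied to the outcome.\<close>

lemma mixed_partial_derivative:
  fixes y :: "real \<times> real \<Rightarrow> 'b::euclidean_space"
  assumes y: "Ck_on (Suc (Suc 0)) UNIV y"
  shows "((\<lambda>r. D2 y (r, \<theta>)) has_vector_derivative D2 (D1 y) (r0, \<theta>)) (at r0)"
proof -
  \<comment> \<open>Any interval with \<open>r0\<close> in its interior serves; interiority turns
    the one-sided statement of the fundamental theorem into a derivative at
    \<open>r0\<close>.\<close>
  define c d where "c = r0 - 1" and "d = r0 + 1"
  have dy: "y differentiable (at p)" for p using y unfolding Ck_on.simps(2) by blast
  have "Ck_on (Suc 0) UNIV (D1 y)" using y unfolding Ck_on.simps(2)[of "Suc 0"] by blast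
  then have dd: "(D1 y) differentiable (at p)" and cont: "continuous_on UNIV (D2 (D1 y))" for p
    unfolding Ck_on.simps by blast+
  have cont1: "continuous_on UNIV (D1 y)"
    using dd by (auto intro!: continuous_at_imp_continuous_on differentiable_imp_continuous_within)
  have slice: "continuous_on S (\<lambda>r. g (r, \<theta>))" if "continuous_on UNIV g"
    for S \<theta> and g :: "real \<times> real \<Rightarrow> 'b"
    by (rule continuous_on_compose2[OF that]) (auto intro!: continuous_intros)
  have swap: "continuous_on S (\<lambda>(\<theta>, r). g (r, \<theta>))" if "continuous_on UNIV g"
    for S and g :: "real \<times> real \<Rightarrow> 'b"
    unfolding split_beta by (rule continuous_on_compose2[OF that]) (auto intro!: continuous_intros)
  have eq: "D2 y (r, \<theta>) = D2 y (c, \<theta>) + integral {c..r} (\<lambda>\<rho>. D2 (D1 y) (\<rho>, \<theta>))" if "r \<in> {c..d}" for r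
  proof -
    have F: "((\<lambda>\<rho>. D1 y (\<rho>, t)) has_integral (y (r, t) - y (c, t))) {c..r}" for t
      using that
      by (intro fundamental_theorem_of_calculus has_vector_derivative_at_within[OF partial_derivatives(1)[OF dy]]) auto
    then have "y (c, t) + integral {c..r} (\<lambda>\<rho>. D1 y (\<rho>, t)) = y (r, t)" for t
      using integral_unique[OF F[of t]] by simp
    moreover have "((\<lambda>t. integral (cbox c r) (\<lambda>\<rho>. D1 y (\<rho>, t))) has_vector_derivative
        integral (cbox c r) (\<lambda>\<rho>. D2 (D1 y) (\<rho>, \<theta>))) (at \<theta> within UNIV)"
      by (rule leibniz_rule_vector_derivative)
        (auto intro!: partial_derivatives(2)[OF dd] integrable_continuous_real slice[OF cont1] swap[OF cont])
    then have "((\<lambda>t. y (c, t) + integral {c..r} (\<lambda>\<rho>. D1 y (\<rho>, t))) has_vector_derivative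
        D2 y (c, \<theta>) + integral {c..r} (\<lambda>\<rho>. D2 (D1 y) (\<rho>, \<theta>))) (at \<theta>)"
      by (intro has_vector_derivative_add partial_derivatives(2)[OF dy]) simp
    ultimately have "((\<lambda>t. y (r, t)) has_vector_derivative
        D2 y (c, \<theta>) + integral {c..r} (\<lambda>\<rho>. D2 (D1 y) (\<rho>, \<theta>))) (at \<theta>)" by simp
    then show ?thesis using partial_derivatives(2)[OF dy] vector_derivative_unique_at by blast
  qed
  have X: "((\<lambda>r. D2 y (c, \<theta>) + integral {c..r} (\<lambda>\<rho>. D2 (D1 y) (\<rho>, \<theta>))) has_vector_derivative
      0 + D2 (D1 y) (r0, \<theta>)) (at r0 within {c..d})"
    by (intro has_vector_derivative_add has_vector_derivative_const integral_has_vector_derivative slice[OF cont])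
      (auto simp: c_def d_def)
  have "((\<lambda>r. D2 y (r, \<theta>)) has_vector_derivative D2 (D1 y) (r0, \<theta>)) (at r0 within {c..d})"
    by (intro has_vector_derivative_transform[OF _ _ X[unfolded add_0_left]] eq) (auto simp: c_def d_def)
  moreover have "r0 \<in> interior {c..d}" by (simp add: c_def d_def)
  ultimately show ?thesis by (simp only: at_within_interior)
qed

text \<open>The Hermitian connection of the tautological line bundle along a lift \<open>y\<close>.
  Its real part is the derivative of log |y|, its imaginary part the rotation of the phase. Lifts
  are not normalised, because projecting a vector changes its norm.\<close>

definition conn_form :: "complex^'m::finite \<Rightarrow> complex^'m \<Rightarrow> complex" where
  "conn_form y u = herm u y / herm y y"

lemma conn_form_deriv:
  assumes y: "(y has_vector_derivative y') (at t)" "y t \<noteq> 0"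
    and u: "(u has_vector_derivative u') (at t)"
  shows "((\<lambda>s. conn_form (y s) (u s)) has_vector_derivative
    (herm u' (y t) + herm (u t) y') / herm (y t) (y t)
     - herm (u t) (y t) * (herm y' (y t) + herm (y t) y') / (herm (y t) (y t))\<^sup>2) (at t)"
proof -
  have h: "((\<lambda>s. herm (a s) (b s)) has_vector_derivative herm (a t) b' + herm a' (b t)) (at t)"
    if "(a has_vector_derivative a') (at t)" "(b has_vector_derivative b') (at t)" for a a' b b'
    by (rule bounded_bilinear.has_vector_derivative[OF bounded_bilinear_herm that])
  have nz: "herm (y t) (y t) \<noteq> 0" using y(2) by (simp add: herm_self)
  show ?thesis
    unfolding conn_form_def has_vector_derivative_def
    by (rule has_derivative_eq_rhs[OF has_derivative_divide'[OF h[OF u y(1), unfolded has_vector_derivative_def]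
          h[OF y(1) y(1), unfolded has_vector_derivative_def] nz]])
      (use nz in \<open>auto simp: fun_eq_iff scaleR_conv_of_real field_simps power2_eq_square\<close>)
qed

text \<open>The shape produced by the quotient rule in \<open>conn_form_deriv\<close>, and one from
  which continuity is immediate.\<close>

lemma fs_form_alt: "fs_form y u v = herm u v / herm y y - herm u y * herm y v / (herm y y)\<^sup>2"
proof (cases "y = 0")
  case False
  then show ?thesis
    unfolding fs_form_def herm_self by (simp add: diff_divide_distrib power4_eq_xxxx power2_eq_square)
qed (simp add: fs_form_def)

text \<open>
  Stokes' theorem: the derivative of the integral of the connection form over circles is the integral of the
  curvature \<open>2\<i> Im (fs_form y)\<close>, because the angular derivative of its radial component integrates to \<open>0\<close>.
\<close>

lemma connection_integral_deriv:
  fixes y :: "real \<times> real \<Rightarrow> complex^'m::finite"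
  assumes y: "Ck_on (Suc (Suc 0)) UNIV y" and per: "\<And>r \<theta>. y (r, \<theta> + 2 * pi) = y (r, \<theta>)"
    and nz: "\<And>r \<theta>. r \<in> {s..t} \<Longrightarrow> y (r, \<theta>) \<noteq> 0" and r: "r \<in> {s..t}"
  shows "((\<lambda>r. integral {0..2*pi} (\<lambda>\<theta>. conn_form (y (r, \<theta>)) (D2 y (r, \<theta>)))) has_vector_derivative
    integral {0..2*pi} (\<lambda>\<theta>. 2 * \<i> * of_real (Im (fs_form (y (r, \<theta>)) (D2 y (r, \<theta>)) (D1 y (r, \<theta>)))))) (at r within {s..t})"
proof -
  have dy: "y differentiable (at p)" for p using y unfolding Ck_on.simps(2) by blast
  have C: "Ck_on (Suc 0) UNIV (D1 y)" "Ck_on (Suc 0) UNIV (D2 y)"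
    using y unfolding Ck_on.simps(2)[of "Suc 0"] by blast+
  then have dd: "(D1 y) differentiable (at p)" and c12: "continuous_on UNIV (D2 (D1 y))" for p
    unfolding Ck_on.simps by blast+
  have cy: "continuous_on UNIV y" "continuous_on UNIV (D1 y)" "continuous_on UNIV (D2 y)"
    using y C by (blast intro: Ck_on_continuous)+
  note cs = continuous_on_compose2[OF cy(1)] continuous_on_compose2[OF cy(2)]
    continuous_on_compose2[OF cy(3)] continuous_on_compose2[OF c12]
  let ?y = "\<lambda>r \<theta>. y (r, \<theta>)" and ?yr = "\<lambda>r \<theta>. D1 y (r, \<theta>)" and ?yt = "\<lambda>r \<theta>. D2 y (r, \<theta>)"
    and ?yrt = "\<lambda>r \<theta>. D2 (D1 y) (r, \<theta>)"
  let ?n = "\<lambda>r \<theta>. herm (?y r \<theta>) (?y r \<theta>)"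
  have n: "?n r \<theta> \<noteq> 0" if "r \<in> {s..t}" for r \<theta> using nz[OF that] by (simp add: herm_self)
  let ?a = "\<lambda>r \<theta>. (herm (?yrt r \<theta>) (?y r \<theta>) + herm (?yt r \<theta>) (?yr r \<theta>)) / ?n r \<theta>
     - herm (?yt r \<theta>) (?y r \<theta>) * (herm (?yr r \<theta>) (?y r \<theta>) + herm (?y r \<theta>) (?yr r \<theta>)) / (?n r \<theta>)\<^sup>2"
  let ?b = "\<lambda>r \<theta>. (herm (?yrt r \<theta>) (?y r \<theta>) + herm (?yr r \<theta>) (?yt r \<theta>)) / ?n r \<theta>
     - herm (?yr r \<theta>) (?y r \<theta>) * (herm (?yt r \<theta>) (?y r \<theta>) + herm (?y r \<theta>) (?yt r \<theta>)) / (?n r \<theta>)\<^sup>2"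
  let ?F = "\<lambda>r \<theta>. 2 * \<i> * of_real (Im (fs_form (?y r \<theta>) (?yt r \<theta>) (?yr r \<theta>)))"
  \<comment> \<open>\<open>?a\<close> is the radial derivative of the angular component and
    \<open>?b\<close> the angular derivative of the radial component; the second derivatives of the
    lift cancel in the difference and the curvature remains.\<close>
  have aF: "?a r \<theta> = ?b r \<theta> + ?F r \<theta>" for r \<theta>
  proof -
    have "?F r \<theta> = fs_form (?y r \<theta>) (?yt r \<theta>) (?yr r \<theta>) - cnj (fs_form (?y r \<theta>) (?yt r \<theta>) (?yr r \<theta>))"
      by (simp add: complex_eq_iff)
    also have "\<dots> = ?a r \<theta> - ?b r \<theta>"
      unfolding cnj_fs_form fs_form_alt by (simp add: cnj_herm algebra_simps add_divide_distrib diff_divide_distrib)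
    finally show ?thesis by simp
  qed
  have A: "((\<lambda>r. conn_form (?y r \<theta>) (?yt r \<theta>)) has_vector_derivative ?a r \<theta>) (at r)" if "r \<in> {s..t}" for r \<theta>
    using conn_form_deriv[OF partial_derivatives(1)[OF dy] nz[OF that] mixed_partial_derivative[OF y]] .
  have B: "((\<lambda>\<theta>. conn_form (?y r \<theta>) (?yr r \<theta>)) has_vector_derivative ?b r \<theta>) (at \<theta>)" if "r \<in> {s..t}" for r \<theta>
    using conn_form_deriv[OF partial_derivatives(2)[OF dy] nz[OF that] partial_derivatives(2)[OF dd]] .
  have "((\<lambda>r. integral (cbox 0 (2*pi)) (\<lambda>\<theta>. conn_form (?y r \<theta>) (?yt r \<theta>))) has_vector_derivative
      integral (cbox 0 (2*pi)) (?a r)) (at r within {s..t})"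
  proof (rule leibniz_rule_vector_derivative)
    show "((\<lambda>x. conn_form (?y x \<theta>) (?yt x \<theta>)) has_vector_derivative ?a x \<theta>) (at x within {s..t})"
      if "x \<in> {s..t}" for x \<theta> using A[OF that] by (rule has_vector_derivative_at_within)
    show "(\<lambda>\<theta>. conn_form (?y x \<theta>) (?yt x \<theta>)) integrable_on cbox 0 (2*pi)" if "x \<in> {s..t}" for x
      unfolding conn_form_def
      by (intro integrable_continuous continuous_intros herm_continuous_on cs) (use n[OF that] in auto)
    show "continuous_on ({s..t} \<times> cbox 0 (2*pi)) (\<lambda>(r, \<theta>). ?a r \<theta>)"
      unfolding split_beta
      by (intro continuous_intros herm_continuous_on cs) (use n in auto)
  qed (use r in auto)
  moreover have "integral {0..2*pi} (?a r) = integral {0..2*pi} (?F r)"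
  proof -
    have "(?b r has_integral conn_form (?y r (2*pi)) (?yr r (2*pi)) - conn_form (?y r 0) (?yr r 0)) {0..2*pi}"
      by (intro fundamental_theorem_of_calculus has_vector_derivative_at_within[OF B[OF r]]) auto
    moreover have "?yr r (2*pi) = ?yr r 0"
    proof -
      have "(\<lambda>r. ?y r (2*pi)) = (\<lambda>r. ?y r 0)" using per[of _ 0] by simp
      then have "((\<lambda>r. ?y r 0) has_vector_derivative ?yr r (2*pi)) (at r)"
        using partial_derivatives(1)[where r=r and \<theta>="2*pi", OF dy] by (simp only:)
      then show ?thesis by (rule vector_derivative_unique_at[OF _ partial_derivatives(1)[OF dy]])
    qed
    ultimately have b: "(?b r has_integral 0) {0..2*pi}" using per[of r 0] by simp
    have "?F r integrable_on {0..2*pi}"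
      unfolding fs_form_alt
      by (intro integrable_continuous_real continuous_intros herm_continuous_on cs) (use n[OF r] in auto)
    then have "(?F r has_integral integral {0..2*pi} (?F r)) {0..2*pi}" by (rule integrable_integral)
    from has_integral_add[OF b this] have "((\<lambda>\<theta>. ?b r \<theta> + ?F r \<theta>) has_integral integral {0..2*pi} (?F r)) {0..2*pi}"
      by simp
    then show ?thesis unfolding aF[symmetric] by (rule integral_unique)
  qed
  ultimately show ?thesis by simp
qed

section \<open>Strict and non-strict mean value estimates\<close>

lemma norm_integral_less:
  fixes F :: "real \<Rightarrow> 'a::euclidean_space"
  assumes F: "continuous_on {a..b} F" "a < b" "\<And>x. x \<in> {a..b} \<Longrightarrow> norm (F x) \<le> c"
    and x: "x \<in> {a..b}" "norm (F x) < c"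
  shows "norm (integral {a..b} F) < (b - a) * c"
proof -
  have i: "(\<lambda>x. norm (F x)) integrable_on {a..b}"
    by (intro integrable_continuous_real continuous_on_norm F)
  have "norm (integral {a..b} F) \<le> integral {a..b} (\<lambda>x. norm (F x))"
    by (rule integral_norm_bound_integral) (auto intro: i integrable_continuous_real F)
  moreover have "integral {a..b} (\<lambda>x. c - norm (F x)) = (b - a) * c - integral {a..b} (\<lambda>x. norm (F x))"
    using i F(2) by (subst integral_diff) auto
  moreover have "integral {a..b} (\<lambda>x. c - norm (F x)) \<noteq> 0"
    using x F by (subst integral_eq_0_iff) (auto intro!: continuous_intros bexI[of _ x])
  moreover have "integral {a..b} (\<lambda>x. c - norm (F x)) \<ge> 0"
    using F by (intro integral_nonneg integrable_continuous_real continuous_intros) auto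
  ultimately show ?thesis by linarith
qed

lemma norm_diff_le_of_deriv:
  fixes J :: "real \<Rightarrow> 'a::euclidean_space"
  assumes J: "\<And>r. r \<in> {s..t} \<Longrightarrow> (J has_vector_derivative J' r) (at r within {s..t})"
    and \<phi>: "\<And>r. r \<in> {s..t} \<Longrightarrow> (\<phi> has_real_derivative \<phi>' r) (at r within {s..t})"
    and le: "\<And>r. r \<in> {s..t} \<Longrightarrow> norm (J' r) \<le> \<phi>' r" and st: "s \<le> t"
  shows "norm (J t - J s) \<le> \<phi> t - \<phi> s"
proof (cases "s = t")
  case False
  show ?thesis
  proof (rule differentiable_bound_general[where f=J and f'=J' and \<phi>=\<phi> and \<phi>'=\<phi>'])
    show "continuous_on {s..t} \<phi>" using \<phi> by (rule DERIV_continuous_on)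
    show "continuous_on {s..t} J" using J by (rule continuous_on_vector_derivative)
    show "(J has_vector_derivative J' x) (at x)" "(\<phi> has_vector_derivative \<phi>' x) (at x)" if "s < x" "x < t" for x
      using J[of x] \<phi>[of x] that at_within_interior[of x "{s..t}"]
      by (simp_all add: has_real_derivative_iff_has_vector_derivative)
  qed (use le False st in auto)
qed simp

text \<open>The strict gain comes from one point: the difference quotients at \<open>q\<close>
  inherit the strict inequality for small increments, which gives strictness on
  \<open>[q, q + h]\<close>; the intervals before and after are estimated by the non-strict
  lemma.\<close>

lemma norm_diff_less_of_deriv:
  fixes J :: "real \<Rightarrow> 'a::euclidean_space"
  assumes J: "\<And>r. r \<in> {s..t} \<Longrightarrow> (J has_vector_derivative J' r) (at r within {s..t})"
    and \<phi>: "\<And>r. r \<in> {s..t} \<Longrightarrow> (\<phi> has_real_derivative \<phi>' r) (at r within {s..t})"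
    and le: "\<And>r. r \<in> {s..t} \<Longrightarrow> norm (J' r) \<le> \<phi>' r"
    and q: "s < q" "q < t" "norm (J' q) < \<phi>' q"
  shows "norm (J t - J s) < \<phi> t - \<phi> s"
proof -
  have int: "at q within {s..t} = at q" using q by (intro at_within_interior) simp
  have "((\<lambda>h. norm (J (q + h) - J q - h *\<^sub>R J' q) / norm h) \<longlongrightarrow> 0) (at 0)"
    using J[of q] q int by (simp add: has_vector_derivative_def has_derivative_at)
  moreover have "\<forall>\<^sub>F h in at 0. norm (J (q + h) - J q - h *\<^sub>R J' q) / norm h = norm ((J (q + h) - J q) /\<^sub>R h - J' q)"
  proof -
    have "norm (J (q + h) - J q - h *\<^sub>R J' q) / norm h = norm ((J (q + h) - J q) /\<^sub>R h - J' q)" if "h \<noteq> 0" for h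
    proof -
      have "J (q + h) - J q - h *\<^sub>R J' q = h *\<^sub>R ((J (q + h) - J q) /\<^sub>R h - J' q)"
        using that by (simp add: scaleR_diff_right)
      then show ?thesis using that by simp
    qed
    then show ?thesis by (simp add: eventually_at_filter)
  qed
  ultimately have "((\<lambda>h. norm ((J (q + h) - J q) /\<^sub>R h - J' q)) \<longlongrightarrow> 0) (at 0)"
    by (rule Lim_transform_eventually)
  then have "((\<lambda>h. (J (q + h) - J q) /\<^sub>R h) \<longlongrightarrow> J' q) (at 0)"
    by (rule LIM_zero_cancel[OF tendsto_norm_zero_cancel])
  then have 1: "((\<lambda>h. norm ((J (q + h) - J q) /\<^sub>R h)) \<longlongrightarrow> norm (J' q)) (at 0)" by (rule tendsto_norm)
  have "((\<lambda>h. (\<phi> (q + h) - \<phi> q) / h) \<longlongrightarrow> \<phi>' q) (at 0)"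
    using \<phi>[of q] q int by (simp add: DERIV_def)
  from tendsto_diff[OF this 1] have "((\<lambda>h. (\<phi> (q + h) - \<phi> q) / h - norm ((J (q + h) - J q) /\<^sub>R h)) \<longlongrightarrow> \<phi>' q - norm (J' q)) (at 0)" .
  then have "\<forall>\<^sub>F h in at 0. (\<phi> (q + h) - \<phi> q) / h - norm ((J (q + h) - J q) /\<^sub>R h) > 0"
    by (rule order_tendstoD) (use q in simp)
  then obtain \<delta> where \<delta>: "\<delta> > 0"
    "\<And>h. h \<noteq> 0 \<Longrightarrow> \<bar>h\<bar> < \<delta> \<Longrightarrow> (\<phi> (q + h) - \<phi> q) / h - norm ((J (q + h) - J q) /\<^sub>R h) > 0"
    unfolding eventually_at by (auto simp: dist_real_def)
  define h where "h = min (\<delta> / 2) (t - q)"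
  have h: "h > 0" "h < \<delta>" "q + h \<le> t" using \<delta> q by (auto simp: h_def)
  have "norm ((J (q + h) - J q) /\<^sub>R h) = norm (J (q + h) - J q) / h"
    using h by (simp add: divide_inverse_commute)
  then have "norm (J (q + h) - J q) / h < (\<phi> (q + h) - \<phi> q) / h" using \<delta>(2)[of h] h by simp
  then have "norm (J (q + h) - J q) < \<phi> (q + h) - \<phi> q" using h by (simp add: divide_less_cancel)
  moreover have "norm (J q - J s) \<le> \<phi> q - \<phi> s"
    using q by (intro norm_diff_le_of_deriv[where J'=J' and \<phi>'=\<phi>'] has_vector_derivative_within_subset[OF J]
        DERIV_subset[OF \<phi>] le) auto
  moreover have "norm (J t - J (q + h)) \<le> \<phi> t - \<phi> (q + h)"
    using q h by (intro norm_diff_le_of_deriv[where J'=J' and \<phi>'=\<phi>'] has_vector_derivative_within_subset[OF J]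
        DERIV_subset[OF \<phi>] le) auto
  moreover have "J t - J s = (J q - J s) + (J (q + h) - J q) + (J t - J (q + h))" by simp
  ultimately show ?thesis
    using norm_triangle_ineq[of "J q - J s" "J (q + h) - J q"]
      norm_triangle_ineq[of "(J q - J s) + (J (q + h) - J q)" "J t - J (q + h)"] by simp
qed

section \<open>Radial lifts\<close>

lemma vector_smult_has_vector_derivative_cis:
  "((\<lambda>\<theta>. cis \<theta> *s a) has_vector_derivative \<i> *s (cis \<theta> *s a)) (at \<theta>)" for a :: "complex^'m::finite"
proof -
  have "(cis has_vector_derivative \<i> * cis \<theta>) (at \<theta>)"
    unfolding has_vector_derivative_def
    by (rule has_derivative_eq_rhs[OF has_derivative_cis[OF has_derivative_ident]]) (simp add: fun_eq_iff)
  from bounded_linear.has_vector_derivative[OF bounded_bilinear.bounded_linear_left[OF bounded_bilinear_vector_smult] this]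
  show ?thesis by (simp add: vector_smult_assoc)
qed

text \<open>A base point with a unit representative, and a representative of its image. Every point
  admits such data, so a conclusion at \<open>z0\<close> is a conclusion everywhere.\<close>

locale radial =
  fixes f :: "'n::finite cproj \<Rightarrow> 'n cproj" and z0 v0 :: "complex^('n option)"
  assumes smooth: "smooth_cproj f" and area: "area_nonincreasing f"
    and z0: "norm z0 = 1" and v0: "v0 \<noteq> 0" "to_cproj v0 = f (to_cproj z0)"
begin

definition geod :: "real \<Rightarrow> complex^('n option) \<Rightarrow> complex^('n option)" where
  "geod r x = cos r *\<^sub>R z0 + sin r *\<^sub>R x"

text \<open>Strict Cauchy-Schwarz against the unit vector \<open>z0\<close>: the vectors not
  proportional to \<open>z0\<close>. This is an open neighbourhood of \<open>K\<close> on which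
  \<open>geod\<close> never vanishes, so that lifts can be differentiated there as maps on an open
  set.\<close>

definition Omega :: "(complex^('n option)) set" where
  "Omega = {x. norm (herm x z0) < norm x}"

abbreviation cyl :: "(real \<times> (complex^('n option))) set" where
  "cyl \<equiv> UNIV \<times> Omega"

text \<open>The unit horizontal directions at \<open>z0\<close>, a sphere of dimension 2n - 1. Its
  quotient by the circles \<open>cis \<theta> *s a\<close> is the hyperplane at distance pi/2, the
  cut locus of the base point.\<close>

definition K :: "(complex^('n option)) set" where
  "K = {a. norm a = 1 \<and> herm a z0 = 0}"

lemma z0_nz: "z0 \<noteq> 0" using z0 by auto

lemma geod_0 [simp]: "geod 0 x = z0" by (simp add: geod_def)

lemma geod_nonzero:
  assumes "x \<in> Omega" shows "geod r x \<noteq> 0"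
proof
  assume g: "geod r x = 0"
  show False
  proof (cases "sin r = 0")
    case True
    then have "cos r \<noteq> 0" using sin_cos_squared_add[of r] by auto
    then show False using g True z0_nz by (simp add: geod_def)
  next
    case False
    then have "x = (1 / sin r) *\<^sub>R (sin r *\<^sub>R x)" by simp
    also have "sin r *\<^sub>R x = - (cos r *\<^sub>R z0)" using g by (simp add: geod_def add_eq_0_iff)
    finally have "x = (- cos r / sin r) *\<^sub>R z0" by simp
    then obtain k where "x = k *\<^sub>R z0" by blast
    then show False using assms z0 by (simp add: Omega_def herm_scaleR_left herm_self norm_mult)
  qed
qed

lemma continuous_on_herm_left: "continuous_on S (\<lambda>x. herm x z0)"
  by (intro herm_continuous_on continuous_intros)

lemma open_Omega: "open Omega"
  unfolding Omega_def by (intro open_Collect_less continuous_intros continuous_on_herm_left)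

lemma K_subset_Omega: "K \<subseteq> Omega" by (auto simp: K_def Omega_def)

lemma compact_K: "compact K"
proof -
  have "K = sphere 0 1 \<inter> {a. herm a z0 = 0}" by (auto simp: K_def)
  moreover have "closed {a. herm a z0 = 0}"
    by (intro closed_Collect_eq continuous_on_herm_left continuous_intros)
  ultimately show ?thesis by (simp add: compact_Int_closed)
qed

lemma cis_K: "a \<in> K \<Longrightarrow> cis \<theta> *s a \<in> K"
  by (simp add: K_def norm_vector_smult herm_simps)

lemma herm_K:
  assumes "a \<in> K" shows "herm a a = 1" "herm a z0 = 0" "herm z0 a = 0" "herm z0 z0 = 1"
  using assms z0 cnj_herm[of a z0] by (simp_all add: K_def herm_self)

lemma of_real_cos_sin_square:
  "complex_of_real (cos r) * complex_of_real (cos r) + complex_of_real (sin r) * complex_of_real (sin r) = 1"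
  by (metis of_real_1 of_real_add of_real_mult sin_cos_squared_add3)

lemma norm_geod: "a \<in> K \<Longrightarrow> norm (geod r a) = 1"
proof -
  assume a: "a \<in> K"
  have "complex_of_real ((norm (geod r a))\<^sup>2) = of_real (cos r * cos r + sin r * sin r)"
    unfolding herm_self[symmetric] geod_def
    by (simp add: herm_simps herm_scaleR_left herm_scaleR_right herm_K[OF a] of_real_cos_sin_square)
  then have "(norm (geod r a))\<^sup>2 = 1" by (simp only: of_real_eq_iff sin_cos_squared_add3)
  then show ?thesis by (metis norm_ge_zero one_power2 power2_eq_iff_nonneg zero_le_one)
qed

lemma Ck_on_geod: "Ck_on k cyl (\<lambda>p. geod (fst p) (snd p))"
proof -
  have o: "open cyl" by (intro open_Times open_UNIV open_Omega)
  have c: "Ck_on k cyl (\<lambda>p. cos (fst p))"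
    by (rule Ck_on_compose[where g=fst, OF o open_UNIV Ck_on_cos];
        intro Ck_on_bounded_linear_self bounded_linear_fst o UNIV_I)
  have s: "Ck_on k cyl (\<lambda>p. sin (fst p))"
    by (rule Ck_on_compose[where g=fst, OF o open_UNIV Ck_on_sin];
        intro Ck_on_bounded_linear_self bounded_linear_fst o UNIV_I)
  show ?thesis unfolding geod_def
    by (intro Ck_on_add o Ck_on_bilinear[OF bounded_bilinear_scaleR o c Ck_on_const]
        Ck_on_bilinear[OF bounded_bilinear_scaleR o s Ck_on_bounded_linear_self[OF bounded_linear_snd o]])
qed

lemma Ck_on_map_geod: "Ck_on k cyl (\<lambda>p. map_mat f (geod (fst p) (snd p)))"
  by (rule Ck_on_compose[where f="map_mat f", OF _ open_nonzero Ck_on_map_mat[OF smooth] Ck_on_geod])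
    (auto intro: open_Times open_Omega simp: geod_nonzero)

lemma geod_deriv_r:
  "((\<lambda>r. geod r x) has_vector_derivative (- sin r) *\<^sub>R z0 + cos r *\<^sub>R x) (at r)"
  unfolding geod_def by (auto intro!: derivative_eq_intros)

lemma geod_deriv_theta:
  "((\<lambda>\<theta>. geod r (cis \<theta> *s a)) has_vector_derivative sin r *\<^sub>R (\<i> *s (cis \<theta> *s a))) (at \<theta>)"
  unfolding geod_def
  using has_vector_derivative_add[OF has_vector_derivative_const
      bounded_linear.has_vector_derivative[OF bounded_linear_scaleR_right vector_smult_has_vector_derivative_cis]]
  by simp

lemma fs_form_unit: "norm z = 1 \<Longrightarrow> fs_form z u v = herm u v - herm u z * herm z v"
  by (simp add: fs_form_def)

text \<open>The squared area density, in polar coordinates, of the complex line through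
  \<open>z0\<close> and \<open>x\<close>. That line is a round sphere of radius 1/2, whose circle at
  distance r has length 2 pi sin r cos r.\<close>

lemma geod_gram:
  assumes "x \<in> K"
  shows "Re (fs_form (geod r x) (sin r *\<^sub>R (\<i> *s x)) (sin r *\<^sub>R (\<i> *s x)))
      * Re (fs_form (geod r x) ((- sin r) *\<^sub>R z0 + cos r *\<^sub>R x) ((- sin r) *\<^sub>R z0 + cos r *\<^sub>R x))
      - (Re (fs_form (geod r x) (sin r *\<^sub>R (\<i> *s x)) ((- sin r) *\<^sub>R z0 + cos r *\<^sub>R x)))\<^sup>2 = (sin r * cos r)\<^sup>2"
proof -
  note h = herm_simps herm_scaleR_left herm_scaleR_right herm_K[OF assms]
  have s: "(sin r)\<^sup>2 + (cos r)\<^sup>2 = 1" by simp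
  have 1: "fs_form (geod r x) (sin r *\<^sub>R (\<i> *s x)) (sin r *\<^sub>R (\<i> *s x)) = of_real ((sin r)\<^sup>2 - (sin r)^4)"
    by (simp only: fs_form_unit[OF norm_geod[OF assms]]) (simp add: geod_def h power2_eq_square power4_eq_xxxx algebra_simps)
  have 2: "fs_form (geod r x) ((- sin r) *\<^sub>R z0 + cos r *\<^sub>R x) ((- sin r) *\<^sub>R z0 + cos r *\<^sub>R x) = of_real ((sin r)\<^sup>2 + (cos r)\<^sup>2)"
    by (simp only: fs_form_unit[OF norm_geod[OF assms]]) (simp add: geod_def h power2_eq_square algebra_simps of_real_cos_sin_square)
  have 3: "fs_form (geod r x) (sin r *\<^sub>R (\<i> *s x)) ((- sin r) *\<^sub>R z0 + cos r *\<^sub>R x) = \<i> * of_real (sin r * cos r)"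
    by (simp only: fs_form_unit[OF norm_geod[OF assms]]) (simp add: geod_def h power2_eq_square algebra_simps of_real_cos_sin_square)
  have c: "(cos r)\<^sup>2 = 1 - (sin r)\<^sup>2" using s by linarith
  show ?thesis unfolding 1 2 3 s
    by (simp add: power_mult_distrib c) (simp add: algebra_simps power2_eq_square power4_eq_xxxx)
qed

end

section \<open>Discrete parallel transport along rays\<close>

text \<open>The subdivision is so fine that the image lines at neighbouring radii are never
  orthogonal, uniformly in the direction.\<close>

locale mesh = radial f z0 v0 for f :: "'n::finite cproj \<Rightarrow> 'n cproj" and z0 v0 +
  fixes N :: nat
  assumes N: "N \<ge> 1"
    and mesh: "\<And>r s x v. r \<in> {0..pi/2} \<Longrightarrow> s \<in> {0..pi/2} \<Longrightarrow> \<bar>r - s\<bar> \<le> pi / (2 * real N) \<Longrightarrow> x \<in> K \<Longrightarrow> v \<noteq> 0 \<Longrightarrow>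
      map_mat f (geod s x) *v v = v \<Longrightarrow> map_mat f (geod r x) *v v \<noteq> 0"
begin

definition h :: real where "h = pi / (2 * real N)"

text \<open>
  Discrete parallel transport of \<open>v0\<close> along the ray from \<open>z0\<close> in the direction \<open>x\<close>: project successively onto
  the lines \<open>f [geod r x]\<close>. The mesh condition keeps the projections nonzero.
\<close>

fun V :: "nat \<Rightarrow> complex^('n option) \<Rightarrow> complex^('n option)" where
  "V 0 x = v0"
| "V (Suc j) x = map_mat f (geod (real (Suc j) * h) x) *v V j x"

text \<open>Interpolates between \<open>V j\<close> and \<open>V (Suc j)\<close>: on the
  \<open>j\<close>-th interval of radii it is a nonvanishing lift of f, and it starts at
  \<open>V j\<close> because projections are idempotent.\<close>

definition Y :: "nat \<Rightarrow> real \<Rightarrow> complex^('n option) \<Rightarrow> complex^('n option)" where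
  "Y j r x = map_mat f (geod r x) *v V j x"

lemma h: "h > 0" "real N * h = pi / 2"
  using N by (simp_all add: h_def)

lemma jh: assumes "j < N" "r \<in> {real j * h..real (Suc j) * h}"
  shows "r \<in> {0..pi/2}" "real j * h \<in> {0..pi/2}" "\<bar>r - real j * h\<bar> \<le> h"
proof -
  have "real (Suc j) * h \<le> real N * h" using assms h by (intro mult_right_mono) auto
  moreover have "0 \<le> real j * h" using h by simp
  moreover have "real (Suc j) * h = real j * h + h" by (simp add: algebra_simps)
  moreover have "real j * h \<le> r" "r \<le> real (Suc j) * h" using assms(2) by auto
  ultimately show "r \<in> {0..pi/2}" "real j * h \<in> {0..pi/2}" "\<bar>r - real j * h\<bar> \<le> h"
    unfolding atLeastAtMost_iff abs_le_iff using h by linarith+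
qed

lemma Y_start: "Y j (real j * h) x = V j x"
proof (cases j)
  case 0
  then show ?thesis by (simp add: Y_def map_mat_fixes v0)
next
  case (Suc i)
  show ?thesis unfolding Suc Y_def V.simps by (rule map_mat_idem)
qed

lemma Y_end: "Y j (real (Suc j) * h) x = V (Suc j) x"
  by (simp add: Y_def)

lemma Y_nonzero_aux:
  assumes "j < N" "x \<in> K" "r \<in> {real j * h..real (Suc j) * h}" "V j x \<noteq> 0"
  shows "Y j r x \<noteq> 0"
  using mesh[folded h_def, OF jh[OF assms(1,3)] assms(2,4) Y_start[of j x, unfolded Y_def]]
  by (simp only: Y_def not_False_eq_True)

lemma V_nonzero: "j \<le> N \<Longrightarrow> x \<in> K \<Longrightarrow> V j x \<noteq> 0"
proof (induction j)
  case (Suc j)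
  have "Y j (real (Suc j) * h) x \<noteq> 0"
    by (rule Y_nonzero_aux) (use Suc h in \<open>auto simp: mult_right_mono\<close>)
  then show ?case unfolding Y_end .
qed (simp add: v0)

lemma Y_nonzero:
  assumes "j < N" "x \<in> K" "r \<in> {real j * h..real (Suc j) * h}"
  shows "Y j r x \<noteq> 0"
  using assms V_nonzero[of j x] by (intro Y_nonzero_aux) auto

lemma to_cproj_Y: "Y j r x \<noteq> 0 \<Longrightarrow> to_cproj (Y j r x) = f (to_cproj (geod r x))"
  unfolding Y_def by (rule to_cproj_map_mat)

lemma Ck_on_Y_gen:
  assumes "Ck_on k Omega (V j)"
  shows "Ck_on k cyl (\<lambda>p. Y j (fst p) (snd p))"
proof -
  have o: "open cyl" by (intro open_Times open_UNIV open_Omega)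
  have "Ck_on k cyl (\<lambda>p. V j (snd p))"
    by (rule Ck_on_compose[where g=snd, OF o open_Omega assms]) (auto intro: Ck_on_bounded_linear_self bounded_linear_snd o)
  then show ?thesis unfolding Y_def
    by (intro Ck_on_bilinear[OF bounded_bilinear_matrix_vector_mult o Ck_on_map_geod])
qed

lemma Ck_on_V: "Ck_on k Omega (V j)"
proof (induction j)
  case 0
  have "V 0 = (\<lambda>x. v0)" by (simp add: fun_eq_iff)
  then show ?case by (simp add: Ck_on_const)
next
  case (Suc j)
  have P: "Ck_on k Omega (\<lambda>x. (real (Suc j) * h, x))"
    by (intro Ck_on_Pair open_Omega Ck_on_const Ck_on_bounded_linear_self[OF bounded_linear_ident])
  have o: "open cyl" by (intro open_Times open_UNIV open_Omega)
  have "Ck_on k Omega (\<lambda>x. Y j (fst (real (Suc j) * h, x)) (snd (real (Suc j) * h, x)))"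
    by (rule Ck_on_compose[OF open_Omega o Ck_on_Y_gen[OF Suc] P]) simp
  then show ?case by (rule Ck_on_cong[OF open_Omega, rotated]) (simp add: Y_def)
qed

text \<open>Rotating the direction by a phase stays in the complex line through \<open>z0\<close>
  and \<open>a\<close>, so this is the lift over an annulus of that line. It is a smooth map on the
  whole plane, but known to be nonzero only for radii in the \<open>j\<close>-th interval.\<close>

definition surf :: "nat \<Rightarrow> complex^('n option) \<Rightarrow> real \<times> real \<Rightarrow> complex^('n option)" where
  "surf j a p = Y j (fst p) (cis (snd p) *s a)"

lemma Ck_on_cis: "Ck_on k UNIV (\<lambda>\<theta>. cis \<theta> *s a)" for a :: "complex^('n option)"
proof -
  have "Ck_on k UNIV (\<lambda>\<theta>. cos \<theta> *\<^sub>R a + sin \<theta> *\<^sub>R (\<i> *s a))"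
    by (intro Ck_on_add Ck_on_bilinear[OF bounded_bilinear_scaleR] Ck_on_cos Ck_on_sin Ck_on_const open_UNIV)
  moreover have "cos \<theta> *\<^sub>R a + sin \<theta> *\<^sub>R (\<i> *s a) = cis \<theta> *s a" for \<theta>
    by (simp add: vec_eq_iff complex_eq_iff)
  ultimately show ?thesis by simp
qed

lemma Ck_on_surf:
  assumes "a \<in> K" shows "Ck_on k UNIV (surf j a)"
proof -
  have "Ck_on k UNIV (\<lambda>p::real \<times> real. cis (snd p) *s a)"
    by (rule Ck_on_compose[where g=snd and f="\<lambda>\<theta>. cis \<theta> *s a", OF open_UNIV open_UNIV Ck_on_cis])
      (auto intro: Ck_on_bounded_linear_self bounded_linear_snd)
  then have "Ck_on k UNIV (\<lambda>p::real \<times> real. (fst p, cis (snd p) *s a))"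
    by (rule Ck_on_Pair[OF open_UNIV Ck_on_bounded_linear_self[OF bounded_linear_fst open_UNIV]])
  from Ck_on_compose[OF open_UNIV _ Ck_on_Y_gen[OF Ck_on_V] this]
  have "Ck_on k UNIV (\<lambda>p::real \<times> real. Y j (fst (fst p, cis (snd p) *s a)) (snd (fst p, cis (snd p) *s a)))"
    using cis_K[OF assms] K_subset_Omega by (auto intro: open_Times open_Omega)
  then show ?thesis by (simp add: surf_def[abs_def])
qed

text \<open>Three estimates in a row: Wirtinger's inequality at the image, the area bound for f, and
  the density of the complex line in polar coordinates.\<close>

lemma curvature_le:
  assumes j: "j < N" and a: "a \<in> K" and r: "r \<in> {real j * h..real (Suc j) * h}"
  shows "2 * \<bar>Im (fs_form (surf j a (r, \<theta>)) (D2 (surf j a) (r, \<theta>)) (D1 (surf j a) (r, \<theta>)))\<bar> \<le> sin (2 * r)"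
proof -
  let ?y = "surf j a" and ?x = "cis \<theta> *s a"
  have x: "?x \<in> K" by (rule cis_K[OF a])
  have dy: "?y differentiable (at (r, \<theta>))" using Ck_on_surf[OF a, of "Suc 0"] by simp
  have nz: "?y (r, \<theta>) \<noteq> 0" using Y_nonzero[OF j x r] by (simp add: surf_def)
  have cont: "continuous_on UNIV ?y" by (rule Ck_on_continuous[OF Ck_on_surf[OF a]])
  \<comment> \<open>\<open>surf\<close> represents the image under f only where it is nonzero;
    continuity extends this from the point to a neighbourhood on either coordinate curve.\<close>
  have ev: "\<forall>\<^sub>F s in nhds t. to_cproj (?y (g s)) = f (to_cproj (geod (fst (g s)) (cis (snd (g s)) *s a)))"
    if "continuous_on UNIV g" "g t = (r, \<theta>)" for g :: "real \<Rightarrow> real \<times> real" and t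
  proof -
    have "continuous_on UNIV (\<lambda>s. ?y (g s))"
      by (rule continuous_on_compose2[OF cont that(1)]) simp
    then have "isCont (\<lambda>s. ?y (g s)) t" by (simp only: continuous_on_eq_continuous_at open_UNIV UNIV_I)
    then have "((\<lambda>s. ?y (g s)) \<longlongrightarrow> ?y (g t)) (nhds t)"
      by (rule iffD1[OF tendsto_at_iff_tendsto_nhds isContD])
    then have "\<forall>\<^sub>F s in nhds t. ?y (g s) \<noteq> 0" by (rule tendsto_imp_eventually_ne) (simp add: that nz)
    then show ?thesis by eventually_elim (simp add: surf_def to_cproj_Y)
  qed
  have c1: "continuous_on UNIV (\<lambda>t::real. (r, t))" and c2: "continuous_on UNIV (\<lambda>t::real. (t, \<theta>))"
    by (intro continuous_intros)+
  have "(Im (fs_form (?y (r, \<theta>)) (D2 ?y (r, \<theta>)) (D1 ?y (r, \<theta>))))\<^sup>2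
    \<le> Re (fs_form (?y (r, \<theta>)) (D2 ?y (r, \<theta>)) (D2 ?y (r, \<theta>))) * Re (fs_form (?y (r, \<theta>)) (D1 ?y (r, \<theta>)) (D1 ?y (r, \<theta>)))
      - (Re (fs_form (?y (r, \<theta>)) (D2 ?y (r, \<theta>)) (D1 ?y (r, \<theta>))))\<^sup>2"
    by (rule fs_form_Cauchy_Schwarz[OF nz])
  also have "\<dots> \<le> Re (fs_form (geod r ?x) (sin r *\<^sub>R (\<i> *s ?x)) (sin r *\<^sub>R (\<i> *s ?x)))
      * Re (fs_form (geod r ?x) ((- sin r) *\<^sub>R z0 + cos r *\<^sub>R ?x) ((- sin r) *\<^sub>R z0 + cos r *\<^sub>R ?x))
      - (Re (fs_form (geod r ?x) (sin r *\<^sub>R (\<i> *s ?x)) ((- sin r) *\<^sub>R z0 + cos r *\<^sub>R ?x)))\<^sup>2"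
    by (rule lift_area_le[OF smooth area geod_deriv_theta _ partial_derivatives(2)[OF dy] nz
          geod_deriv_r refl partial_derivatives(1)[OF dy] refl])
      (use ev[OF c1, of \<theta>] ev[OF c2, of r] geod_nonzero K_subset_Omega x in auto)
  also have "\<dots> = (sin r * cos r)\<^sup>2" by (rule geod_gram[OF x])
  finally have "\<bar>Im (fs_form (?y (r, \<theta>)) (D2 ?y (r, \<theta>)) (D1 ?y (r, \<theta>)))\<bar> \<le> \<bar>sin r * cos r\<bar>"
    by (rule abs_le_square_iff[THEN iffD2])
  moreover have "sin r \<ge> 0" "cos r \<ge> 0" using jh(1)[OF j r] by (auto intro: sin_ge_zero cos_ge_zero)
  ultimately show ?thesis by (simp add: sin_double)
qed

end

section \<open>The degree\<close>

context mesh
begin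

text \<open>The connection form evaluated on the velocity of the Hopf circle through
  \<open>x\<close>.\<close>

definition rate :: "nat \<Rightarrow> complex^('n option) \<Rightarrow> complex" where
  "rate j x = conn_form (V j x) (frechet_derivative (V j) (at x) (\<i> *s x))"

text \<open>The holonomy integral of the lift. For \<open>j = N\<close> the circle lies over a
  single point of \<open>CP^n\<close>, and the value is, up to sign, 2 pi \<i> times the degree of f
  on the complex line through \<open>z0\<close> and \<open>a\<close>.\<close>

definition conn :: "nat \<Rightarrow> complex^('n option) \<Rightarrow> complex" where
  "conn j a = integral {0..2*pi} (\<lambda>\<theta>. rate j (cis \<theta> *s a))"

lemma V_theta_deriv:
  assumes "a \<in> K"
  shows "((\<lambda>\<theta>. V j (cis \<theta> *s a)) has_vector_derivative
    frechet_derivative (V j) (at (cis \<theta> *s a)) (\<i> *s (cis \<theta> *s a))) (at \<theta>)"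
proof -
  have "cis \<theta> *s a \<in> Omega" using cis_K[OF assms] K_subset_Omega by blast
  then have "(V j has_derivative frechet_derivative (V j) (at (cis \<theta> *s a))) (at (cis \<theta> *s a))"
    by (rule Ck_on_SucE[OF Ck_on_V])
  from vector_derivative_diff_chain_within[OF vector_smult_has_vector_derivative_cis has_derivative_at_withinI[OF this]]
  show ?thesis by (simp add: o_def)
qed

definition circle_conn :: "nat \<Rightarrow> complex^('n option) \<Rightarrow> real \<Rightarrow> complex" where
  "circle_conn j a r = integral {0..2*pi} (\<lambda>\<theta>. conn_form (surf j a (r, \<theta>)) (D2 (surf j a) (r, \<theta>)))"

text \<open>The integral depends only on the lift along the circle. Hence adjacent annuli contribute
  the same value at their common radius, and the increments telescope.\<close>

lemma circle_conn_eq: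
  assumes a: "a \<in> K" and eq: "\<And>x. Y j r x = V i x"
  shows "circle_conn j a r = conn i a"
proof -
  have dy: "surf j a differentiable (at p)" for p
    using Ck_on_surf[OF a, of "Suc 0"] unfolding Ck_on.simps(2) by blast
  have "D2 (surf j a) (r, \<theta>) = frechet_derivative (V i) (at (cis \<theta> *s a)) (\<i> *s (cis \<theta> *s a))" for \<theta>
  proof (rule vector_derivative_unique_at[OF _ V_theta_deriv[OF a]])
    show "((\<lambda>\<theta>. V i (cis \<theta> *s a)) has_vector_derivative D2 (surf j a) (r, \<theta>)) (at \<theta>)"
      using partial_derivatives(2)[where r=r and \<theta>=\<theta>, OF dy]
      by (simp only: surf_def[of j a "(_, _)"] fst_conv snd_conv eq)
  qed
  then show ?thesis by (simp add: circle_conn_def conn_def rate_def surf_def eq)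
qed

lemma circle_conn_start: "a \<in> K \<Longrightarrow> circle_conn j a (real j * h) = conn j a"
  by (rule circle_conn_eq) (auto simp: Y_start)

lemma circle_conn_end: "a \<in> K \<Longrightarrow> circle_conn j a (real (Suc j) * h) = conn (Suc j) a"
  by (rule circle_conn_eq[OF _ Y_end])

abbreviation curv :: "nat \<Rightarrow> complex^('n option) \<Rightarrow> real \<Rightarrow> real \<Rightarrow> real" where
  "curv j a r \<theta> \<equiv> Im (fs_form (surf j a (r, \<theta>)) (D2 (surf j a) (r, \<theta>)) (D1 (surf j a) (r, \<theta>)))"

lemma surf_nonzero: "j < N \<Longrightarrow> a \<in> K \<Longrightarrow> r \<in> {real j * h..real (Suc j) * h} \<Longrightarrow> surf j a (r, \<theta>) \<noteq> 0"
  by (simp add: surf_def Y_nonzero cis_K)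

lemma circle_conn_deriv:
  assumes j: "j < N" and a: "a \<in> K" and r: "r \<in> {real j * h..real (Suc j) * h}"
  shows "(circle_conn j a has_vector_derivative integral {0..2*pi} (\<lambda>\<theta>. 2 * \<i> * of_real (curv j a r \<theta>)))
    (at r within {real j * h..real (Suc j) * h})"
  unfolding circle_conn_def[abs_def]
proof (rule connection_integral_deriv[OF Ck_on_surf[OF a] _ surf_nonzero[OF j a] r])
  show "surf j a (r, \<theta> + 2 * pi) = surf j a (r, \<theta>)" for r \<theta>
    by (simp add: surf_def flip: cis_mult)
qed

lemma continuous_on_curv:
  assumes j: "j < N" and a: "a \<in> K" and r: "r \<in> {real j * h..real (Suc j) * h}"
  shows "continuous_on S (\<lambda>\<theta>. 2 * \<i> * of_real (curv j a r \<theta>))"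
proof -
  have y: "Ck_on (Suc 0) UNIV (surf j a)" by (rule Ck_on_surf[OF a])
  then have c: "continuous_on UNIV (surf j a)" "continuous_on UNIV (D1 (surf j a))" "continuous_on UNIV (D2 (surf j a))"
    using Ck_on_continuous[OF y] unfolding Ck_on.simps by blast+
  note cs = continuous_on_compose2[OF c(1)] continuous_on_compose2[OF c(2)] continuous_on_compose2[OF c(3)]
  show ?thesis unfolding fs_form_alt
    by (intro continuous_intros herm_continuous_on cs) (use surf_nonzero[OF j a r] in \<open>auto simp: herm_self\<close>)
qed

lemma curv_integral_le:
  assumes "j < N" "a \<in> K" "r \<in> {real j * h..real (Suc j) * h}"
  shows "norm (integral {0..2*pi} (\<lambda>\<theta>. 2 * \<i> * of_real (curv j a r \<theta>))) \<le> 2 * pi * sin (2 * r)"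
proof -
  have "norm (integral {0..2*pi} (\<lambda>\<theta>. 2 * \<i> * complex_of_real (curv j a r \<theta>))) \<le> integral {0..2*pi} (\<lambda>_. sin (2 * r))"
    using curvature_le[OF assms]
    by (intro integral_norm_bound_integral integrable_continuous_real continuous_on_curv[OF assms] continuous_intros)
      (auto simp: norm_mult)
  then show ?thesis by simp
qed

text \<open>A primitive of the curvature bound. Its total increase over [0, pi/2] is 2 pi, the least
  nonzero norm that \<open>conn N a\<close> can have.\<close>

lemma phi_deriv: "((\<lambda>r. - pi * cos (2 * r)) has_real_derivative 2 * pi * sin (2 * r)) (at r within S)"
  by (auto intro!: derivative_eq_intros)

lemma conn_step:
  assumes j: "j < N" and a: "a \<in> K"
  shows "norm (conn (Suc j) a - conn j a) \<le> pi * (cos (2 * (real j * h)) - cos (2 * (real (Suc j) * h)))"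
proof -
  have "norm (circle_conn j a (real (Suc j) * h) - circle_conn j a (real j * h))
      \<le> - pi * cos (2 * (real (Suc j) * h)) - (- pi * cos (2 * (real j * h)))"
    by (rule norm_diff_le_of_deriv[OF circle_conn_deriv[OF j a] phi_deriv curv_integral_le[OF j a]])
      (use h in \<open>auto simp: mult_right_mono\<close>)
  then show ?thesis by (simp only: circle_conn_start[OF a] circle_conn_end[OF a]) (simp add: algebra_simps)
qed

lemma conn_0: "conn 0 a = 0"
proof -
  have "V 0 = (\<lambda>x. v0)" by (simp add: fun_eq_iff)
  then have "rate 0 x = 0" for x by (simp add: rate_def conn_form_def)
  then show ?thesis by (simp add: conn_def)
qed

lemma conn_diff_le:
  assumes a: "a \<in> K" and "j \<le> n" "n \<le> N"
  shows "norm (conn n a - conn j a) \<le> pi * (cos (2 * (real j * h)) - cos (2 * (real n * h)))"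
  using assms(2,3)
proof (induction n rule: dec_induct)
  case (step n)
  have "norm (conn (Suc n) a - conn j a) \<le> norm (conn (Suc n) a - conn n a) + norm (conn n a - conn j a)"
    using norm_triangle_ineq[of "conn (Suc n) a - conn n a" "conn n a - conn j a"] by simp
  then show ?case using conn_step[OF _ a, of n] step by (simp add: algebra_simps)
qed simp

lemma cos_end: "cos (2 * (real N * h)) = -1"
proof -
  have "2 * (real N * h) = pi" using h(2) by simp
  then show ?thesis by (simp only: cos_pi)
qed

text \<open>A curvature defect at one point makes the integral over its circle strictly smaller,
  then the increment over the first annulus; the remaining annuli obey the non-strict bound, and the
  sum of all bounds is 2 pi.\<close>

lemma norm_conn_less:
  assumes a: "a \<in> K" and q: "0 < q" "q < h" and \<theta>: "\<theta> \<in> {0..2*pi}"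
    and less: "2 * \<bar>curv 0 a q \<theta>\<bar> < sin (2 * q)"
  shows "norm (conn N a) < 2 * pi"
proof -
  have j: "0 < N" using N by simp
  have r: "q \<in> {real 0 * h..real (Suc 0) * h}" using q by simp
  have "norm (integral {0..2*pi} (\<lambda>\<theta>. 2 * \<i> * complex_of_real (curv 0 a q \<theta>))) < (2 * pi - 0) * sin (2 * q)"
    using curvature_le[OF j a r] less
    by (intro norm_integral_less[OF continuous_on_curv[OF j a r] _ _ \<theta>]) (auto simp: norm_mult)
  then have "norm (circle_conn 0 a (real (Suc 0) * h) - circle_conn 0 a (real 0 * h))
      < - pi * cos (2 * (real (Suc 0) * h)) - (- pi * cos (2 * (real 0 * h)))"
    by (intro norm_diff_less_of_deriv[OF circle_conn_deriv[OF j a] phi_deriv curv_integral_le[OF j a], of q])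
      (use q in auto)
  then have "norm (conn (Suc 0) a - conn 0 a) < pi - pi * cos (2 * (real (Suc 0) * h))"
    by (simp only: circle_conn_start[OF a] circle_conn_end[OF a]) simp
  moreover have "norm (conn N a - conn (Suc 0) a) \<le> pi * (cos (2 * (real (Suc 0) * h)) - cos (2 * (real N * h)))"
    using N by (intro conn_diff_le[OF a]) auto
  moreover have "norm (conn N a) \<le> norm (conn N a - conn (Suc 0) a) + norm (conn (Suc 0) a - conn 0 a)"
    using norm_triangle_ineq[of "conn N a - conn (Suc 0) a" "conn (Suc 0) a - conn 0 a"] by (simp add: conn_0)
  ultimately show ?thesis unfolding cos_end by (simp add: algebra_simps)
qed

section \<open>Integrality of the degree\<close>

lemma continuous_on_rate: "j \<le> N \<Longrightarrow> continuous_on K (rate j)"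
proof -
  assume j: "j \<le> N"
  have C: "Ck_on (Suc 0) Omega (V j)" by (rule Ck_on_V)
  have "frechet_derivative (V j) (at x) u = (\<Sum>b\<in>Basis. (u \<bullet> b) *\<^sub>R frechet_derivative (V j) (at x) b)"
    if "x \<in> Omega" for x u
  proof -
    interpret linear "frechet_derivative (V j) (at x)"
      using Ck_on_SucE[OF C that] by (rule has_derivative_linear)
    have "frechet_derivative (V j) (at x) u = frechet_derivative (V j) (at x) (\<Sum>b\<in>Basis. (u \<bullet> b) *\<^sub>R b)"
      by (simp add: euclidean_representation)
    then show ?thesis by (simp add: sum scale)
  qed
  moreover have "continuous_on Omega (\<lambda>x. \<Sum>b\<in>Basis. ((\<i> *s x) \<bullet> b) *\<^sub>R frechet_derivative (V j) (at x) b)"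
    using C by (intro continuous_on_sum continuous_on_scaleR continuous_intros
        bounded_bilinear.continuous_on[OF bounded_bilinear_vector_smult]) auto
  ultimately have c: "continuous_on Omega (\<lambda>x. frechet_derivative (V j) (at x) (\<i> *s x))"
    by (simp cong: continuous_on_cong)
  show ?thesis
    unfolding rate_def[abs_def] conn_form_def
    by (intro continuous_on_divide herm_continuous_on continuous_on_subset[OF c K_subset_Omega]
        continuous_on_subset[OF Ck_on_continuous[OF C] K_subset_Omega])
      (use V_nonzero[OF j] in \<open>auto simp: herm_self\<close>)
qed

lemma continuous_on_cis_smult: "continuous_on S (\<lambda>p. cis (g p) *s w p)"
  if "continuous_on S g" "continuous_on S w" for w :: "_ \<Rightarrow> complex^('n option)"
  by (intro bounded_bilinear.continuous_on[OF bounded_bilinear_vector_smult] continuous_intros that)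

lemma continuous_on_rate_circle: "a \<in> K \<Longrightarrow> continuous_on S (\<lambda>\<theta>. rate N (cis \<theta> *s a))"
  by (rule continuous_on_compose2[OF continuous_on_rate[OF order_refl]])
    (auto intro!: continuous_on_cis_smult continuous_intros cis_K)

lemma V_N_fixed: "map_mat f x *v V N x = V N x"
proof -
  have "geod (real N * h) x = x" unfolding h(2) by (simp add: geod_def)
  then show ?thesis using Y_start[of N x] unfolding Y_def by simp
qed

lemma V_N_lift: "x \<in> K \<Longrightarrow> to_cproj (V N x) = f (to_cproj x)"
  using V_N_fixed[of x] to_cproj_map_mat[of f x "V N x"] V_nonzero[of N x] by simp

text \<open>All points of a Hopf circle represent the same point of \<open>CP^n\<close>, so the
  values of the lift on it lie in one complex line.\<close>

lemma V_N_line: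
  assumes a: "a \<in> K"
  shows "V N (cis \<theta> *s a) = (herm (V N (cis \<theta> *s a)) (V N a) / (norm (V N a))\<^sup>2) *s V N a"
proof -
  have a0: "a \<noteq> 0" using a by (auto simp: K_def)
  have "map_mat f (cis \<theta> *s a) = map_mat f a" by (rule map_mat_scale) (simp_all add: a0)
  also have "\<dots> = proj_mat (V N a)"
    by (rule map_mat_eq[where f=f, OF V_nonzero[OF order_refl a] V_N_lift[OF a]])
  finally show ?thesis using V_N_fixed[of "cis \<theta> *s a"] by (simp add: proj_mat_mult)
qed

text \<open>The lift moves inside a fixed complex line along the circle, so its derivative is a
  multiple of the lift itself, and pairing with the lift identifies the multiple as the
  rate.\<close>

lemma V_N_theta_deriv:
  assumes a: "a \<in> K"
  shows "((\<lambda>\<theta>. V N (cis \<theta> *s a)) has_vector_derivative rate N (cis \<theta> *s a) *s V N (cis \<theta> *s a)) (at \<theta>)"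
proof -
  let ?x = "cis \<theta> *s a" and ?n = "complex_of_real ((norm (V N a))\<^sup>2)"
  let ?D = "frechet_derivative (V N) (at ?x) (\<i> *s ?x)"
  have d: "((\<lambda>\<theta>. V N (cis \<theta> *s a)) has_vector_derivative ?D) (at \<theta>)" by (rule V_theta_deriv[OF a])
  have bl: "bounded_linear (\<lambda>v. (herm v (V N a) / ?n) *s V N a)"
    by (intro bounded_linear_compose[OF bounded_bilinear.bounded_linear_left[OF bounded_bilinear_vector_smult]]
        bounded_linear_compose[OF bounded_linear_divide] bounded_bilinear.bounded_linear_left[OF bounded_bilinear_herm])
  from bounded_linear.has_vector_derivative[OF this d]
  have "((\<lambda>\<theta>. V N (cis \<theta> *s a)) has_vector_derivative (herm ?D (V N a) / ?n) *s V N a) (at \<theta>)"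
    unfolding V_N_line[OF a, symmetric] .
  with d have D: "?D = (herm ?D (V N a) / ?n) *s V N a" by (rule vector_derivative_unique_at)
  define u u' where "u = herm (V N ?x) (V N a) / ?n" and "u' = herm ?D (V N a) / ?n"
  have V: "V N ?x = u *s V N a" "?D = u' *s V N a" using V_N_line[OF a, of \<theta>] D by (simp_all add: u_def u'_def)
  have "u \<noteq> 0" using V(1) V_nonzero[OF order_refl cis_K[OF a, of \<theta>]] by auto
  moreover have "herm (V N a) (V N a) \<noteq> 0" using V_nonzero[OF order_refl a] by (simp add: herm_self)
  ultimately have "rate N ?x = u' / u"
    unfolding rate_def conn_form_def V by (simp add: herm_simps)
  then have "rate N ?x *s V N ?x = ?D" unfolding V using \<open>u \<noteq> 0\<close> by (simp add: vector_smult_assoc)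
  then show ?thesis using d by simp
qed

text \<open>An integrating factor. It is applied to the plain integral of the rate to prove
  integrality, and to \<open>phase\<close> to make the lift constant on Hopf circles.\<close>

lemma exp_primitive_constant:
  assumes a: "a \<in> K" and P: "\<And>\<theta>. \<theta> \<in> {0..2*pi} \<Longrightarrow> (P has_vector_derivative - rate N (cis \<theta> *s a)) (at \<theta> within {0..2*pi})"
    and \<theta>: "\<theta> \<in> {0..2*pi}"
  shows "exp (P \<theta>) *s V N (cis \<theta> *s a) = exp (P 0) *s V N a"
proof -
  let ?G = "\<lambda>\<theta>. exp (P \<theta>) *s V N (cis \<theta> *s a)"
  have "(?G has_derivative (\<lambda>h. 0)) (at \<theta> within {0..2*pi})" if t: "\<theta> \<in> {0..2*pi}" for \<theta>
  proof -
    have "((\<lambda>\<theta>. exp (P \<theta>)) has_vector_derivative - rate N (cis \<theta> *s a) * exp (P \<theta>)) (at \<theta> within {0..2*pi})"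
      using field_vector_diff_chain_within[OF P[OF t] DERIV_subset[OF DERIV_exp subset_UNIV]]
      by (simp add: o_def)
    from bounded_bilinear.has_vector_derivative[OF bounded_bilinear_vector_smult this
        has_vector_derivative_at_within[OF V_N_theta_deriv[OF a]]]
    have "(?G has_vector_derivative 0) (at \<theta> within {0..2*pi})"
      by (simp add: vector_smult_assoc mult.commute flip: vector_sadd_rdistrib)
    then show ?thesis by (simp add: has_vector_derivative_def)
  qed
  then have "?G \<theta> = ?G 0"
    by (rule has_derivative_zero_unique[OF convex_real_interval(5)]) (use \<theta> in auto)
  then show ?thesis by simp
qed

text \<open>The circle closes up, so the lift has the same nonzero value at both ends, and the
  integrating factor must return to 1.\<close>

lemma conn_integral:
  assumes a: "a \<in> K" shows "exp (conn N a) = 1"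
proof -
  let ?P = "\<lambda>\<theta>. - integral {0..\<theta>} (\<lambda>\<theta>. rate N (cis \<theta> *s a))"
  have "exp (?P (2*pi)) *s V N (cis (2*pi) *s a) = exp (?P 0) *s V N a"
    by (rule exp_primitive_constant[OF a])
      (auto intro!: has_vector_derivative_minus integral_has_vector_derivative continuous_on_rate_circle a)
  then have "(exp (- conn N a) - 1) *s V N a = 0" by (simp add: conn_def vector_ssub_ldistrib vector_sub_rdistrib)
  then have "exp (- conn N a) = 1" using V_nonzero[OF order_refl a] vector_smult_eq_0_iff by (metis eq_iff_diff_eq_0)
  then show ?thesis by (simp add: exp_minus)
qed

lemma conn_eq_0:
  assumes a: "a \<in> K" and "norm (conn N a) < 2 * pi" shows "conn N a = 0"
proof -
  obtain n :: int where n: "Re (conn N a) = 0" "Im (conn N a) = of_int (2 * n) * pi"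
    using conn_integral[OF a] unfolding exp_eq_1 by auto
  have "\<bar>Im (conn N a)\<bar> < 2 * pi" using assms(2) abs_Im_le_cmod[of "conn N a"] by linarith
  then have "2 * pi * \<bar>real_of_int n\<bar> < 2 * pi * 1" using n(2) by (simp add: abs_mult)
  then have "\<bar>real_of_int n\<bar> < 1" by simp
  then have "n = 0" by linarith
  then show ?thesis using n by (simp add: complex_eq_iff)
qed

end

section \<open>Descending the lift when the degree vanishes\<close>

lemma path_component_image:
  fixes g :: "real \<Rightarrow> 'a::topological_space"
  assumes "continuous_on {0..1} g" "g ` {0..1} \<subseteq> S"
  shows "path_component S (g 0) (g 1)"
  unfolding path_component_def using assms
  by (intro exI[of _ g]) (auto simp: path_def path_image_def pathstart_def pathfinish_def)

text \<open>A continuous map from a compact set into a metric space is closed, hence a quotient map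
  onto its image. It is used to descend from polar coordinates to \<open>CP^n\<close>.\<close>

lemma continuous_on_factor:
  fixes q :: "'a::metric_space \<Rightarrow> 'b::metric_space" and w :: "'a \<Rightarrow> 'c::metric_space"
  assumes D: "compact D" and q: "continuous_on D q" and w: "continuous_on D w"
    and fib: "\<And>x y. x \<in> D \<Longrightarrow> y \<in> D \<Longrightarrow> q x = q y \<Longrightarrow> w x = w y"
  obtains g where "continuous_on (q ` D) g" "\<And>x. x \<in> D \<Longrightarrow> g (q x) = w x"
proof -
  define g where "g = (\<lambda>c. w (SOME x. x \<in> D \<and> q x = c))"
  have g: "g (q x) = w x" if "x \<in> D" for x
    unfolding g_def using someI[of "\<lambda>y. y \<in> D \<and> q y = q x" x] that fib by blast
  have "closed (g -` B \<inter> q ` D)" if "closed B" for B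
  proof -
    have "g -` B \<inter> q ` D = q ` (D \<inter> w -` B)" using g by auto
    moreover have "closed (D \<inter> w -` B)"
      by (rule continuous_closed_preimage[OF w compact_imp_closed[OF D] that])
    then have "compact (D \<inter> w -` B)" using compact_Int_closed[OF D, of "D \<inter> w -` B"] by (simp add: Int_absorb1)
    then have "compact (q ` (D \<inter> w -` B))"
      by (intro compact_continuous_image continuous_on_subset[OF q]) auto
    ultimately show ?thesis by (simp add: compact_imp_closed)
  qed
  then have "continuous_on (q ` D) g"
    by (subst continuous_on_closed_vimage[OF compact_imp_closed[OF compact_continuous_image[OF q D]]]) blast
  then show ?thesis using g that by blast
qed

section \<open>Polar coordinates on \<open>CP^n\<close>\<close>

context radial
begin

lemma K_not_collinear:
  assumes "a \<in> K" "b \<in> K" "0 \<le> t" "t \<le> 1" "herm a b = of_real s" "s \<ge> 0"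
  shows "(1 - t) *\<^sub>R a + t *\<^sub>R b \<noteq> 0"
proof
  assume 0: "(1 - t) *\<^sub>R a + t *\<^sub>R b = 0"
  then have "herm ((1 - t) *\<^sub>R a + t *\<^sub>R b) b = 0" by simp
  then have "complex_of_real ((1 - t) * s + t) = 0"
    using herm_K(1)[OF assms(2)] assms(5) by (simp add: herm_simps herm_scaleR_left)
  then have "(1 - t) * s + t = 0" by (simp only: of_real_eq_0_iff)
  moreover have "(1 - t) * s \<ge> 0" using assms by simp
  ultimately have "t = 0" using assms(3) by linarith
  then show False using 0 assms(1) by (auto simp: K_def)
qed

text \<open>A phase rotation, itself a path in \<open>K\<close>, makes the Hermitian product with
  \<open>b\<close> real and nonnegative; after that the segment to \<open>b\<close> misses 0 and can
  be normalised.\<close>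

lemma connected_K: "connected K"
proof -
  have "path_component K a b" if ab: "a \<in> K" "b \<in> K" for a b
  proof -
    define \<theta> where "\<theta> = - Arg (herm a b)"
    define c where "c = cis \<theta> *s a"
    have c: "c \<in> K" unfolding c_def by (rule cis_K[OF ab(1)])
    have "herm c b = cis \<theta> * rcis (norm (herm a b)) (Arg (herm a b))"
      unfolding rcis_cmod_Arg by (simp add: c_def herm_simps)
    also have "\<dots> = of_real (norm (herm a b))"
      by (simp add: rcis_def \<theta>_def cis_mult mult.left_commute)
    finally have hc: "herm c b = of_real (norm (herm a b))" .
    have "path_component K (cis (0 * \<theta>) *s a) (cis (1 * \<theta>) *s a)"
      by (rule path_component_image)
        (auto intro!: cis_K ab bounded_bilinear.continuous_on[OF bounded_bilinear_vector_smult] continuous_intros)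
    then have 1: "path_component K a c" by (simp add: c_def)
    let ?l = "\<lambda>t. (1 - t) *\<^sub>R c + t *\<^sub>R b"
    have nz: "?l t \<noteq> 0" if "t \<in> {0..1}" for t
      using K_not_collinear[OF c ab(2) _ _ hc, of t] that by simp
    have "?l t /\<^sub>R norm (?l t) \<in> K" if "t \<in> {0..1}" for t
    proof -
      have "herm (?l t) z0 = 0" using herm_K[OF c] herm_K[OF ab(2)] by (simp add: herm_simps herm_scaleR_left)
      then show ?thesis using nz[OF that] by (simp add: K_def herm_scaleR_left)
    qed
    moreover have "continuous_on {0..1} (\<lambda>t. ?l t /\<^sub>R norm (?l t))"
      using nz by (intro continuous_intros) auto
    ultimately have "path_component K (?l 0 /\<^sub>R norm (?l 0)) (?l 1 /\<^sub>R norm (?l 1))"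
      by (intro path_component_image) auto
    then have "path_component K c b" using c ab by (simp add: K_def)
    with 1 show ?thesis by (rule path_component_trans)
  qed
  then have "path_connected K" by (simp add: path_connected_component)
  then show ?thesis by (rule path_connected_imp_connected)
qed

text \<open>The line is represented by a unit vector whose product with \<open>z0\<close> is real
  and nonnegative. This product is the cosine of the radius, and the part orthogonal to
  \<open>z0\<close> gives the direction.\<close>

lemma geod_surj:
  assumes z: "z \<noteq> 0" and K: "K \<noteq> {}"
  shows "\<exists>r\<in>{0..pi/2}. \<exists>a\<in>K. proj_mat (geod r a) = proj_mat z"
proof -
  define \<alpha> where "\<alpha> = herm z z0"
  define k where "k = cis (- Arg \<alpha>) * of_real (1 / norm z)"
  have k: "k \<noteq> 0" using z by (simp add: k_def)
  define y where "y = k *s z"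
  have ny: "norm y = 1" using z by (simp add: y_def k_def norm_vector_smult norm_mult norm_divide)
  define s where "s = norm \<alpha> / norm z"
  have "herm y z0 = cis (- Arg \<alpha>) * rcis (norm \<alpha>) (Arg \<alpha>) * of_real (1 / norm z)"
    unfolding rcis_cmod_Arg by (simp add: y_def k_def herm_simps \<alpha>_def)
  also have "cis (- Arg \<alpha>) * rcis (norm \<alpha>) (Arg \<alpha>) = of_real (norm \<alpha>)"
    by (simp add: rcis_def cis_mult mult.left_commute)
  finally have hy: "herm y z0 = of_real s" by (simp add: s_def)
  define b where "b = y - s *\<^sub>R z0"
  have bz: "herm b z0 = 0" using hy z0 by (simp add: b_def herm_simps herm_scaleR_left herm_self)
  then have zb: "herm z0 b = 0" using cnj_herm[of b z0] by simp
  have y: "y = s *\<^sub>R z0 + b" by (simp add: b_def)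
  have "complex_of_real ((norm y)\<^sup>2) = of_real (s\<^sup>2 + (norm b)\<^sup>2)"
    unfolding herm_self[of y, symmetric] unfolding y
    using bz zb herm_self[of b] herm_self[of z0] z0
    by (simp add: herm_simps herm_scaleR_left herm_scaleR_right power2_eq_square)
  then have nb: "s\<^sup>2 + (norm b)\<^sup>2 = 1" using ny by (simp only: of_real_eq_iff) simp
  have "s\<^sup>2 \<le> 1" using nb zero_le_power2[of "norm b"] by linarith
  then have "\<bar>s\<bar> \<le> 1" by (simp only: abs_square_le_1)
  then have s: "0 \<le> s" "s \<le> 1" by (auto simp: s_def)
  define r where "r = arccos s"
  have r: "r \<in> {0..pi/2}" "cos r = s"
    using s arccos_le_pi2[OF s] arccos_lbound[of s] by (simp_all add: r_def)
  have "(sin r)\<^sup>2 = (norm b)\<^sup>2" using nb r(2) sin_squared_eq[of r] by simp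
  then have sr: "sin r = norm b" using r(1) by (simp add: power2_eq_iff_nonneg sin_ge_zero)
  obtain a where a: "a \<in> K" "norm b *\<^sub>R a = b"
  proof (cases "b = 0")
    case True
    then show ?thesis using K that by auto
  next
    case False
    then have "b /\<^sub>R norm b \<in> K" using bz by (simp add: K_def herm_scaleR_left)
    then show ?thesis using that[of "b /\<^sub>R norm b"] False by simp
  qed
  have "geod r a = y" unfolding geod_def r(2) sr a(2) y ..
  then have "proj_mat (geod r a) = proj_mat z" using proj_mat_scale[OF k] by (simp add: y_def)
  then show ?thesis using r a by blast
qed

text \<open>The product with \<open>z0\<close> recovers cos r and, unless it vanishes, forces the
  scalar between the representatives to be 1. Only the centre, where all directions meet, and the
  circles at radius pi/2 are collapsed.\<close>

lemma geod_fibre: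
  assumes r: "r \<in> {0..pi/2}" "r' \<in> {0..pi/2}" and a: "a \<in> K" "a' \<in> K"
    and eq: "proj_mat (geod r a) = proj_mat (geod r' a')"
  shows "r = r'" "0 < r \<Longrightarrow> r < pi/2 \<Longrightarrow> a = a'" "r = pi/2 \<Longrightarrow> \<exists>\<theta>\<in>{0..2*pi}. a' = cis \<theta> *s a"
proof -
  have nz: "geod r a \<noteq> 0" "geod r' a' \<noteq> 0" using norm_geod[OF a(1), of r] norm_geod[OF a(2), of r'] by auto
  have "cproj_mat (to_cproj (geod r a)) = cproj_mat (to_cproj (geod r' a'))"
    using eq nz by (simp add: cproj_mat_to_cproj)
  then have "to_cproj (geod r a) = to_cproj (geod r' a')" by (rule injD[OF inj_cproj_mat])
  then obtain c where c: "geod r' a' = c *s geod r a" using to_cproj_eq_iff[OF nz] by blast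
  have "norm c = 1" using norm_geod[OF a(1), of r] norm_geod[OF a(2), of r'] by (simp add: c norm_vector_smult)
  have hz: "herm (geod r a) z0 = of_real (cos r)" if "a \<in> K" for r a
    using herm_K[OF that] by (simp add: geod_def herm_simps herm_scaleR_left)
  have cc: "complex_of_real (cos r') = c * of_real (cos r)"
    using hz[OF a(2), of r'] hz[OF a(1), of r] by (simp add: c herm_simps)
  have pos: "cos r \<ge> 0" "cos r' \<ge> 0" using r by (auto intro: cos_ge_zero)
  have "\<bar>cos r'\<bar> = norm (c * complex_of_real (cos r))" by (metis cc norm_of_real)
  then have "cos r' = cos r" using pos \<open>norm c = 1\<close> by (simp add: norm_mult)
  then show rr: "r = r'" using r by (intro cos_inj_pi[of r r']) auto
  have sc: "sin r *\<^sub>R a' = c *s (sin r *\<^sub>R a)" if "c = 1 \<or> cos r = 0"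
    using c that unfolding geod_def rr[symmetric] by (auto simp: vector_add_ldistrib)
  show "a = a'" if "0 < r" "r < pi/2"
  proof -
    have "cos r > 0" using that r by (intro cos_gt_zero_pi) auto
    then have "c = 1" using cc unfolding rr[symmetric] by simp
    moreover have "sin r > 0" using that r by (intro sin_gt_zero) auto
    ultimately show ?thesis using sc by simp
  qed
  show "\<exists>\<theta>\<in>{0..2*pi}. a' = cis \<theta> *s a" if "r = pi/2"
  proof -
    have "a' = c *s a" using sc that by simp
    moreover have "c = cis (Arg2pi c)"
      using Arg2pi_eq[of c] \<open>norm c = 1\<close> by (simp add: cis_conv_exp)
    moreover have "Arg2pi c \<in> {0..2*pi}" using Arg2pi[of c] by auto
    ultimately show ?thesis by metis
  qed
qed

end

section \<open>Phase correction of the lift along Hopf circles\<close>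

text \<open>The bounds -1 and 20 leave [0, 4 pi] in the interior, as pi < 4; the derivatives there
  are two-sided.\<close>

lemma antiderivative_vector:
  fixes b :: "real \<Rightarrow> complex"
  assumes "continuous_on UNIV b" "u \<in> {-1<..<20}"
  shows "((\<lambda>u. integral {-1..u} b) has_vector_derivative b u) (at u)"
proof -
  have "((\<lambda>u. integral {-1..u} b) has_vector_derivative b u) (at u within {-1..20})"
    using assms by (intro integral_has_vector_derivative continuous_on_subset[OF assms(1)]) auto
  moreover have "u \<in> interior {-1..20}" using assms(2) by simp
  ultimately show ?thesis by (simp only: at_within_interior)
qed

context mesh
begin

lemma continuous_on_circle_integral:
  assumes "continuous_on UNIV g"
  shows "continuous_on K (\<lambda>a. integral {0..2*pi} (\<lambda>t. g t * rate N (cis t *s a)))"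
proof -
  have "continuous_on (K \<times> cbox 0 (2*pi)) (\<lambda>p. rate N (cis (snd p) *s fst p))"
    by (rule continuous_on_compose2[OF continuous_on_rate[OF order_refl]])
      (auto intro!: continuous_on_cis_smult continuous_intros cis_K)
  moreover have "continuous_on (K \<times> cbox 0 (2*pi)) (\<lambda>p. g (snd p))"
    by (rule continuous_on_compose2[OF assms]) (auto intro!: continuous_intros)
  ultimately have "continuous_on (K \<times> cbox 0 (2*pi)) (\<lambda>(a, t). g t * rate N (cis t *s a))"
    unfolding split_beta by (intro continuous_on_mult)
  then have "continuous_on K (\<lambda>a. integral (cbox 0 (2*pi)) (\<lambda>t. g t * rate N (cis t *s a)))"
    by (rule integral_continuous_on_param)
  then show ?thesis by simp
qed

text \<open>The norm of \<open>conn N\<close> is continuous on the connected set \<open>K\<close>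
  and jumps from 0 to at least 2 pi; a nonzero value somewhere would force the value pi.\<close>

lemma conn_zero_all:
  assumes "a0 \<in> K" "conn N a0 = 0" "a \<in> K"
  shows "conn N a = 0"
proof (rule ccontr)
  assume ne: "conn N a \<noteq> 0"
  have c: "continuous_on K (conn N)"
    using continuous_on_circle_integral[of "\<lambda>_. 1"] by (simp add: conn_def[abs_def])
  have "connected ((\<lambda>a. norm (conn N a)) ` K)"
    by (intro connected_continuous_image connected_K continuous_on_norm c)
  moreover have "0 \<in> (\<lambda>a. norm (conn N a)) ` K" using assms by force
  moreover have "norm (conn N a) \<in> (\<lambda>a. norm (conn N a)) ` K" using assms by blast
  moreover have "\<not> norm (conn N a) < 2 * pi" using conn_eq_0[OF assms(3)] ne by blast
  then have "pi \<le> norm (conn N a)" using pi_ge_zero by linarith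
  ultimately have "pi \<in> (\<lambda>a. norm (conn N a)) ` K" 
    by (rule connectedD_interval[OF _ _ _ pi_ge_zero])
  then obtain b where "b \<in> K" "norm (conn N b) = pi" by auto
  then show False using conn_eq_0[of b] pi_gt_zero by auto
qed

text \<open>A logarithm of the correcting factor for \<open>V N\<close> that needs no choice of a
  starting point on each Hopf circle, which is what makes it continuous on all of
  \<open>K\<close>.\<close>

definition phase :: "complex^('n option) \<Rightarrow> complex" where
  "phase a = - (1 / (2 * pi)) * integral {0..2*pi} (\<lambda>t. of_real t * rate N (cis t *s a))"

lemma continuous_on_phase: "continuous_on K phase"
  unfolding phase_def[abs_def]
  by (intro continuous_on_mult continuous_on_const continuous_on_circle_integral continuous_intros)

text \<open>
  Integration by parts: as the mean of the rate vanishes, \<^term>\<open>phase\<close> is a primitive of minus the rate along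
  every Hopf circle.
\<close>

lemma phase_deriv:
  assumes a: "a \<in> K" and 0: "\<And>a. a \<in> K \<Longrightarrow> conn N a = 0" and \<theta>: "\<theta> \<in> {0..2*pi}"
  shows "((\<lambda>\<theta>. phase (cis \<theta> *s a)) has_vector_derivative - rate N (cis \<theta> *s a)) (at \<theta> within {0..2*pi})"
proof -
  define b where "b t = rate N (cis t *s a)" for t
  have b: "continuous_on UNIV b" unfolding b_def by (rule continuous_on_rate_circle[OF a])
  have tb: "continuous_on UNIV (\<lambda>t. of_real t * b t)" by (intro continuous_intros b)
  define P where "P u = integral {-1..u} (\<lambda>t. of_real t * b t)" for u
  have P: "(P has_vector_derivative of_real u * b u) (at u)" if "u \<in> {-1<..<20}" for u
    unfolding P_def[abs_def] by (rule antiderivative_vector[OF tb that])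
  have shift: "rate N (cis t *s (cis \<theta> *s a)) = b (t + \<theta>)" for t \<theta>
    by (simp add: b_def vector_smult_assoc cis_mult)
  have small: "u \<in> {-1<..<20}" if "0 \<le> u" "u \<le> 4 * pi" for u
    using that pi_less_4 by auto
  have bs: "continuous_on S (\<lambda>t. b (t + \<theta>))" for S \<theta>
    by (rule continuous_on_compose2[OF b]) (auto intro!: continuous_intros)
  \<comment> \<open>After shifting the circle by \<theta>, the weight t may be replaced by t +
    \<theta>, because the rate has mean zero; the phase then becomes a difference of values of
    \<open>P\<close> one period apart.\<close>
  have eq: "phase (cis \<theta> *s a) = - (1 / (2 * pi)) * (P (\<theta> + 2 * pi) - P \<theta>)" if t: "\<theta> \<in> {0..2*pi}" for \<theta>
  proof -
    have "((\<lambda>t. P (t + \<theta>)) has_vector_derivative of_real (t + \<theta>) * b (t + \<theta>)) (at t within {0..2*pi})"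
      if "t \<in> {0..2*pi}" for t
    proof -
      have "((\<lambda>t. t + \<theta>) has_vector_derivative 1) (at t)" by (auto intro!: derivative_eq_intros)
      from vector_diff_chain_at[OF this P[OF small]] that t
      have "((\<lambda>t. P (t + \<theta>)) has_vector_derivative of_real (t + \<theta>) * b (t + \<theta>)) (at t)" by (simp add: o_def)
      then show ?thesis by (rule has_vector_derivative_at_within)
    qed
    then have I1: "((\<lambda>t. of_real (t + \<theta>) * b (t + \<theta>)) has_integral P (2*pi + \<theta>) - P (0 + \<theta>)) {0..2*pi}"
      by (intro fundamental_theorem_of_calculus) auto
    have "integral {0..2*pi} (\<lambda>t. b (t + \<theta>)) = conn N (cis \<theta> *s a)"
      unfolding conn_def shift ..
    then have "integral {0..2*pi} (\<lambda>t. b (t + \<theta>)) = 0" using 0[OF cis_K[OF a]] by simp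
    then have I2: "((\<lambda>t. b (t + \<theta>)) has_integral 0) {0..2*pi}"
      using integrable_integral[OF integrable_continuous_real[OF bs]] by metis
    have "((\<lambda>t. of_real (t + \<theta>) * b (t + \<theta>) - of_real \<theta> * b (t + \<theta>)) has_integral
        (P (2*pi + \<theta>) - P (0 + \<theta>)) - of_real \<theta> * 0) {0..2*pi}"
      by (intro has_integral_diff I1 has_integral_mult_right I2)
    then have "integral {0..2*pi} (\<lambda>t. of_real t * b (t + \<theta>)) = P (\<theta> + 2*pi) - P \<theta>"
      by (intro integral_unique) (simp add: algebra_simps)
    then show ?thesis unfolding phase_def shift by simp
  qed
  have "cis (\<theta> + 2 * pi) = cis \<theta>" by (simp flip: cis_mult)
  then have per: "b (\<theta> + 2 * pi) = b \<theta>" by (simp add: b_def)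
  have "((\<lambda>\<theta>. \<theta> + 2 * pi) has_vector_derivative 1) (at \<theta>)" by (auto intro!: derivative_eq_intros)
  from vector_diff_chain_at[OF this P[OF small]] \<theta>
  have "((\<lambda>\<theta>. P (\<theta> + 2 * pi)) has_vector_derivative of_real (\<theta> + 2 * pi) * b (\<theta> + 2 * pi)) (at \<theta>)"
    by (simp add: o_def)
  moreover have "(P has_vector_derivative of_real \<theta> * b \<theta>) (at \<theta>)" using \<theta> by (intro P small) auto
  ultimately have "((\<lambda>\<theta>. P (\<theta> + 2 * pi) - P \<theta>) has_vector_derivative
      of_real (\<theta> + 2 * pi) * b (\<theta> + 2 * pi) - of_real \<theta> * b \<theta>) (at \<theta>)"
    by (rule has_vector_derivative_diff)
  from has_vector_derivative_mult_right[OF this, of "- (1 / (2 * pi))"]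
  have "((\<lambda>\<theta>. - (1 / (2 * pi)) * (P (\<theta> + 2 * pi) - P \<theta>)) has_vector_derivative - b \<theta>) (at \<theta>)"
    unfolding per by (simp add: field_simps)
  then have X: "((\<lambda>\<theta>. - (1 / (2 * pi)) * (P (\<theta> + 2 * pi) - P \<theta>)) has_vector_derivative - b \<theta>) (at \<theta> within {0..2*pi})"
    by (rule has_vector_derivative_at_within)
  show ?thesis
    unfolding b_def[symmetric] by (rule has_vector_derivative_transform[OF \<theta> eq X])
qed

lemma rotation_invariant:
  assumes a: "a \<in> K" and 0: "\<And>a. a \<in> K \<Longrightarrow> conn N a = 0" and \<theta>: "\<theta> \<in> {0..2*pi}"
  shows "exp (phase (cis \<theta> *s a)) *s V N (cis \<theta> *s a) = exp (phase a) *s V N a"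
  using exp_primitive_constant[OF a phase_deriv[OF a 0] \<theta>] by simp

section \<open>Assembling the global lift\<close>

text \<open>The pieces \<open>Y n\<close> agree at the common radii by \<open>Y_start\<close>, so
  they glue to one continuous lift in polar coordinates.\<close>

lemma radial_lift:
  assumes "n \<le> N"
  shows "\<exists>v. continuous_on ({0..real n * h} \<times> K) v \<and> (\<forall>r\<in>{0..real n * h}. \<forall>a\<in>K. v (r, a) \<noteq> 0 \<and>
    to_cproj (v (r, a)) = f (to_cproj (geod r a))) \<and> (\<forall>a\<in>K. v (0, a) = v0 \<and> v (real n * h, a) = V n a)"
  using assms
proof (induction n)
  case 0
  show ?case by (rule exI[of _ "\<lambda>_. v0"]) (auto simp: v0)
next
  case (Suc n)
  then obtain v where v: "continuous_on ({0..real n * h} \<times> K) v"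
    "\<And>r a. r \<in> {0..real n * h} \<Longrightarrow> a \<in> K \<Longrightarrow> v (r, a) \<noteq> 0 \<and> to_cproj (v (r, a)) = f (to_cproj (geod r a))"
    "\<And>a. a \<in> K \<Longrightarrow> v (0, a) = v0 \<and> v (real n * h, a) = V n a"
    by (metis Suc_leD)
  define w where "w p = (if fst p \<le> real n * h then v p else Y n (fst p) (snd p))" for p
  have le: "0 \<le> real n * h" "real n * h \<le> real (Suc n) * h" using h by (auto simp: mult_right_mono)
  have S: "{0..real (Suc n) * h} \<times> K = ({0..real n * h} \<times> K) \<union> ({real n * h..real (Suc n) * h} \<times> K)"
    using le by auto
  have "continuous_on cyl (\<lambda>p. Y n (fst p) (snd p))" by (rule Ck_on_continuous[OF Ck_on_Y_gen[OF Ck_on_V]])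
  then have "continuous_on ({real n * h..real (Suc n) * h} \<times> K) (\<lambda>p. Y n (fst p) (snd p))"
    by (rule continuous_on_subset) (use K_subset_Omega in auto)
  then have "continuous_on ({0..real (Suc n) * h} \<times> K) w"
    unfolding S w_def
    by (intro continuous_on_cases closed_Times compact_imp_closed[OF compact_K] closed_atLeastAtMost v(1))
      (use v(3) Y_start in \<open>auto simp: le\<close>)
  moreover have "w (r, a) \<noteq> 0 \<and> to_cproj (w (r, a)) = f (to_cproj (geod r a))"
    if "r \<in> {0..real (Suc n) * h}" "a \<in> K" for r a
  proof (cases "r \<le> real n * h")
    case True
    then show ?thesis using v(2)[of r a] that by (simp add: w_def)
  next
    case False
    then have "Y n r a \<noteq> 0" using that Suc by (intro Y_nonzero) auto
    then show ?thesis using False to_cproj_Y by (simp add: w_def)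
  qed
  moreover have "w (0, a) = v0 \<and> w (real (Suc n) * h, a) = V (Suc n) a" if "a \<in> K" for a
    using v(3)[OF that] le h Y_end[of n a] by (auto simp: w_def)
  ultimately show ?case by blast
qed

lemma global_lift:
  assumes 0: "\<And>a. a \<in> K \<Longrightarrow> conn N a = 0" and ne: "K \<noteq> {}"
  shows "compact (proj_mat ` (- {0 :: complex^('n option)}))"
    and "\<exists>g. continuous_on (proj_mat ` (- {0 :: complex^('n option)})) g \<and>
      (\<forall>z. z \<noteq> 0 \<longrightarrow> g (proj_mat z) \<noteq> 0 \<and> to_cproj (g (proj_mat z)) = f (to_cproj z))"
proof -
  obtain v where v: "continuous_on ({0..pi/2} \<times> K) v"
    "\<And>r a. r \<in> {0..pi/2} \<Longrightarrow> a \<in> K \<Longrightarrow> v (r, a) \<noteq> 0 \<and> to_cproj (v (r, a)) = f (to_cproj (geod r a))"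
    "\<And>a. a \<in> K \<Longrightarrow> v (0, a) = v0 \<and> v (pi/2, a) = V N a"
    using radial_lift[OF order_refl] unfolding h(2) by blast
  let ?D = "{0..pi/2} \<times> K"
  define q where "q p = proj_mat (geod (fst p) (snd p))" for p
  \<comment> \<open>The correction is switched on linearly in the radius: absent at the centre,
    where \<open>v\<close> has the single value \<open>v0\<close>, and complete at pi/2, where it
    makes the value constant on each Hopf circle. So \<open>w\<close> is compatible with both
    collapsed sets.\<close>
  define w where "w p = exp (of_real (2 / pi * fst p) * phase (snd p)) *s v p" for p
  have D: "compact ?D" by (intro compact_Times compact_Icc compact_K)
  have q: "continuous_on ?D q"
    unfolding q_def
    by (rule continuous_on_compose2[OF Ck_on_continuous[OF Ck_on_proj_mat[of 0]]])
      (use K_subset_Omega geod_nonzero in \<open>auto intro!: continuous_intros simp: geod_def\<close>)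
  have "continuous_on ?D (\<lambda>p. phase (snd p))"
    by (rule continuous_on_compose2[OF continuous_on_phase]) (auto intro!: continuous_intros)
  then have w: "continuous_on ?D w"
    unfolding w_def
    by (intro bounded_bilinear.continuous_on[OF bounded_bilinear_vector_smult] continuous_intros v(1))
  have fib: "w x = w y" if xy: "x \<in> ?D" "y \<in> ?D" "q x = q y" for x y
  proof -
    obtain r a r' a' where x: "x = (r, a)" and y: "y = (r', a')" by (cases x, cases y)
    have ra: "r \<in> {0..pi/2}" "r' \<in> {0..pi/2}" "a \<in> K" "a' \<in> K" "proj_mat (geod r a) = proj_mat (geod r' a')"
      using xy by (auto simp: x y q_def)
    note fibre = geod_fibre[OF ra]
    consider "r = 0" | "0 < r" "r < pi/2" | "r = pi/2" using ra(1) by fastforce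
    then show ?thesis
    proof cases
      case 1
      then show ?thesis using fibre(1) v(3) ra by (simp add: x y w_def)
    next
      case 2
      then show ?thesis using fibre by (simp add: x y)
    next
      case 3
      then obtain \<theta> where \<theta>: "\<theta> \<in> {0..2*pi}" "a' = cis \<theta> *s a" using fibre(3) by blast
      have "w (pi/2, b) = exp (phase b) *s V N b" if "b \<in> K" for b
        using v(3)[OF that] by (simp add: w_def)
      then show ?thesis
        using rotation_invariant[OF ra(3) 0 \<theta>(1)] ra(3,4) unfolding x y fibre(1)[symmetric] 3 \<theta>(2) by simp
    qed
  qed
  have img: "q ` ?D = proj_mat ` (- {0})"
  proof
    show "q ` ?D \<subseteq> proj_mat ` (- {0})" using K_subset_Omega geod_nonzero by (auto simp: q_def)
    show "proj_mat ` (- {0}) \<subseteq> q ` ?D"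
    proof
      fix A assume "A \<in> proj_mat ` (- {0 :: complex^('n option)})"
      then obtain z where "z \<noteq> 0" "A = proj_mat z" by auto
      then obtain r a where "r \<in> {0..pi/2}" "a \<in> K" "A = q (r, a)"
        using geod_surj[OF _ ne] by (metis q_def fst_conv snd_conv)
      then show "A \<in> q ` ?D" by blast
    qed
  qed
  show "compact (proj_mat ` (- {0 :: complex^('n option)}))"
    unfolding img[symmetric] by (rule compact_continuous_image[OF q D])
  obtain g where g: "continuous_on (q ` ?D) g" "\<And>x. x \<in> ?D \<Longrightarrow> g (q x) = w x"
    using continuous_on_factor[OF D q w fib] by blast
  have "g (proj_mat z) \<noteq> 0 \<and> to_cproj (g (proj_mat z)) = f (to_cproj z)" if z: "z \<noteq> 0" for z
  proof -
    obtain r a where ra: "r \<in> {0..pi/2}" "a \<in> K" "proj_mat (geod r a) = proj_mat z"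
      using geod_surj[OF z ne] by blast
    have nz: "geod r a \<noteq> 0" using geod_nonzero K_subset_Omega ra by blast
    have gq: "g (proj_mat z) = w (r, a)" using g(2)[of "(r, a)"] ra by (simp add: q_def)
    have "cproj_mat (to_cproj (geod r a)) = cproj_mat (to_cproj z)"
      using ra(3) nz z by (simp add: cproj_mat_to_cproj)
    then have "to_cproj (geod r a) = to_cproj z" by (rule injD[OF inj_cproj_mat])
    then show ?thesis using v(2)[OF ra(1,2)] unfolding gq by (simp add: w_def to_cproj_scale)
  qed
  then show "\<exists>g. continuous_on (proj_mat ` (- {0 :: complex^('n option)})) g \<and>
      (\<forall>z. z \<noteq> 0 \<longrightarrow> g (proj_mat z) \<noteq> 0 \<and> to_cproj (g (proj_mat z)) = f (to_cproj z))"
    using g(1) unfolding img by blast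
qed

end

section \<open>Null-homotopic maps\<close>

lemma continuous_on_cproj_mat: "continuous_on UNIV cproj_mat"
proof -
  have "open (cproj_mat -` B :: 'a cproj set)" if "open B" for B
  proof -
    have "{z. z \<noteq> 0 \<and> to_cproj z \<in> cproj_mat -` B} = proj_mat -` B \<inter> (- {0 :: complex^'a option})"
      by (auto simp: cproj_mat_to_cproj)
    moreover have "open \<dots>"
      using continuous_open_preimage[OF Ck_on_continuous[OF Ck_on_proj_mat[of 0]] open_nonzero that]
      by (simp add: Int_commute)
    ultimately show ?thesis unfolding open_cproj_def by simp
  qed
  then show ?thesis by (simp add: continuous_on_open_vimage)
qed

lemma homotopic_to_cproj:
  fixes A B :: "'n::finite cproj \<Rightarrow> complex^('n option)"
  assumes A: "continuous_on UNIV A" and B: "continuous_on UNIV B"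
    and nz: "\<And>t p. t \<in> {0..1} \<Longrightarrow> (1 - t) *\<^sub>R A p + t *\<^sub>R B p \<noteq> 0"
  shows "homotopic_with_canon (\<lambda>_. True) UNIV UNIV (\<lambda>p. to_cproj (A p)) (\<lambda>p. to_cproj (B p))"
proof -
  let ?h = "\<lambda>x. to_cproj ((1 - fst x) *\<^sub>R A (snd x) + fst x *\<^sub>R B (snd x))"
  have "continuous_on ({0..1} \<times> UNIV) ?h"
  proof (rule continuous_on_compose2[OF continuous_on_to_cproj])
    show "continuous_on ({0..1} \<times> UNIV) (\<lambda>x. (1 - fst x) *\<^sub>R A (snd x) + fst x *\<^sub>R B (snd x))"
      by (intro continuous_intros continuous_on_compose2[OF A] continuous_on_compose2[OF B]) auto
  qed (use nz in auto)
  then have "continuous_map (prod_topology (top_of_set {0..1}) (top_of_set UNIV)) (top_of_set UNIV) ?h"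
    by (simp add: prod_topology_subtopology(1) prod_topology_euclidean)
  then show ?thesis
    by (subst homotopic_with) (auto intro!: exI[of _ ?h])
qed

text \<open>In each of the finitely many charts all real multiples of the image are parametrised
  smoothly by 2n + 1 real variables, hence form a null set in dimension 2n + 2.\<close>

lemma ex_ray_avoiding:
  fixes P :: "complex^('n::finite option)^('n option) \<Rightarrow> complex^('n option)"
  assumes "polynomial_function P"
  obtains e where "e \<noteq> 0" "\<And>t p. e \<noteq> t *\<^sub>R P (cproj_mat p)"
proof -
  let ?R = "\<lambda>i. range (\<lambda>x::real \<times> (complex^'n). fst x *\<^sub>R P (proj_mat (affine_lift i (snd x))))"
  have "negligible (?R i)" for i
  proof (rule negligible_differentiable_image_lowdim)
    show "DIM(real \<times> (complex^'n)) < DIM(complex^('n option))" by simp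
    have "Ck_on (Suc 0) UNIV (\<lambda>w. proj_mat (affine_lift i w))"
      by (rule Ck_on_compose[OF open_UNIV open_nonzero Ck_on_proj_mat Ck_on_affine_lift]) auto
    then have "(\<lambda>w. proj_mat (affine_lift i w)) differentiable (at w)" for w by simp
    then have "(\<lambda>w. P (proj_mat (affine_lift i w))) differentiable (at w)" for w
      using differentiable_chain_at[of "\<lambda>w. proj_mat (affine_lift i w)" w P]
        differentiable_at_polynomial_function[OF assms] by (simp add: o_def)
    then have d: "(\<lambda>x::real \<times> (complex^'n). P (proj_mat (affine_lift i (snd x)))) differentiable (at x)" for x
      using differentiable_chain_at[of snd x "\<lambda>w. P (proj_mat (affine_lift i w))"]
      by (simp add: o_def bounded_linear_imp_differentiable bounded_linear_snd)
    have "(\<lambda>x::real \<times> (complex^'n). fst x *\<^sub>R P (proj_mat (affine_lift i (snd x)))) differentiable (at x)" for x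
      by (intro differentiable_scaleR d bounded_linear_imp_differentiable[OF bounded_linear_fst])
    then show "(\<lambda>x::real \<times> (complex^'n). fst x *\<^sub>R P (proj_mat (affine_lift i (snd x)))) differentiable_on UNIV"
      by (simp add: differentiable_on_def)
  qed
  then have "negligible (\<Union>i. ?R i)" by (intro negligible_Union) auto
  then have "(\<Union>i. ?R i) \<noteq> UNIV" by (metis non_negligible_UNIV)
  then obtain e where e: "e \<notin> (\<Union>i. ?R i)" by blast
  have ne: "e \<noteq> t *\<^sub>R P (cproj_mat p)" for t p
  proof
    assume eq: "e = t *\<^sub>R P (cproj_mat p)"
    obtain z where z: "z \<noteq> 0" "p = to_cproj z" by (rule cproj_cases)
    then obtain i where i: "z $ i \<noteq> 0" by (auto simp: vec_eq_iff)
    have "p = to_cproj (affine_lift i (cchart i z))"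
      using affine_param_cchart[OF i] z by (simp add: affine_param_def)
    then have "cproj_mat p = proj_mat (affine_lift i (cchart i z))" by (simp add: cproj_mat_to_cproj)
    then have "e = fst (t, cchart i z) *\<^sub>R P (proj_mat (affine_lift i (snd (t, cchart i z))))" using eq by simp
    then show False using e by blast
  qed
  moreover from ne[of 0] have "e \<noteq> 0" by simp
  ultimately show ?thesis using that by blast
qed

text \<open>
  A polynomial approximation of the lift has image of dimension at most \<open>2n\<close>, hence misses a ray, and can
  be pushed away from it to a constant.
\<close>

lemma homotopically_trivial_of_lift:
  fixes f :: "'n::finite cproj \<Rightarrow> 'n cproj" and g :: "complex^('n option)^('n option) \<Rightarrow> complex^('n option)"
  assumes C: "compact (proj_mat ` (- {0 :: complex^('n option)}))"
    and g: "continuous_on (proj_mat ` (- {0 :: complex^('n option)})) g"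
    and lift: "\<And>z. z \<noteq> 0 \<Longrightarrow> g (proj_mat z) \<noteq> 0 \<and> to_cproj (g (proj_mat z)) = f (to_cproj z)"
  shows "homotopically_trivial f"
proof -
  let ?C = "proj_mat ` (- {0 :: complex^('n option)})"
  have M: "cproj_mat p \<in> ?C" for p :: "'n cproj"
  proof -
    obtain z where "z \<noteq> 0" "p = to_cproj z" by (rule cproj_cases)
    then show ?thesis by (simp add: cproj_mat_to_cproj)
  qed
  have gM: "g (cproj_mat p) \<noteq> 0" "to_cproj (g (cproj_mat p)) = f p" for p
  proof -
    obtain z where "z \<noteq> 0" "p = to_cproj z" by (rule cproj_cases)
    then show "g (cproj_mat p) \<noteq> 0" "to_cproj (g (cproj_mat p)) = f p" using lift[of z] by (auto simp: cproj_mat_to_cproj)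
  qed
  have "?C \<noteq> {}" using M by blast
  then obtain c0 where c0: "c0 \<in> ?C" "\<And>c. c \<in> ?C \<Longrightarrow> norm (g c0) \<le> norm (g c)"
    using continuous_attains_inf[OF C _ continuous_on_norm[OF g]] by blast
  have "norm (g c0) > 0" using c0(1) lift by auto
  \<comment> \<open>The tolerance is the minimum of the norm of \<open>g\<close>, so no segment from
    \<open>g\<close> to \<open>P\<close> meets 0.\<close>
  from Stone_Weierstrass_polynomial_function[OF C g this]
  obtain P where P: "polynomial_function P" "\<And>c. c \<in> ?C \<Longrightarrow> norm (g c - P c) < norm (g c0)"
    by (elim exE conjE) (simp only: Ball_def)
  obtain e where e: "e \<noteq> 0" "\<And>t p. e \<noteq> t *\<^sub>R P (cproj_mat p)"
    using ex_ray_avoiding[OF P(1)] by blast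
  have close: "norm (g (cproj_mat p) - P (cproj_mat p)) < norm (g (cproj_mat p))" for p
    using P(2)[OF M[of p]] c0(2)[OF M[of p]] by linarith
  have cg: "continuous_on UNIV (\<lambda>p. g (cproj_mat p))"
    by (rule continuous_on_compose2[OF g continuous_on_cproj_mat]) (use M in auto)
  have cP: "continuous_on UNIV (\<lambda>p. P (cproj_mat p))"
    by (rule continuous_on_compose2[OF continuous_on_polymonial_function[OF P(1), of UNIV] continuous_on_cproj_mat]) auto
  have "homotopic_with_canon (\<lambda>_. True) UNIV UNIV (\<lambda>p. to_cproj (g (cproj_mat p))) (\<lambda>p. to_cproj (P (cproj_mat p)))"
  proof (rule homotopic_to_cproj[OF cg cP], rule notI)
    fix t :: real and p :: "'n cproj" assume t: "t \<in> {0..1}"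
    let ?g = "g (cproj_mat p)" and ?P = "P (cproj_mat p)"
    assume "(1 - t) *\<^sub>R ?g + t *\<^sub>R ?P = 0"
    then have "?g = t *\<^sub>R (?g - ?P)" by (simp add: algebra_simps)
    then have "norm ?g = t * norm (?g - ?P)" using t by (metis abs_of_nonneg atLeastAtMost_iff norm_scaleR)
    also have "\<dots> \<le> 1 * norm (?g - ?P)" using t by (intro mult_right_mono) auto
    finally show False using close[of p] by simp
  qed
  moreover have "homotopic_with_canon (\<lambda>_. True) UNIV UNIV (\<lambda>p. to_cproj (P (cproj_mat p))) (\<lambda>p. to_cproj e)"
  proof (rule homotopic_to_cproj[OF cP continuous_on_const], rule notI)
    fix t :: real and p :: "'n cproj" assume t: "t \<in> {0..1}"
    let ?P = "P (cproj_mat p)"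
    assume 0: "(1 - t) *\<^sub>R ?P + t *\<^sub>R e = 0"
    show False
    proof (cases "t = 0")
      case True
      then show False using 0 close[of p] by simp
    next
      case False
      then have "e = (1 / t) *\<^sub>R (t *\<^sub>R e)" by simp
      also have "t *\<^sub>R e = - ((1 - t) *\<^sub>R ?P)" using 0 by (simp add: add_eq_0_iff add.commute)
      finally have "e = - ((1 - t) / t) *\<^sub>R ?P" by (simp only: scaleR_minus_left scaleR_minus_right scaleR_scaleR) simp
      then show False using e(2) by blast
    qed
  qed
  ultimately have "homotopic_with_canon (\<lambda>_. True) UNIV UNIV (\<lambda>p. to_cproj (g (cproj_mat p))) (\<lambda>p. to_cproj e)"
    by (rule homotopic_with_trans)
  then show ?thesis unfolding homotopically_trivial_def gM(2) by blast
qed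

section \<open>The equality case\<close>

context radial
begin

text \<open>If the projection at \<open>r\<close> killed a vector fixed by the projection at
  \<open>s\<close>, their difference would preserve its norm; uniform continuity makes this
  difference, as an operator, smaller than 1.\<close>

lemma ex_mesh: "\<exists>N. mesh f z0 v0 N"
proof -
  obtain B where B: "B > 0"
    "\<And>(A :: complex^('n option)^('n option)) x. norm (A *v x) \<le> norm A * norm x * B"
    using bounded_bilinear.pos_bounded[OF bounded_bilinear_matrix_vector_mult] by metis
  let ?D = "{0..pi/2} \<times> K" and ?q = "\<lambda>p. map_mat f (geod (fst p) (snd p))"
  have "continuous_on ?D ?q"
    by (rule continuous_on_subset[OF Ck_on_continuous[OF Ck_on_map_geod[of 0]]]) (use K_subset_Omega in auto)
  then have "uniformly_continuous_on ?D ?q"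
    by (intro compact_uniformly_continuous compact_Times compact_Icc compact_K)
  then obtain d where d: "d > 0" "\<And>p p'. p \<in> ?D \<Longrightarrow> p' \<in> ?D \<Longrightarrow> dist p' p < d \<Longrightarrow> dist (?q p') (?q p) < 1 / B"
    using B(1) unfolding uniformly_continuous_on_def by (metis zero_less_divide_1_iff)
  obtain N :: nat where N: "pi / (2 * d) < real N" using reals_Archimedean2 by blast
  have "0 < pi / (2 * d)" using d(1) by simp
  then have N0: "N \<ge> 1" using N by (cases N) auto
  have hd: "pi / (2 * real N) < d" using N N0 d(1) by (simp add: field_simps)
  have "map_mat f (geod r x) *v v \<noteq> 0"
    if r: "r \<in> {0..pi/2}" "s \<in> {0..pi/2}" "\<bar>r - s\<bar> \<le> pi / (2 * real N)" and x: "x \<in> K" "v \<noteq> 0"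
      and fx: "map_mat f (geod s x) *v v = v" for r s x v
  proof
    assume 0: "map_mat f (geod r x) *v v = 0"
    have "dist (r, x) (s, x) < d" using r(3) hd by (simp add: dist_Pair_Pair dist_real_def)
    then have "norm (map_mat f (geod r x) - map_mat f (geod s x)) < 1 / B"
      using d(2)[of "(s, x)" "(r, x)"] r x by (simp add: dist_norm)
    moreover have "(map_mat f (geod r x) - map_mat f (geod s x)) *v v = - v"
      using 0 fx by (simp add: matrix_vector_mult_diff_rdistrib)
    then have "norm v \<le> norm (map_mat f (geod r x) - map_mat f (geod s x)) * norm v * B"
      using B(2)[of "map_mat f (geod r x) - map_mat f (geod s x)" v] by simp
    ultimately have "norm v < (1 / B) * norm v * B"
      using x(2) B(1) by (smt (verit) mult_strict_right_mono zero_less_norm_iff)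
    then show False using B(1) by simp
  qed
  then have "mesh f z0 v0 N" by unfold_locales (use N0 in auto)
  then show ?thesis by blast
qed

text \<open>The first piece of the radial lift as a function of the point reached: it is smooth at
  all nonzero vectors, and a nonzero local lift of f near \<open>z0\<close>. It gives access to
  derivatives at the centre, where polar coordinates degenerate.\<close>

definition yhat :: "complex^('n option) \<Rightarrow> complex^('n option)" where
  "yhat z = map_mat f z *v v0"

abbreviation dy :: "complex^('n option) \<Rightarrow> complex^('n option) \<Rightarrow> complex^('n option)" where
  "dy z \<equiv> frechet_derivative yhat (at z)"

lemma Ck_on_yhat: "Ck_on k (- {0}) yhat"
  unfolding yhat_def[abs_def]
  by (intro Ck_on_bilinear[OF bounded_bilinear_matrix_vector_mult] open_nonzero Ck_on_map_mat smooth Ck_on_const)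

lemma yhat_deriv: "z \<noteq> 0 \<Longrightarrow> (yhat has_derivative dy z) (at z)"
  by (rule Ck_on_SucE[OF Ck_on_yhat]) simp

lemma yhat_z0: "yhat z0 = v0"
  unfolding yhat_def by (rule map_mat_fixes[where f=f, OF v0])

lemma yhat_curve_deriv:
  assumes "(z has_vector_derivative z') (at t)" "z t \<noteq> 0"
  shows "((\<lambda>s. yhat (z s)) has_vector_derivative dy (z t) z') (at t)"
  using vector_derivative_diff_chain_within[OF assms(1) has_derivative_at_withinI[OF yhat_deriv[OF assms(2)]]]
  by (simp add: o_def)

text \<open>The pulled-back metric at the base point in homogeneous coordinates; on vectors
  orthogonal to \<open>z0\<close> it is to be compared with the Euclidean inner product.\<close>

definition hh :: "complex^('n option) \<Rightarrow> complex^('n option) \<Rightarrow> real" where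
  "hh u v = Re (fs_form v0 (dy z0 u) (dy z0 v))"

lemma line_lift: "\<forall>\<^sub>F s in nhds 0. to_cproj (yhat (z0 + s *\<^sub>R u)) = f (to_cproj (z0 + s *\<^sub>R u))"
  and line_deriv: "((\<lambda>s. z0 + s *\<^sub>R u) has_vector_derivative u) (at 0)"
  and yhat_line_deriv: "((\<lambda>s. yhat (z0 + s *\<^sub>R u)) has_vector_derivative dy z0 u) (at 0)"
proof -
  show d: "((\<lambda>s. z0 + s *\<^sub>R u) has_vector_derivative u) (at 0)"
    by (auto intro!: derivative_eq_intros)
  show d2: "((\<lambda>s. yhat (z0 + s *\<^sub>R u)) has_vector_derivative dy z0 u) (at 0)"
    using yhat_curve_deriv[OF d] z0_nz by simp
  have "((\<lambda>s. yhat (z0 + s *\<^sub>R u)) \<longlongrightarrow> yhat (z0 + 0 *\<^sub>R u)) (nhds 0)"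
    by (rule iffD1[OF tendsto_at_iff_tendsto_nhds isContD[OF has_vector_derivative_continuous[OF d2]]])
  then have "\<forall>\<^sub>F s in nhds 0. yhat (z0 + s *\<^sub>R u) \<noteq> 0"
    by (rule tendsto_imp_eventually_ne) (simp add: yhat_z0 v0)
  then show "\<forall>\<^sub>F s in nhds 0. to_cproj (yhat (z0 + s *\<^sub>R u)) = f (to_cproj (z0 + s *\<^sub>R u))"
    by eventually_elim (simp add: yhat_def to_cproj_map_mat)
qed

lemma bilinear_hh: "bilinear hh"
proof -
  have "linear (dy z0)" by (rule has_derivative_linear[OF yhat_deriv[OF z0_nz]])
  then show ?thesis
    unfolding bilinear_def linear_iff hh_def by (auto simp: fs_form_linear)
qed

lemma hh_area_le:
  assumes "herm u z0 = 0" "herm v z0 = 0"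
  shows "hh u u * hh v v - (hh u v)\<^sup>2 \<le> (u \<bullet> u) * (v \<bullet> v) - (u \<bullet> v)\<^sup>2"
proof -
  have fs: "Re (fs_form z0 x y) = x \<bullet> y" if "herm x z0 = 0" for x y
    using that by (simp add: fs_form_unit[OF z0] Re_herm)
  have "Re (fs_form (yhat (z0 + 0 *\<^sub>R u)) (dy z0 u) (dy z0 u)) * Re (fs_form (yhat (z0 + 0 *\<^sub>R u)) (dy z0 v) (dy z0 v))
      - (Re (fs_form (yhat (z0 + 0 *\<^sub>R u)) (dy z0 u) (dy z0 v)))\<^sup>2
    \<le> Re (fs_form (z0 + 0 *\<^sub>R u) u u) * Re (fs_form (z0 + 0 *\<^sub>R u) v v) - (Re (fs_form (z0 + 0 *\<^sub>R u) u v))\<^sup>2"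
    by (rule lift_area_le[OF smooth area line_deriv _ yhat_line_deriv _ line_deriv _ yhat_line_deriv _ line_lift line_lift])
      (use z0_nz v0 yhat_z0 in auto)
  then show ?thesis by (simp add: yhat_z0 hh_def fs assms)
qed

end

context mesh
begin

lemma curv_0:
  assumes a: "a \<in> K" and q: "q \<in> {0..h}"
  shows "curv 0 a q 0 = sin q * Im (fs_form (yhat (geod q a)) (dy (geod q a) (\<i> *s a))
    (- sin q *\<^sub>R dy (geod q a) z0 + cos q *\<^sub>R dy (geod q a) a))"
proof -
  have nz: "geod q a \<noteq> 0" using geod_nonzero K_subset_Omega a by blast
  have dsurf: "surf 0 a differentiable (at p)" for p
    using Ck_on_surf[OF a, of "Suc 0"] unfolding Ck_on.simps(2) by blast
  have y: "surf 0 a p = yhat (geod (fst p) (cis (snd p) *s a))" for p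
    by (simp add: surf_def Y_def yhat_def)
  interpret L: linear "dy (geod q a)" by (rule has_derivative_linear[OF yhat_deriv[OF nz]])
  have "D1 (surf 0 a) (q, 0) = dy (geod q a) ((- sin q) *\<^sub>R z0 + cos q *\<^sub>R a)"
  proof (rule vector_derivative_unique_at[OF partial_derivatives(1)[OF dsurf]])
    show "((\<lambda>r. surf 0 a (r, 0)) has_vector_derivative dy (geod q a) ((- sin q) *\<^sub>R z0 + cos q *\<^sub>R a)) (at q)"
      using yhat_curve_deriv[OF geod_deriv_r nz] by (simp add: y)
  qed
  then have 1: "D1 (surf 0 a) (q, 0) = - sin q *\<^sub>R dy (geod q a) z0 + cos q *\<^sub>R dy (geod q a) a"
    by (simp add: L.add L.scale L.diff L.neg)
  have "D2 (surf 0 a) (q, 0) = dy (geod q a) (sin q *\<^sub>R (\<i> *s a))"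
  proof (rule vector_derivative_unique_at[OF partial_derivatives(2)[OF dsurf]])
    show "((\<lambda>\<theta>. surf 0 a (q, \<theta>)) has_vector_derivative dy (geod q a) (sin q *\<^sub>R (\<i> *s a))) (at 0)"
      using yhat_curve_deriv[OF geod_deriv_theta[of q a 0]] nz by (simp add: y)
  qed
  then have 2: "D2 (surf 0 a) (q, 0) = sin q *\<^sub>R dy (geod q a) (\<i> *s a)" by (simp add: L.scale)
  show ?thesis unfolding 1 2 fs_form_linear(3) by (simp add: y)
qed

text \<open>By \<open>norm_conn_less\<close> the curvature attains its bound on the whole ray inside
  the first annulus, and the limit towards the centre is taken.\<close>

lemma equality_at_base:
  assumes a: "a \<in> K" and big: "\<not> norm (conn N a) < 2 * pi"
  shows "1 \<le> \<bar>Im (fs_form v0 (dy z0 (\<i> *s a)) (dy z0 a))\<bar>"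
proof -
  \<comment> \<open>Both the curvature and its bound sin 2q vanish at the centre; this is their
    comparison after the common factor sin q is divided out, which keeps a nontrivial limit.\<close>
  define \<psi> where "\<psi> q = \<bar>Im (fs_form (yhat (geod q a)) (dy (geod q a) (\<i> *s a))
    (- sin q *\<^sub>R dy (geod q a) z0 + cos q *\<^sub>R dy (geod q a) a))\<bar> - cos q" for q
  have N0: "0 < N" using N by simp
  have small: "q \<in> {real 0 * h..real (Suc 0) * h}" if "q \<in> {0..h}" for q using that by simp
  have "\<psi> q \<ge> 0" if q: "q \<in> {0<..<h}" for q
  proof -
    have "\<not> 2 * \<bar>curv 0 a q 0\<bar> < sin (2 * q)"
      using norm_conn_less[OF a, of q 0] q big by auto
    then have "sin (2 * q) \<le> 2 * \<bar>curv 0 a q 0\<bar>" by simp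
    moreover have "q < pi" using jh(1)[OF N0 small, of q] q pi_gt_zero by auto
    then have "sin q > 0" using q by (intro sin_gt_zero) auto
    ultimately show ?thesis
      using curv_0[OF a, of q] q by (simp add: \<psi>_def sin_double abs_mult)
  qed
  moreover have "continuous_on (closure {0<..<h}) \<psi>"
  proof -
    have g: "geod q a \<noteq> 0" for q using geod_nonzero K_subset_Omega a by blast
    have cg: "continuous_on S (\<lambda>q. geod q a)" for S unfolding geod_def by (intro continuous_intros)
    have "Ck_on (Suc 0) (- {0}) yhat" by (rule Ck_on_yhat)
    then have cd: "continuous_on (- {0}) (\<lambda>z. dy z u)" for u unfolding Ck_on.simps by blast
    have c1: "continuous_on S (\<lambda>q. dy (geod q a) u)" for S u
      by (rule continuous_on_compose2[OF cd cg]) (use g in auto)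
    have c2: "continuous_on S (\<lambda>q. yhat (geod q a))" for S
      by (rule continuous_on_compose2[OF Ck_on_continuous[OF Ck_on_yhat[of 0]] cg]) (use g in auto)
    have nz: "herm (yhat (geod q a)) (yhat (geod q a)) \<noteq> 0" if "q \<in> {0..h}" for q
      using Y_nonzero[OF N0 a small[OF that]] by (simp add: Y_def yhat_def herm_self)
    show ?thesis
      unfolding \<psi>_def fs_form_alt closure_greaterThanLessThan[OF h(1)]
      by (intro continuous_intros herm_continuous_on c1 c2) (use nz in auto)
  qed
  moreover have "0 \<in> closure {0<..<h}" using h(1) by (simp add: closure_greaterThanLessThan)
  ultimately have "\<psi> 0 \<ge> 0" using continuous_ge_on_closure by blast
  then show ?thesis by (simp add: \<psi>_def yhat_z0)
qed

end

context radial
begin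

lemma trivial_or_isometric_at_base:
  assumes card: "CARD('n) \<ge> 2" and nt: "\<not> homotopically_trivial f"
    and uv: "herm u z0 = 0" "herm v z0 = 0"
  shows "hh u v = u \<bullet> v"
proof -
  obtain N where "mesh f z0 v0 N" using ex_mesh by blast
  then interpret mesh f z0 v0 N .
  have card3: "CARD('n option) \<ge> 3" using card by simp
  \<comment> \<open>One direction with small holonomy has degree zero, then so have all directions,
    and the resulting global lift would make f null-homotopic.\<close>
  have big: "\<not> norm (conn N a) < 2 * pi" if a: "a \<in> K" for a
  proof
    assume "norm (conn N a) < 2 * pi"
    then have "conn N a = 0" by (rule conn_eq_0[OF a])
    then have 0: "conn N b = 0" if "b \<in> K" for b using conn_zero_all[OF a _ that] by blast
    have "K \<noteq> {}" using a by blast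
    from global_lift[OF 0 this] nt show False using homotopically_trivial_of_lift by blast
  qed
  \<comment> \<open>Wirtinger's inequality read backwards: a Kaehler form of absolute value at least
    1 on the image of a complex line forces image area at least 1.\<close>
  have ge: "1 \<le> hh a a * hh (\<i> *s a) (\<i> *s a) - (hh a (\<i> *s a))\<^sup>2" if "herm a z0 = 0" "norm a = 1" for a
  proof -
    have a: "a \<in> K" using that by (simp add: K_def)
    let ?I = "Im (fs_form v0 (dy z0 (\<i> *s a)) (dy z0 a))"
    have "1\<^sup>2 \<le> \<bar>?I\<bar>\<^sup>2" by (intro power_mono equality_at_base[OF a big[OF a]]) auto
    then have "1 \<le> ?I\<^sup>2" by simp
    also have "\<dots> \<le> hh (\<i> *s a) (\<i> *s a) * hh a a - (hh (\<i> *s a) a)\<^sup>2"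
      unfolding hh_def by (rule fs_form_Cauchy_Schwarz[OF v0(1)])
    finally show ?thesis by (simp add: hh_def mult.commute Re_fs_form_sym[of v0 "dy z0 (\<i> *s a)" "dy z0 a"])
  qed
  show ?thesis
    by (rule area_equality_on_complex_lines[OF card3 bilinear_hh _ _ hh_area_le ge uv])
      (auto simp: hh_def Re_fs_form_sym Re_fs_form_nonneg)
qed

end

section \<open>Transfer from the base point to charts\<close>

lemma dchart_add_scale: "dchart i z (u - c *s z) = dchart i z u"
  by (simp add: dchart_def vec_eq_iff algebra_simps)

lemma dchart_surj:
  assumes "z $ i \<noteq> 0"
  shows "dchart i z (z $ i *s (affine_lift i u - affine_lift i 0)) = u"
proof -
  have "affine_lift i w $ Transposition.transpose None i (Some k) = w $ k" for w k
    by (simp add: affine_lift_def)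
  then show ?thesis using assms by (simp add: dchart_def vec_eq_iff power2_eq_square)
qed

theorem trivial_or_pullback_eq:
  fixes f :: "'n::finite cproj \<Rightarrow> 'n cproj"
  assumes card: "CARD('n) \<ge> 2" and f: "smooth_cproj f" "area_nonincreasing f"
    and nt: "\<not> homotopically_trivial f" and w: "w \<in> local_domain f i j"
  shows "pullback_fs f i j w u v = fubini_study w u v"
proof -
  define z0 where "z0 = affine_lift i w /\<^sub>R norm (affine_lift i w)"
  have z0: "norm z0 = 1" by (simp add: z0_def)
  have z0i: "z0 $ i \<noteq> 0" by (simp add: z0_def)
  have z0_eq: "z0 = of_real (1 / norm (affine_lift i w)) *s affine_lift i w"
    by (simp add: z0_def scaleR_vector_smult divide_inverse)
  have tz: "to_cproj z0 = affine_param i w"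
    unfolding z0_eq affine_param_def by (rule to_cproj_scale) auto
  have cz: "cchart i z0 = w"
    using affine_chart_eq[of z0 i] z0 affine_chart_param[of i w] tz by (metis norm_zero zero_neq_one)
  obtain v0 where v0: "v0 \<noteq> 0" "f (to_cproj z0) = to_cproj v0" by (rule cproj_cases)
  interpret radial f z0 v0 by unfold_locales (use f z0 v0 in auto)
  have v0j: "v0 $ j \<noteq> 0"
    using w v0 in_affine_domain_iff[OF v0(1), of j] by (simp add: local_domain_def flip: tz)
  have *: "pullback_fs f i j w (dchart i z0 x) (dchart i z0 y) = fubini_study w (dchart i z0 x) (dchart i z0 y)"
    if xy: "herm x z0 = 0" "herm y z0 = 0" for x y
  proof -
    have "pullback_fs f i j (cchart i (z0 + 0 *\<^sub>R x)) (dchart i (z0 + 0 *\<^sub>R x) x) (dchart i (z0 + 0 *\<^sub>R x) y)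
      = Re (fs_form (yhat (z0 + 0 *\<^sub>R x)) (dy z0 x) (dy z0 y))"
      by (rule pullback_lift[OF f(1) line_deriv _ yhat_line_deriv _ line_deriv _ yhat_line_deriv _ line_lift line_lift])
        (use z0i v0j yhat_z0 in auto)
    then have "pullback_fs f i j w (dchart i z0 x) (dchart i z0 y) = hh x y"
      by (simp add: cz yhat_z0 hh_def)
    also have "\<dots> = x \<bullet> y" by (rule trivial_or_isometric_at_base[OF card nt xy])
    also have "\<dots> = Re (fs_form z0 x y)" using xy by (simp add: fs_form_unit[OF z0] Re_herm)
    also have "\<dots> = fubini_study w (dchart i z0 x) (dchart i z0 y)"
      using fubini_study_chart[OF z0i, of x y] by (simp add: cz)
    finally show ?thesis .
  qed
  \<comment> \<open>A chart vector is lifted to homogeneous coordinates and then made orthogonal to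
    \<open>z0\<close>; \<open>dchart\<close> does not see the multiple of \<open>z0\<close> that is
    subtracted.\<close>
  define X where "X u = z0 $ i *s (affine_lift i u - affine_lift i 0)" for u
  define Z where "Z u = X u - herm (X u) z0 *s z0" for u
  have "dchart i z0 (Z u) = u" for u
    unfolding Z_def dchart_add_scale X_def by (rule dchart_surj[OF z0i])
  moreover have "herm (Z u) z0 = 0" for u
    using z0 by (simp add: Z_def herm_simps herm_self)
  ultimately show ?thesis using *[of "Z u" "Z v"] by simp
qed

section \<open>Topology of complex projective space\<close>

lemma open_affine_param_image:
  assumes "open U" shows "open (affine_param i ` U)"
proof -
  have "{z. z \<noteq> 0 \<and> to_cproj z \<in> affine_param i ` U} = {z. z $ i \<noteq> 0} \<inter> cchart i -` U"
  proof (intro equalityI subsetI CollectI IntI conjI)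
    fix z assume z: "z \<in> {z. z \<noteq> 0 \<and> to_cproj z \<in> affine_param i ` U}"
    then obtain w where w: "w \<in> U" "to_cproj z = affine_param i w" by auto
    then have "to_cproj z \<in> affine_domain i" unfolding affine_domain_eq_range by simp
    then show "z $ i \<noteq> 0" using z by (simp add: in_affine_domain_iff)
    have "cchart i z = w" using w(2) affine_chart_param[of i w] affine_chart_eq[of z i] z by auto
    then show "z \<in> cchart i -` U" using w by simp
  next
    fix z assume z: "z \<in> {z. z $ i \<noteq> 0} \<inter> cchart i -` U"
    then show "z \<noteq> 0" by auto
    show "to_cproj z \<in> affine_param i ` U"
      using z affine_param_cchart[of z i] by (metis (mono_tags, lifting) IntE image_eqI mem_Collect_eq vimageE)
  qed
  moreover have "open \<dots>"
    by (rule continuous_open_preimage[OF Ck_on_continuous[OF Ck_on_cchart[of 0]] open_nth_nonzero assms])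
  ultimately show ?thesis unfolding open_cproj_def by simp
qed

lemma continuous_on_affine_chart: "continuous_on (affine_domain i) (affine_chart i)"
proof -
  have "open (affine_chart i -` B \<inter> affine_domain i)" if "open B" for B
  proof -
    have "affine_chart i -` B \<inter> affine_domain i = affine_param i ` B"
      unfolding affine_domain_eq_range by (auto simp: affine_chart_param)
    then show ?thesis using open_affine_param_image[OF that] by simp
  qed
  then show ?thesis by (simp add: continuous_on_open_vimage[OF open_affine_domain])
qed

lemma range_to_cproj: "to_cproj ` (- {0}) = UNIV"
proof -
  have "p \<in> to_cproj ` (- {0})" for p :: "'a cproj"
    by (rule cproj_cases[of p]) auto
  then show ?thesis by blast
qed

lemma connected_cproj: "connected (UNIV :: 'n::finite cproj set)"
proof -
  have "1 \<le> CARD('n)" by (simp add: Suc_leI)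
  then have "connected (- {0 :: complex^('n option)})" by (intro connected_punctured_universe) simp
  from connected_continuous_image[OF continuous_on_to_cproj this] show ?thesis unfolding range_to_cproj .
qed

lemma compact_cproj: "compact (UNIV :: 'n::finite cproj set)"
proof -
  have "compact (to_cproj ` sphere (0 :: complex^('n option)) 1)"
    by (intro compact_continuous_image continuous_on_subset[OF continuous_on_to_cproj]) auto
  moreover have "p \<in> to_cproj ` sphere 0 1" for p :: "'n cproj"
  proof -
    obtain z where z: "z \<noteq> 0" "p = to_cproj z" by (rule cproj_cases)
    have "to_cproj (of_real (1 / norm z) *s z) = p" using z by (simp add: to_cproj_scale)
    moreover have "norm (complex_of_real (1 / norm z) *s z) = 1" using z(1) by (simp add: norm_vector_smult norm_divide)
    ultimately show ?thesis by (metis image_eqI mem_sphere_0)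
  qed
  then have "to_cproj ` sphere 0 1 = (UNIV :: 'n cproj set)" by blast
  ultimately show ?thesis by simp
qed

text \<open>The image of the compact space is closed after embedding by projections into a Euclidean
  space, and closedness is pulled back along the injective continuous map
  \<open>cproj_mat\<close>.\<close>

lemma closed_cproj_image:
  fixes f :: "'n::finite cproj \<Rightarrow> 'n cproj"
  assumes "continuous_on UNIV f"
  shows "closed (range f)"
proof -
  have "compact (cproj_mat ` range f)"
    by (intro compact_continuous_image continuous_on_subset[OF continuous_on_cproj_mat] assms compact_cproj subset_UNIV)
  then have "closed (cproj_mat ` range f)" by (rule compact_imp_closed)
  then have "closed (cproj_mat -` (cproj_mat ` range f))"
    by (rule closed_vimage[OF _ continuous_on_cproj_mat])
  then show ?thesis by (simp add: inj_vimage_image_eq inj_cproj_mat)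
qed

section \<open>Curves of speed at most one\<close>

text \<open>Fubini-Study speed at most 1, tested at each time on a lift chosen for that time and
  horizontal at that instant. This asks for no global lift and is stable under composition with
  infinitesimal isometries.\<close>

definition unit_curve :: "(real \<Rightarrow> 'n::finite cproj) \<Rightarrow> bool" where
  "unit_curve \<gamma> \<longleftrightarrow> (\<forall>t. \<exists>z z'. z t \<noteq> 0 \<and> (\<forall>\<^sub>F s in nhds t. \<gamma> s = to_cproj (z s)) \<and>
    (z has_vector_derivative z') (at t) \<and> herm z' (z t) = 0 \<and> norm z' \<le> norm (z t))"

lemma unit_curve_compose:
  fixes f :: "'n::finite cproj \<Rightarrow> 'n cproj"
  assumes f: "smooth_cproj f"
    and iso: "\<And>i j w u v. w \<in> local_domain f i j \<Longrightarrow> pullback_fs f i j w u v = fubini_study w u v"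
    and \<gamma>: "unit_curve \<gamma>"
  shows "unit_curve (f \<circ> \<gamma>)"
  unfolding unit_curve_def
proof
  fix t
  obtain z z' where z: "z t \<noteq> 0" "\<forall>\<^sub>F s in nhds t. \<gamma> s = to_cproj (z s)"
    "(z has_vector_derivative z') (at t)" "herm z' (z t) = 0" "norm z' \<le> norm (z t)"
    using \<gamma> unfolding unit_curve_def by blast
  obtain i where i: "z t $ i \<noteq> 0" using z(1) by (auto simp: vec_eq_iff)
  obtain v where v: "v \<noteq> 0" "f (to_cproj (z t)) = to_cproj v" by (rule cproj_cases)
  obtain j where j: "v $ j \<noteq> 0" using v(1) by (auto simp: vec_eq_iff)
  have dom: "cchart i (z t) \<in> local_domain f i j"
    using local_domain_cchart(1)[where f=f, OF i j] v(2) by simp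
  define y where "y s = affine_lift j (local_rep f i j (cchart i (z s)))" for s
  define y' where "y' = affine_lift j (frechet_derivative (local_rep f i j) (at (cchart i (z t))) (dchart i (z t) z')) - affine_lift j 0"
  have cz: "((\<lambda>s. cchart i (z s)) has_vector_derivative dchart i (z t) z') (at t)"
    using vector_derivative_diff_chain_within[OF z(3), of "cchart i" "dchart i (z t)"]
      cchart_has_derivative[OF i] by (simp add: o_def has_derivative_at_withinI)
  have "((\<lambda>s. local_rep f i j (cchart i (z s))) has_vector_derivative
      frechet_derivative (local_rep f i j) (at (cchart i (z t))) (dchart i (z t) z')) (at t)"
    using vector_derivative_diff_chain_within[OF cz, of "local_rep f i j"]
      local_rep_has_derivative[OF f dom] by (simp add: o_def has_derivative_at_withinI)
  from vector_derivative_diff_chain_within[OF this has_derivative_at_withinI[OF affine_lift_has_derivative]]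
  have y: "(y has_vector_derivative y') (at t)" by (simp add: o_def y_def[abs_def] y'_def)
  have yj: "y t $ j \<noteq> 0" by (simp add: y_def)
  have "((\<lambda>s. z s $ i) \<longlongrightarrow> z t $ i) (nhds t)"
    by (intro tendsto_vec_nth iffD1[OF tendsto_at_iff_tendsto_nhds]
        isContD has_vector_derivative_continuous[OF z(3)])
  then have e1: "\<forall>\<^sub>F s in nhds t. z s $ i \<noteq> 0" using i by (rule tendsto_imp_eventually_ne)
  have "((\<lambda>s. cchart i (z s)) \<longlongrightarrow> cchart i (z t)) (nhds t)"
    by (intro iffD1[OF tendsto_at_iff_tendsto_nhds] isContD has_vector_derivative_continuous[OF cz])
  then have e2: "\<forall>\<^sub>F s in nhds t. cchart i (z s) \<in> local_domain f i j"
    by (rule topological_tendstoD[OF _ open_local_domain[OF f] dom])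
  have ev: "\<forall>\<^sub>F s in nhds t. to_cproj (y s) = f (to_cproj (z s))"
    using e1 e2
  proof eventually_elim
    case (elim s)
    then have "f (to_cproj (z s)) \<in> affine_domain j" by (simp add: local_domain_def affine_param_cchart)
    from affine_param_chart[OF this] show ?case
      using elim by (simp add: y_def local_rep_def affine_param_cchart flip: affine_param_def)
  qed
  have "Re (fs_form (y t) y' y') = pullback_fs f i j (cchart i (z t)) (dchart i (z t) z') (dchart i (z t) z')"
    by (rule pullback_lift[OF f z(3) i y yj z(3) refl y refl ev ev, symmetric])
  also have "\<dots> = Re (fs_form (z t) z' z')"
    unfolding iso[OF dom] by (rule fubini_study_chart[OF i])
  also have "\<dots> = (norm z' / norm (z t))\<^sup>2"
    unfolding fs_form_perp[OF z(1)] using z(4) by (simp add: perp_def herm_self power_divide Re_divide_of_real flip: of_real_power)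
  also have "\<dots> \<le> 1\<^sup>2" using z(1,5) by (intro power_mono) auto
  finally have le: "Re (fs_form (y t) y' y') \<le> 1" by simp
  have yt: "y t \<noteq> 0" using yj by auto
  have "(norm (perp (y t) y'))\<^sup>2 / (norm (y t))\<^sup>2 \<le> 1"
    using le unfolding fs_form_perp[OF yt] by (simp add: herm_self Re_divide_of_real flip: of_real_power)
  then have nle: "norm (perp (y t) y') \<le> norm (y t)" using yt by (simp add: divide_le_eq power2_le_iff_abs_le)
  \<comment> \<open>Multiplying the lift by a scalar with value 1 and derivative
    \<open>- \<alpha>\<close> at \<open>t\<close> removes the vertical part of its velocity.\<close>
  define \<alpha> where "\<alpha> = herm y' (y t) / (norm (y t))\<^sup>2"
  define x where "x s = (1 - of_real (s - t) * \<alpha>) *s y s" for s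
  have "((\<lambda>s. 1 - complex_of_real (s - t) * \<alpha>) has_vector_derivative - \<alpha>) (at t)"
    by (auto intro!: derivative_eq_intros)
  from bounded_bilinear.has_vector_derivative[OF bounded_bilinear_vector_smult this y]
  have "(x has_vector_derivative (1 - complex_of_real (t - t) * \<alpha>) *s y' + (- \<alpha>) *s y t) (at t)"
    unfolding x_def[abs_def] .
  moreover have "(1 - complex_of_real (t - t) * \<alpha>) *s y' + (- \<alpha>) *s y t = perp (y t) y'"
    by (simp add: perp_def \<alpha>_def vec_eq_iff)
  ultimately have x: "(x has_vector_derivative perp (y t) y') (at t)" by (simp only:)
  have "((\<lambda>s. 1 - complex_of_real (s - t) * \<alpha>) \<longlongrightarrow> 1 - complex_of_real (t - t) * \<alpha>) (nhds t)"
    by (intro iffD1[OF tendsto_at_iff_tendsto_nhds] isContD continuous_intros)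
  then have e3: "\<forall>\<^sub>F s in nhds t. 1 - complex_of_real (s - t) * \<alpha> \<noteq> 0"
    by (rule tendsto_imp_eventually_ne) simp
  have "\<forall>\<^sub>F s in nhds t. (f \<circ> \<gamma>) s = to_cproj (x s)"
    using z(2) ev e3
  proof eventually_elim
    case (elim s)
    have "y s \<noteq> 0" by (simp add: y_def)
    with elim(3) have "to_cproj (x s) = to_cproj (y s)" unfolding x_def by (rule to_cproj_scale)
    then show ?case using elim by simp
  qed
  moreover have "herm (perp (y t) y') (x t) = 0"
    using yt by (simp add: x_def perp_def herm_simps herm_self)
  moreover have "x t = y t" by (simp add: x_def)
  ultimately show "\<exists>z z'. z t \<noteq> 0 \<and> (\<forall>\<^sub>F s in nhds t. (f \<circ> \<gamma>) s = to_cproj (z s)) \<and>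
    (z has_vector_derivative z') (at t) \<and> herm z' (z t) = 0 \<and> norm z' \<le> norm (z t)"
    using x nle yt by (intro exI[of _ x] exI[of _ "perp (y t) y'"]) simp
qed

lemma unit_curve_iterate:
  assumes "smooth_cproj f"
    and "\<And>i j w u v. w \<in> local_domain f i j \<Longrightarrow> pullback_fs f i j w u v = fubini_study w u v"
    and "unit_curve \<gamma>"
  shows "unit_curve ((f ^^ k) \<circ> \<gamma>)"
proof (induction k)
  case (Suc k)
  from unit_curve_compose[OF assms(1,2) this] show ?case by (simp add: o_def)
qed (simp add: assms)

definition outer :: "complex^'m::finite \<Rightarrow> complex^'m \<Rightarrow> complex^'m^'m" where
  "outer a b = (\<chi> i j. a $ i * cnj (b $ j))"

lemma bounded_bilinear_outer: "bounded_bilinear outer"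
  unfolding bilinear_conv_bounded_bilinear[symmetric] bilinear_def linear_iff outer_def
  by (auto simp: vec_eq_iff algebra_simps)

lemma proj_mat_outer: "proj_mat z = outer z z /\<^sub>R (z \<bullet> z)"
  by (simp add: proj_mat_def outer_def vec_eq_iff mult.commute scaleR_conv_of_real[of _ "_ :: complex"])

lemma unit_curve_dist:
  "\<exists>B>0. \<forall>\<gamma> :: real \<Rightarrow> 'n::finite cproj. unit_curve \<gamma> \<longrightarrow>
    (\<forall>r\<ge>0. dist (cproj_mat (\<gamma> r)) (cproj_mat (\<gamma> 0)) \<le> B * r)"
proof -
  obtain B where B: "B > 0" "\<And>a b :: complex^('n option). norm (outer a b) \<le> norm a * norm b * B"
    using bounded_bilinear.pos_bounded[OF bounded_bilinear_outer] by blast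
  have "dist (cproj_mat (\<gamma> r)) (cproj_mat (\<gamma> 0)) \<le> (2 * B) * r"
    if \<gamma>: "unit_curve \<gamma>" and r: "r \<ge> 0" for \<gamma> :: "real \<Rightarrow> 'n cproj" and r
  proof -
    have "\<exists>d. ((\<lambda>s. cproj_mat (\<gamma> s)) has_vector_derivative d) (at t) \<and> norm d \<le> 2 * B" for t
    proof -
      obtain z z' where z: "z t \<noteq> 0" "\<forall>\<^sub>F s in nhds t. \<gamma> s = to_cproj (z s)"
        "(z has_vector_derivative z') (at t)" "herm z' (z t) = 0" "norm z' \<le> norm (z t)"
        using \<gamma> unfolding unit_curve_def by blast
      define d where "d = (outer (z t) z' + outer z' (z t)) /\<^sub>R (z t \<bullet> z t)"
      have zz': "z' \<bullet> z t = 0" using z(4) Re_herm[of z' "z t"] by simp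
      have n: "((\<lambda>s. z s \<bullet> z s) has_real_derivative 0) (at t)"
        using bounded_bilinear.has_vector_derivative[OF bounded_bilinear_inner z(3) z(3)] zz'
        by (simp add: has_real_derivative_iff_has_vector_derivative inner_commute)
      have "((\<lambda>s. inverse (z s \<bullet> z s)) has_real_derivative - (inverse (z t \<bullet> z t) * 0 * inverse (z t \<bullet> z t))) (at t)"
        by (rule DERIV_inverse'[OF n]) (use z(1) in simp)
      then have "((\<lambda>s. inverse (z s \<bullet> z s)) has_vector_derivative 0) (at t)"
        by (simp add: has_real_derivative_iff_has_vector_derivative)
      from bounded_bilinear.has_vector_derivative[OF bounded_bilinear_scaleR this
          bounded_bilinear.has_vector_derivative[OF bounded_bilinear_outer z(3) z(3)]]
      have "((\<lambda>s. proj_mat (z s)) has_vector_derivative d) (at t)"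
        by (simp add: proj_mat_outer d_def)
      moreover have "((\<lambda>s. z s) \<longlongrightarrow> z t) (nhds t)"
        by (intro iffD1[OF tendsto_at_iff_tendsto_nhds] isContD has_vector_derivative_continuous[OF z(3)])
      then have "\<forall>\<^sub>F s in nhds t. z s \<noteq> 0" using z(1) by (rule tendsto_imp_eventually_ne)
      then have "\<forall>\<^sub>F s in nhds t. proj_mat (z s) = cproj_mat (\<gamma> s)"
        using z(2) by eventually_elim (simp add: cproj_mat_to_cproj)
      ultimately have "((\<lambda>s. cproj_mat (\<gamma> s)) has_vector_derivative d) (at t)"
        unfolding has_vector_derivative_def eventually_nhds_conv_at
        by (auto elim!: has_derivative_transform_eventually)
      moreover have "norm d \<le> 2 * B"
      proof -
        have "norm (outer (z t) z' + outer z' (z t)) \<le> norm (outer (z t) z') + norm (outer z' (z t))"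
          by (rule norm_triangle_ineq)
        also have "\<dots> \<le> 2 * B * (norm (z t) * norm z')"
          using B(2)[of "z t" z'] B(2)[of z' "z t"] by (simp add: algebra_simps)
        also have "\<dots> \<le> 2 * B * (norm (z t) * norm (z t))"
          using z(5) B(1) by (intro mult_left_mono) auto
        finally have "norm (outer (z t) z' + outer z' (z t)) \<le> 2 * B * (z t \<bullet> z t)"
          by (simp add: dot_square_norm power2_eq_square)
        then show ?thesis using z(1) by (simp add: d_def divide_inverse_commute[symmetric] divide_le_eq)
      qed
      ultimately show ?thesis by blast
    qed
    then obtain d where d: "\<And>t. ((\<lambda>s. cproj_mat (\<gamma> s)) has_vector_derivative d t) (at t)" "\<And>t. norm (d t) \<le> 2 * B"
      by metis
    have "norm (cproj_mat (\<gamma> r) - cproj_mat (\<gamma> 0)) \<le> 2 * B * r - 2 * B * 0"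
      by (rule norm_diff_le_of_deriv[OF has_vector_derivative_at_within[OF d(1)] _ d(2) r])
        (auto intro!: derivative_eq_intros)
    then show ?thesis by (simp add: dist_norm)
  qed
  then show ?thesis using B(1) by (intro exI[of _ "2 * B"]) auto
qed

context radial
begin

lemma unit_curve_geod:
  assumes "a \<in> K" shows "unit_curve (\<lambda>r. to_cproj (geod r a))"
  unfolding unit_curve_def
proof
  fix t
  have "herm ((- sin t) *\<^sub>R z0 + cos t *\<^sub>R a) (geod t a) = 0"
    using herm_K[OF assms] by (simp add: geod_def herm_simps herm_scaleR_left herm_scaleR_right algebra_simps)
  moreover have "herm ((- sin t) *\<^sub>R z0 + cos t *\<^sub>R a) ((- sin t) *\<^sub>R z0 + cos t *\<^sub>R a) = 1"
    using herm_K[OF assms] of_real_cos_sin_square[of t]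
    by (simp add: herm_simps herm_scaleR_left herm_scaleR_right algebra_simps)
  then have "(norm ((- sin t) *\<^sub>R z0 + cos t *\<^sub>R a))\<^sup>2 = 1"
    unfolding herm_self by (metis of_real_eq_1_iff)
  then have "norm ((- sin t) *\<^sub>R z0 + cos t *\<^sub>R a) = 1"
    by (metis norm_ge_zero one_power2 power2_eq_iff_nonneg zero_le_one)
  ultimately show "\<exists>z z'. z t \<noteq> 0 \<and> (\<forall>\<^sub>F s in nhds t. to_cproj (geod s a) = to_cproj (z s)) \<and>
      (z has_vector_derivative z') (at t) \<and> herm z' (z t) = 0 \<and> norm z' \<le> norm (z t)"
    using norm_geod[OF assms, of t] geod_deriv_r[of a t] 
    by (intro exI[of _ "\<lambda>s. geod s a"] exI[of _ "(- sin t) *\<^sub>R z0 + cos t *\<^sub>R a"]) auto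
qed

text \<open>The comparison opposite to \<open>unit_curve_dist\<close>: closeness of projections
  forces a small polar radius, since their difference applied to \<open>z0\<close> is sin r times a
  unit vector.\<close>

lemma sin_le_dist:
  assumes B: "\<And>(A :: complex^('n option)^('n option)) x. norm (A *v x) \<le> norm A * norm x * B"
    and a: "a \<in> K" and r: "r \<in> {0..pi/2}"
  shows "sin r \<le> dist (proj_mat (geod r a)) (proj_mat z0) * B"
proof -
  have "herm z0 (geod r a) = of_real (cos r)" using herm_K[OF a] by (simp add: geod_def herm_simps herm_scaleR_right)
  then have "(proj_mat (geod r a) - proj_mat z0) *v z0 = cos r *\<^sub>R geod r a - z0"
    using proj_mat_self[OF z0_nz, of 1]
    by (simp add: matrix_vector_mult_diff_rdistrib proj_mat_mult norm_geod[OF a] scaleR_vector_smult)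
  also have "\<dots> = sin r *\<^sub>R (cos r *\<^sub>R a - sin r *\<^sub>R z0)"
  proof -
    have "cos r *\<^sub>R geod r a - z0 = (cos r * cos r - 1) *\<^sub>R z0 + (cos r * sin r) *\<^sub>R a"
      by (simp add: geod_def algebra_simps)
    also have "cos r * cos r - 1 = - (sin r * sin r)" using sin_cos_squared_add3[of r] by linarith
    finally show ?thesis by (simp add: algebra_simps)
  qed
  finally have eq: "(proj_mat (geod r a) - proj_mat z0) *v z0 = sin r *\<^sub>R (cos r *\<^sub>R a - sin r *\<^sub>R z0)" .
  have "herm (cos r *\<^sub>R a - sin r *\<^sub>R z0) (cos r *\<^sub>R a - sin r *\<^sub>R z0) = 1"
    using herm_K[OF a] of_real_cos_sin_square[of r]
    by (simp add: herm_simps herm_scaleR_left herm_scaleR_right algebra_simps)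
  then have "(norm (cos r *\<^sub>R a - sin r *\<^sub>R z0))\<^sup>2 = 1"
    unfolding herm_self by (metis of_real_eq_1_iff)
  then have 1: "norm (cos r *\<^sub>R a - sin r *\<^sub>R z0) = 1"
    by (metis norm_ge_zero one_power2 power2_eq_iff_nonneg zero_le_one)
  have "sin r = norm ((proj_mat (geod r a) - proj_mat z0) *v z0)"
    unfolding eq using r by (simp add: 1 sin_ge_zero)
  also have "\<dots> \<le> norm (proj_mat (geod r a) - proj_mat z0) * norm z0 * B" by (rule B)
  finally show ?thesis by (simp add: z0 dist_norm)
qed

end

lemma small_sine:
  assumes "e > 0" shows "\<exists>d>0. \<forall>r\<in>{0..pi/2}. sin r < d \<longrightarrow> r < e"
proof (cases "e < pi/2")
  case True
  have "r < e" if "r \<in> {0..pi/2}" "sin r < sin e" for r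
    using that sin_monotone_2pi_le[of e r] assms True by (cases "e \<le> r") auto
  moreover have "sin e > 0" using assms True by (intro sin_gt_zero) auto
  ultimately show ?thesis by blast
next
  case False
  have "r < e" if "r \<in> {0..pi/2}" "sin r < 1" for r
    using that False by (cases "r = pi/2") auto
  then show ?thesis by (intro exI[of _ 1]) auto
qed

text \<open>Points with close projections are joined by a short geodesic. Every iterate of f maps it
  to a curve of speed at most 1, so the bound does not depend on the number of iterations.\<close>

lemma iterates_equicontinuous:
  fixes f :: "'n::finite cproj \<Rightarrow> 'n cproj"
  assumes card: "CARD('n) \<ge> 2" and f: "smooth_cproj f" "area_nonincreasing f"
    and iso: "\<And>i j w u v. w \<in> local_domain f i j \<Longrightarrow> pullback_fs f i j w u v = fubini_study w u v"
    and e: "e > 0"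
  shows "\<exists>d>0. \<forall>p q k. dist (cproj_mat q) (cproj_mat p) < d \<longrightarrow>
    dist (cproj_mat ((f ^^ k) q)) (cproj_mat ((f ^^ k) p)) < e"
proof -
  obtain C where C: "C > 0" "\<And>\<gamma> r. unit_curve (\<gamma> :: real \<Rightarrow> 'n cproj) \<Longrightarrow> r \<ge> 0 \<Longrightarrow>
      dist (cproj_mat (\<gamma> r)) (cproj_mat (\<gamma> 0)) \<le> C * r"
    using unit_curve_dist by blast
  obtain B where B: "B > 0"
    "\<And>(A :: complex^('n option)^('n option)) x. norm (A *v x) \<le> norm A * norm x * B"
    using bounded_bilinear.pos_bounded[OF bounded_bilinear_matrix_vector_mult] by metis
  obtain d where d: "d > 0" "\<And>r. r \<in> {0..pi/2} \<Longrightarrow> sin r < d \<Longrightarrow> r < e / C"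
    using small_sine[of "e / C"] e C(1) by auto
  have "dist (cproj_mat ((f ^^ k) q)) (cproj_mat ((f ^^ k) p)) < e"
    if pq: "dist (cproj_mat q) (cproj_mat p) < d / B" for p q k
  proof -
    obtain z where z: "z \<noteq> 0" "p = to_cproj z" by (rule cproj_cases)
    define z0 where "z0 = of_real (1 / norm z) *s z"
    have zz: "norm z0 = 1" "z0 \<noteq> 0" "p = to_cproj z0"
      using z by (simp_all add: z0_def norm_vector_smult norm_divide to_cproj_scale)
    obtain v0 where v0: "v0 \<noteq> 0" "f (to_cproj z0) = to_cproj v0" by (rule cproj_cases)
    interpret radial f z0 v0 by unfold_locales (use f zz v0 in auto)
    obtain y where y: "y \<noteq> 0" "q = to_cproj y" by (rule cproj_cases)
    obtain b0 where "b0 \<noteq> 0" "herm b0 z0 = 0"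
      using ex_orthogonal_two[of z0 z0] card by auto
    then have "b0 /\<^sub>R norm b0 \<in> K" by (simp add: K_def herm_scaleR_left)
    then have "K \<noteq> {}" by blast
    then obtain r a where ra: "r \<in> {0..pi/2}" "a \<in> K" "proj_mat (geod r a) = proj_mat y"
      using geod_surj[OF y(1)] by blast
    have nz: "geod r a \<noteq> 0" using norm_geod[OF ra(2), of r] by auto
    have "cproj_mat (to_cproj (geod r a)) = cproj_mat q" using ra(3) nz y by (simp add: cproj_mat_to_cproj)
    then have q: "to_cproj (geod r a) = q" by (rule injD[OF inj_cproj_mat])
    have "sin r \<le> dist (proj_mat (geod r a)) (proj_mat z0) * B" by (rule sin_le_dist[OF B(2) ra(2,1)])
    also have "\<dots> < d / B * B"
      using pq B(1) unfolding zz(3) y(2) cproj_mat_to_cproj[OF zz(2)] cproj_mat_to_cproj[OF y(1)] ra(3)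
      by (intro mult_strict_right_mono)
    finally have "r < e / C" using d(2)[OF ra(1)] B(1) by simp
    have "dist (cproj_mat (((f ^^ k) \<circ> (\<lambda>r. to_cproj (geod r a))) r)) (cproj_mat (((f ^^ k) \<circ> (\<lambda>r. to_cproj (geod r a))) 0)) \<le> C * r"
      using ra(1) by (intro C(2) unit_curve_iterate[OF f(1) iso] unit_curve_geod ra(2)) auto
    also have "\<dots> < e" using \<open>r < e / C\<close> C(1) by (simp add: field_simps)
    finally show ?thesis by (simp add: q zz(3))
  qed
  then show ?thesis using d(1) B(1) by (intro exI[of _ "d / B"]) auto
qed

section \<open>Infinitesimal isometries are isometries\<close>

text \<open>The Fubini--Study metric is \<open>(u, v) \<mapsto> fs_op w u \<bullet> v\<close>.\<close>

definition fs_op :: "complex^'n::finite \<Rightarrow> complex^'n \<Rightarrow> complex^'n" where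
  "fs_op w u = inverse ((1 + w \<bullet> w) * (1 + w \<bullet> w)) *\<^sub>R ((1 + w \<bullet> w) *\<^sub>R u - herm u w *s w)"

definition fs_op_inv :: "complex^'n::finite \<Rightarrow> complex^'n \<Rightarrow> complex^'n" where
  "fs_op_inv w u = (1 + w \<bullet> w) *\<^sub>R (u + herm u w *s w)"

lemma one_plus_inner_pos: "1 + w \<bullet> w > 0" for w :: "'a::real_inner"
  by (simp add: add_pos_nonneg)

lemma fs_op_inner: "fs_op w u \<bullet> v = fubini_study w u v"
proof -
  have key: "((1 + w \<bullet> w) *\<^sub>R u - herm u w *s w) \<bullet> v = (1 + (norm w)\<^sup>2) * Re (herm u v) - Re (herm u w * herm w v)"
    unfolding Re_herm[symmetric] power2_norm_eq_inner[symmetric]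
    by (simp add: herm_diff_left herm_scaleR_left herm_scale_left herm_self)
  have n: "(1 + (norm w)\<^sup>2)\<^sup>2 = (1 + w \<bullet> w) * (1 + w \<bullet> w)"
    by (simp add: power2_norm_eq_inner power2_eq_square[of "1 + w \<bullet> w"])
  show ?thesis
    unfolding fs_op_def fubini_study_def n by (simp only: inner_scaleR_left key divide_inverse mult.commute)
qed

lemma fs_op_inv_fs_op: "fs_op_inv w (fs_op w u) = u"
proof -
  define m where "m = 1 + w \<bullet> w"
  have m: "m \<noteq> 0" using one_plus_inner_pos[of w] by (simp add: m_def)
  have hw: "herm w w = of_real (m - 1)" by (simp add: m_def herm_self power2_norm_eq_inner)
  have op: "fs_op w u = inverse (m * m) *\<^sub>R (m *\<^sub>R u - herm u w *s w)" by (simp add: fs_op_def m_def)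
  have "herm (fs_op w u) w = inverse (m * m) *\<^sub>R herm u w"
    unfolding op by (simp add: herm_simps herm_scaleR_left hw scaleR_conv_of_real[of _ "_ :: complex"] algebra_simps)
  then have "fs_op_inv w (fs_op w u) = m *\<^sub>R (fs_op w u + (inverse (m * m) *\<^sub>R herm u w) *s w)"
    by (simp add: fs_op_inv_def m_def)
  also have "fs_op w u + (inverse (m * m) *\<^sub>R herm u w) *s w = inverse (m * m) *\<^sub>R (m *\<^sub>R u)"
    unfolding op scaleR_vector_smult_left by (simp add: algebra_simps)
  finally have "fs_op_inv w (fs_op w u) = (m * (inverse (m * m) * m)) *\<^sub>R u" by simp
  moreover have "m * (inverse (m * m) * m) = 1" using m by (simp add: field_simps)
  ultimately show ?thesis by (simp only: scaleR_one)
qed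

lemma Ck_on_inner_affine: "open S \<Longrightarrow> Ck_on k S (\<lambda>w. 1 + w \<bullet> w)"
  by (intro Ck_on_add Ck_on_const Ck_on_inner_self)

lemma Ck_on_fs_op:
  assumes "open S" shows "Ck_on k S (\<lambda>w. fs_op w u)"
proof -
  have id: "Ck_on k S (\<lambda>w. w)" by (rule Ck_on_bounded_linear_self[OF bounded_linear_ident assms])
  have neg: "Ck_on k S (\<lambda>w. (1 + w \<bullet> w) *\<^sub>R u + (- 1) *\<^sub>R (herm u w *s w))"
    by (intro Ck_on_add assms Ck_on_inner_affine id Ck_on_const Ck_on_bilinear[OF bounded_bilinear_scaleR]
        Ck_on_bilinear[OF bounded_bilinear_vector_smult] Ck_on_bilinear[OF bounded_bilinear_herm])
  have inv: "Ck_on k S (\<lambda>w. inverse ((1 + w \<bullet> w) * (1 + w \<bullet> w)))"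
  proof (rule Ck_on_inverse[OF assms])
    show "Ck_on k S (\<lambda>w. (1 + w \<bullet> w) * (1 + w \<bullet> w))"
      by (intro Ck_on_bilinear[OF bounded_bilinear_mult] assms Ck_on_inner_affine)
    show "(1 + x \<bullet> x) * (1 + x \<bullet> x) \<noteq> 0" for x :: "complex^'a"
      using one_plus_inner_pos[of x] by simp
  qed
  from Ck_on_bilinear[OF bounded_bilinear_scaleR assms inv neg] show ?thesis
    by (simp add: fs_op_def)
qed

lemma Ck_on_fs_op_inv:
  assumes "open S" "Ck_on k S \<gamma>" "Ck_on k S c"
  shows "Ck_on k S (\<lambda>x. fs_op_inv (\<gamma> x) (c x))"
  unfolding fs_op_inv_def
  by (intro Ck_on_add Ck_on_const assms Ck_on_bilinear[OF bounded_bilinear_scaleR]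
      Ck_on_bilinear[OF bounded_bilinear_inner]
      Ck_on_bilinear[OF bounded_bilinear_vector_smult] Ck_on_bilinear[OF bounded_bilinear_herm])

locale local_isometry =
  fixes f :: "'n::finite cproj \<Rightarrow> 'n cproj"
  assumes smooth: "smooth_cproj f"
    and iso: "\<And>i j w u v. w \<in> local_domain f i j \<Longrightarrow> pullback_fs f i j w u v = fubini_study w u v"
begin

abbreviation Df :: "'n option \<Rightarrow> 'n option \<Rightarrow> complex^'n \<Rightarrow> complex^'n \<Rightarrow> complex^'n" where
  "Df i j w \<equiv> frechet_derivative (local_rep f i j) (at w)"

text \<open>The adjoint of the derivative with respect to the Fubini--Study metrics, for an isometry its inverse.\<close>

definition Df_adj :: "'n option \<Rightarrow> 'n option \<Rightarrow> complex^'n \<Rightarrow> complex^'n \<Rightarrow> complex^'n" where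
  "Df_adj i j w v = fs_op_inv w (\<Sum>b\<in>Basis. (fs_op (local_rep f i j w) v \<bullet> Df i j w b) *\<^sub>R b)"

lemma Df_adj_Df:
  assumes "w \<in> local_domain f i j" shows "Df_adj i j w (Df i j w u) = u"
proof -
  have "fs_op (local_rep f i j w) (Df i j w u) \<bullet> Df i j w b = fs_op w u \<bullet> b" for b
    using iso[OF assms, of u b] by (simp add: fs_op_inner pullback_fs_def Let_def)
  then show ?thesis by (simp add: Df_adj_def euclidean_representation fs_op_inv_fs_op)
qed

lemma linear_Df_adj: "linear (Df_adj i j w)"
proof -
  have "fs_op x (u + v) = fs_op x u + fs_op x v" "fs_op x (r *\<^sub>R u) = r *\<^sub>R fs_op x u" for x u v :: "complex^'n" and r
    by (simp_all add: fs_op_def vec_eq_iff herm_simps herm_scaleR_left scaleR_conv_of_real[of _ "_ :: complex"] algebra_simps)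
  moreover have "fs_op_inv x (u + v) = fs_op_inv x u + fs_op_inv x v" "fs_op_inv x (r *\<^sub>R u) = r *\<^sub>R fs_op_inv x u" for x u v :: "complex^'n" and r
    by (simp_all add: fs_op_inv_def vec_eq_iff herm_simps herm_scaleR_left scaleR_conv_of_real[of _ "_ :: complex"] algebra_simps)
  ultimately show ?thesis
    unfolding Df_adj_def linear_iff
    by (simp add: inner_add_left scaleR_add_left sum.distrib flip: scaleR_scaleR scaleR_sum_right)
qed

lemma Df_Df_adj:
  assumes "w \<in> local_domain f i j" shows "Df i j w (Df_adj i j w v) = v"
proof -
  have l: "linear (Df i j w)" by (rule has_derivative_linear[OF local_rep_has_derivative[OF smooth assms]])
  have "inj (Df i j w)" using Df_adj_Df[OF assms] by (metis injI)
  then have "surj (Df i j w)" by (rule linear_inj_imp_surj[OF l])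
  then obtain u where "v = Df i j w u" by blast
  then show ?thesis using Df_adj_Df[OF assms] by simp
qed

lemma cont: "continuous_on UNIV f"
  using smooth by (simp add: smooth_cproj_def)

text \<open>In charts the derivative has \<open>Df_adj\<close> as a right inverse, so an open
  mapping theorem applies at each point.\<close>

lemma open_map:
  assumes "open U" shows "open (f ` U)"
proof (rule Topological_Spaces.openI)
  fix q assume "q \<in> f ` U"
  then obtain p where p: "p \<in> U" "q = f p" by blast
  obtain z where z: "z \<noteq> 0" "p = to_cproj z" by (rule cproj_cases)
  then obtain i where i: "z $ i \<noteq> 0" by (auto simp: vec_eq_iff)
  obtain y where y: "y \<noteq> 0" "f p = to_cproj y" by (rule cproj_cases)
  then obtain j where j: "y $ j \<noteq> 0" by (auto simp: vec_eq_iff)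
  let ?w = "cchart i z"
  have dom: "?w \<in> local_domain f i j" using local_domain_cchart(1)[where f=f, OF i j] y z by simp
  define S where "S = local_domain f i j \<inter> affine_param i -` U"
  have S: "open S"
    unfolding S_def
    by (intro open_Int open_local_domain[OF smooth] open_vimage[OF assms continuous_on_affine_param])
  have wS: "?w \<in> S" using dom p z by (simp add: S_def affine_param_cchart[OF i])
  have contS: "continuous_on S (local_rep f i j)"
    unfolding continuous_on_eq_continuous_at[OF S]
    using has_derivative_continuous[OF local_rep_has_derivative[OF smooth]] by (auto simp: S_def)
  have "local_rep f i j ?w \<in> interior (local_rep f i j ` S)"
    by (rule sussmann_open_mapping[OF S contS wS local_rep_has_derivative[OF smooth dom], where g'="Df_adj i j ?w"])
      (use linear_Df_adj Df_Df_adj[OF dom] S wS in \<open>auto simp: linear_conv_bounded_linear fun_eq_iff interior_open\<close>)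
  moreover have par: "affine_param j (local_rep f i j x) = f (affine_param i x)" if "x \<in> local_domain f i j" for x
    using that affine_param_chart[of "f (affine_param i x)" j] by (simp add: local_domain_def local_rep_def)
  ultimately have "q \<in> affine_param j ` interior (local_rep f i j ` S)"
    using par[OF dom] p z by (force simp: affine_param_cchart[OF i])
  moreover have "affine_param j ` interior (local_rep f i j ` S) \<subseteq> f ` U"
  proof
    fix x assume "x \<in> affine_param j ` interior (local_rep f i j ` S)"
    then obtain s where "s \<in> S" "x = affine_param j (local_rep f i j s)" using interior_subset by blast
    then show "x \<in> f ` U" using par by (auto simp: S_def)
  qed
  ultimately show "\<exists>T. open T \<and> q \<in> T \<and> T \<subseteq> f ` U"
    using open_affine_param_image[OF open_interior] by blast
qed

lemma surj: "surj f"
proof -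
  have "open (range f)" by (rule open_map) simp
  moreover have "closed (range f)" by (rule closed_cproj_image[OF cont])
  ultimately show ?thesis
    using connected_cproj[where 'n='n] connected_clopen[of "UNIV :: 'n cproj set"] by auto
qed

text \<open>
  If \<open>f p = f q\<close>, choose backward orbits of \<open>p\<close> and \<open>q\<close>. By compactness the two orbits nearly return
  simultaneously, and equicontinuity of the iterates carries this back to \<open>p \<approx> f\<^sup>m p = f\<^sup>m q \<approx> q\<close>.
\<close>

lemma inj:
  assumes card: "CARD('n) \<ge> 2" and area: "area_nonincreasing f"
  shows "inj f"
proof (rule injI)
  fix p q assume pq: "f p = f q"
  define g where "g = (\<lambda>p. SOME x. f x = p)"
  have g: "f (g x) = x" for x unfolding g_def by (rule someI_ex) (metis surj surjD)
  define X where "X k x = (g ^^ k) x" for k x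
  have fX: "(f ^^ k) (X (k + m) x) = X m x" for k m x
  proof (induction k)
    case (Suc k)
    have "(f ^^ Suc k) (X (Suc k + m) x) = (f ^^ k) (f (g (X (k + m) x)))"
      unfolding funpow_Suc_right by (simp add: X_def)
    then show ?case using Suc by (simp add: g)
  qed simp
  have "dist (cproj_mat p) (cproj_mat q) < e" if e: "e > 0" for e
  proof -
    obtain d where d: "d > 0" "\<And>p q k. dist (cproj_mat q) (cproj_mat p) < d \<Longrightarrow>
        dist (cproj_mat ((f ^^ k) q)) (cproj_mat ((f ^^ k) p)) < e / 2"
      using iterates_equicontinuous[OF card smooth area iso, of "e / 2"] e by auto
    obtain d' where d': "d' > 0" "\<And>p q k. dist (cproj_mat q) (cproj_mat p) < d' \<Longrightarrow>
        dist (cproj_mat ((f ^^ k) q)) (cproj_mat ((f ^^ k) p)) < d"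
      using iterates_equicontinuous[OF card smooth area iso d(1)] by auto
    let ?C = "range (cproj_mat :: 'n cproj \<Rightarrow> _)"
    have "compact ?C"
      by (rule compact_continuous_image[OF continuous_on_cproj_mat compact_cproj])
    then have C: "seq_compact (?C \<times> ?C)" by (simp add: compact_Times flip: compact_eq_seq_compact_metric)
    \<comment> \<open>The two backward orbits are treated as one sequence of pairs, so that a single
      return time \<open>m\<close> serves both.\<close>
    define W where "W k = (cproj_mat (X k p), cproj_mat (X k q))" for k
    have "\<forall>k. W k \<in> ?C \<times> ?C" by (simp add: W_def)
    then obtain l r where r: "strict_mono (r :: nat \<Rightarrow> nat)" and l: "(W \<circ> r) \<longlonglongrightarrow> l"
      by (rule seq_compactE[OF C])
    from metric_CauchyD[OF LIMSEQ_imp_Cauchy[OF l] d'(1)] obtain M where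
      M: "\<And>m n. m \<ge> M \<Longrightarrow> n \<ge> M \<Longrightarrow> dist ((W \<circ> r) m) ((W \<circ> r) n) < d'" by blast
    define i m where "i = r M" and "m = r (Suc M) - r M"
    have "r M < r (Suc M)" using r by (simp add: strict_mono_Suc_iff)
    then have m: "m \<ge> 1" "r (Suc M) = i + m" by (auto simp: i_def m_def)
    have dd: "dist (cproj_mat (X (i + m) p), cproj_mat (X (i + m) q)) (cproj_mat (X i p), cproj_mat (X i q)) < d'"
      using M[of "Suc M" M] m by (simp add: i_def W_def)
    \<comment> \<open>Equicontinuity is used twice: \<open>f ^^ i\<close> moves the near return at
      time \<open>i\<close> to one at time 0, so that \<open>X m x\<close> is close to
      \<open>x\<close>; then \<open>f ^^ m\<close> moves this to closeness of \<open>x\<close> and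
      \<open>(f ^^ m) x\<close>.\<close>
    have ret: "dist (cproj_mat x) (cproj_mat ((f ^^ m) x)) < e / 2"
      if "dist (cproj_mat (X (i + m) x)) (cproj_mat (X i x)) < d'" for x
    proof -
      have "dist (cproj_mat ((f ^^ i) (X (i + m) x))) (cproj_mat ((f ^^ i) (X (i + 0) x))) < d"
        using d'(2)[OF that] by simp
      then have "dist (cproj_mat (X m x)) (cproj_mat (X 0 x)) < d" unfolding fX .
      then have "dist (cproj_mat ((f ^^ m) (X (m + 0) x))) (cproj_mat ((f ^^ m) (X 0 x))) < e / 2"
        using d(2) by simp
      then show ?thesis unfolding fX by (simp add: X_def)
    qed
    \<comment> \<open>Here \<open>m\<close> is positive, so the first application of f already
      identifies \<open>p\<close> and \<open>q\<close>.\<close>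
    have "(f ^^ m) p = (f ^^ m) q" using m(1) pq by (cases m) (simp_all add: funpow_swap1)
    moreover have "dist (cproj_mat p) (cproj_mat ((f ^^ m) p)) < e / 2"
      using dd dist_fst_le[of "(cproj_mat (X (i + m) p), cproj_mat (X (i + m) q))"] by (intro ret) (force intro: le_less_trans)
    moreover have "dist (cproj_mat q) (cproj_mat ((f ^^ m) q)) < e / 2"
      using dd dist_snd_le[of "(cproj_mat (X (i + m) p), cproj_mat (X (i + m) q))"] by (intro ret) (force intro: le_less_trans)
    ultimately show ?thesis
      using dist_triangle_half_l[of "cproj_mat p" "cproj_mat ((f ^^ m) p)" e "cproj_mat q"] by simp
  qed
  then have "cproj_mat p = cproj_mat q" by (metis dist_eq_0_iff dist_not_less_zero less_irrefl not_less_iff_gr_or_eq)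
  then show "p = q" by (rule injD[OF inj_cproj_mat])
qed

lemma smooth_inv:
  assumes bij: "bij f" shows "smooth_cproj (inv f)"
  unfolding smooth_cproj_def
proof (intro conjI allI)
  let ?g = "inv f"
  have fg: "f (?g x) = x" for x using bij by (simp add: bij_is_surj surj_f_inv_f)
  show cg: "continuous_on UNIV ?g"
  proof -
    have "open (?g -` U)" if "open U" for U
      using open_map[OF that] bij by (simp add: bij_vimage_eq_inv_image bij_imp_bij_inv inv_inv_eq)
    then show ?thesis by (simp add: continuous_on_open_vimage)
  qed
  fix i j
  let ?S = "local_domain ?g i j" and ?\<gamma> = "local_rep ?g i j"
  have cgp: "continuous_on UNIV (\<lambda>w. ?g (affine_param i w))"
    by (rule continuous_on_compose2[OF cg continuous_on_affine_param]) simp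
  have "open ((\<lambda>w. ?g (affine_param i w)) -` affine_domain j)"
    by (rule open_vimage[OF open_affine_domain cgp])
  then have S: "open ?S" by (simp add: local_domain_def vimage_def)
  have c\<gamma>: "continuous_on ?S ?\<gamma>"
    unfolding local_rep_def o_def
    by (rule continuous_on_compose2[OF continuous_on_affine_chart continuous_on_subset[OF cgp]])
      (auto simp: local_domain_def)
  have par: "affine_param j (?\<gamma> w) = ?g (affine_param i w)" if "w \<in> ?S" for w
    using that by (simp add: local_domain_def local_rep_def affine_param_chart)
  have dom: "?\<gamma> w \<in> local_domain f j i" if "w \<in> ?S" for w
    using par[OF that] by (simp add: local_domain_def fg affine_domain_eq_range)
  have inv: "local_rep f j i (?\<gamma> w) = w" if "w \<in> ?S" for w
    using par[OF that] by (simp add: local_rep_def[of f] fg affine_chart_param)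
  have d: "(?\<gamma> has_derivative Df_adj j i (?\<gamma> w)) (at w)" if w: "w \<in> ?S" for w
  proof (rule has_derivative_inverse_basic[OF local_rep_has_derivative[OF smooth dom[OF w]] _ _ _ S w inv])
    show "bounded_linear (Df_adj j i (?\<gamma> w))" using linear_Df_adj by (simp add: linear_conv_bounded_linear)
    show "Df_adj j i (?\<gamma> w) \<circ> Df j i (?\<gamma> w) = id" using Df_adj_Df[OF dom[OF w]] by (simp add: fun_eq_iff)
    show "continuous (at w) ?\<gamma>" using c\<gamma> w by (simp add: continuous_on_eq_continuous_at[OF S])
  qed
  \<comment> \<open>Bootstrapping: the derivative of the inverse is given by the adjoint formula in
    terms of the inverse itself and of derivatives of f along it, so each order of smoothness yields
    the next.\<close>
  have "Ck_on k ?S ?\<gamma>" for k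
  proof (induction k)
    case 0
    show ?case using c\<gamma> by simp
  next
    case (Suc k)
    show ?case
    proof (rule Ck_on_SucI[OF S d])
      fix v
      have D: "Ck_on k ?S (\<lambda>w. Df j i (?\<gamma> w) b)" for b
      proof (rule Ck_on_compose[OF S open_local_domain[OF smooth] _ Suc dom])
        have "Ck_on (Suc k) (local_domain f j i) (local_rep f j i)"
          using smooth unfolding smooth_cproj_def smooth_on_def by blast
        then show "Ck_on k (local_domain f j i) (\<lambda>x. Df j i x b)" by simp
      qed
      \<comment> \<open>At the point \<open>?\<gamma> w\<close> the map f has the value
        \<open>w\<close>, so the metric operator on the target side is taken at
        \<open>w\<close>.\<close>
      have "Ck_on k ?S (\<lambda>w. fs_op_inv (?\<gamma> w) (\<Sum>b\<in>Basis. (fs_op w v \<bullet> Df j i (?\<gamma> w) b) *\<^sub>R b))"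
        by (intro Ck_on_fs_op_inv S Suc Ck_on_sum Ck_on_bilinear[OF bounded_bilinear_scaleR] Ck_on_const
            Ck_on_bilinear[OF bounded_bilinear_inner] Ck_on_fs_op D)
      then show "Ck_on k ?S (\<lambda>w. Df_adj j i (?\<gamma> w) v)"
        by (rule Ck_on_cong[OF S, rotated]) (simp add: Df_adj_def inv)
    qed
  qed
  then show "smooth_on ?S ?\<gamma>" by (simp add: smooth_on_def)
qed

end

theorem mainTheorem3:
  fixes f :: "'n::finite cproj \<Rightarrow> 'n cproj"
  assumes "CARD('n) \<ge> 2"
    and "smooth_cproj f"
    and "area_nonincreasing f"
  shows "homotopically_trivial f \<or> isometry_cproj f"
proof (cases "homotopically_trivial f")
  case False
  note iso = trivial_or_pullback_eq[OF assms False]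
  interpret local_isometry f by unfold_locales (use assms iso in auto)
  have "bij f" using inj[OF assms(1,3)] surj by (rule bijI)
  then show ?thesis using assms(2) smooth_inv iso by (simp add: isometry_cproj_def)
qed simp

end
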